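(* Let $D$ be a reduced alternating diagram of a knot $K$ and let $\Gamma_D$ be a balanced overlaid Tait graph for $D$. Then $\det(K)$ equals the number of dimer coverings (perfect matchings) of $\Gamma_D$.
   Context: The faces of a knot diagram $D$ are the connected components of the complement in the plane of the underlying $4$-valent curve. $D$ is reduced if at each crossing the four surrounding corners belong to four distinct faces; it is alternating if over- and under-crossings alternate as one travels along the knot. A balanced overlaid Tait (BOT) graph of $D$ is the bipartite graph $\Gamma_D=(V,W,E)$ where $V$ is the set of crossings of $D$, $W$ is the set of all bounded faces of $D$ except one omitted bounded face, the omitted face being adjacent to the unbounded face (separated from it by a portion of an arc of $D$), and $xy\in E$ if and only if the crossing $x$ is incident to the face $y$. A dimer covering of a graph is a set $m$ of edges such that each vertex is an endpoint of exactly one edge in $m$. The Fox coloring module $\mathrm{Col}(K)$ is the abelian group generated by the arcs of a diagram of $K$, with one relation $2a=b+c$ for each crossing, where $a$ is the over strand and $b,c$ are the under strands. Up to isomorphism it is independent of the diagram, and it has rank $1$. The determinant $\det(K)$ is the order of the torsion subgroup $T(\mathrm{Col}(K))$; equivalently it is the absolute value of the Alexander polynomial of $K$ at $-1$. *)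

theory Defs
  imports "HOL-Analysis.Analysis" "HOL-Algebra.Free_Abelian_Groups" "HOL-Algebra.Coset"
begin

section \<open>Knots in regular position and their diagrams\<close>

text \<open>
  A knot is parametrised by the unit circle and lives in \<open>\<complex> \<times> \<real>\<close>, that is, in 3-space. Its diagram
  is the projection to the plane \<open>\<complex>\<close>, together with the crossing information given by the
  heights in \<open>\<real>\<close>. Every diagram (a generic closed plane curve with a choice of over-strand at each
  double point) arises in this way from a knot in regular position.
\<close>

abbreviation circle :: "complex set"
  where "circle \<equiv> sphere 0 1"

definition knot_proj :: "(complex \<Rightarrow> complex \<times> real) \<Rightarrow> complex \<Rightarrow> complex"
  where "knot_proj K z = fst (K z)"

definition knot_height :: "(complex \<Rightarrow> complex \<times> real) \<Rightarrow> complex \<Rightarrow> real"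
  where "knot_height K z = snd (K z)"

definition shadow :: "(complex \<Rightarrow> complex \<times> real) \<Rightarrow> complex set"
  where "shadow K = knot_proj K ` circle"

definition crossings :: "(complex \<Rightarrow> complex \<times> real) \<Rightarrow> complex set"
  where "crossings K = {p. \<exists>x\<in>circle. \<exists>y\<in>circle. x \<noteq> y \<and> knot_proj K x = p \<and> knot_proj K y = p}"

text \<open>
  \<open>N\<close> is a neighbourhood of \<open>p\<close> in which the curve consists of two strands, parametrised by
  \<open>X\<close> and \<open>Y\<close>, that cross transversally at \<open>p\<close>: in a suitable chart \<open>N\<close> is the unit disc and the
  strands are its horizontal and vertical diameters. In particular \<open>p\<close> has exactly two preimages.
\<close>

definition crossing_nbhd :: "(complex \<Rightarrow> complex \<times> real) \<Rightarrow> complex \<Rightarrow> complex set \<Rightarrow> bool"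
  where "crossing_nbhd K p N \<longleftrightarrow>
    open N \<and> p \<in> N \<and>
    (\<exists>h h' X Y. homeomorphism N (ball (0::complex) 1) h h' \<and> h p = 0 \<and>
       connected X \<and> connected Y \<and> X \<inter> Y = {} \<and> X \<union> Y = {z \<in> circle. knot_proj K z \<in> N} \<and>
       inj_on (knot_proj K) X \<and> inj_on (knot_proj K) Y \<and>
       h ` knot_proj K ` X = {w \<in> ball 0 1. Im w = 0} \<and>
       h ` knot_proj K ` Y = {w \<in> ball 0 1. Re w = 0})"

definition regular_knot :: "(complex \<Rightarrow> complex \<times> real) \<Rightarrow> bool"
  where "regular_knot K \<longleftrightarrow>
    continuous_on circle K \<and> inj_on K circle \<and>
    finite (crossings K) \<and> (\<forall>p\<in>crossings K. \<exists>N. crossing_nbhd K p N)"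

definition faces :: "(complex \<Rightarrow> complex \<times> real) \<Rightarrow> complex set set"
  where "faces K = components (- shadow K)"

text \<open>
  The four corners at a crossing are the four open quadrants into which the two strands cut a
  neighbourhood as above.
\<close>

definition reduced_diagram :: "(complex \<Rightarrow> complex \<times> real) \<Rightarrow> bool"
  where "reduced_diagram K \<longleftrightarrow>
    (\<forall>p\<in>crossings K. \<forall>N. crossing_nbhd K p N \<longrightarrow>
      (\<forall>C\<in>components (N - shadow K). \<forall>C'\<in>components (N - shadow K).
        \<forall>F\<in>faces K. C \<subseteq> F \<and> C' \<subseteq> F \<longrightarrow> C = C'))"

text \<open>Parameters on the circle at which the knot passes over, respectively under, another strand.\<close>

definition over_params :: "(complex \<Rightarrow> complex \<times> real) \<Rightarrow> complex set"
  where "over_params K =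
    {x \<in> circle. \<exists>y\<in>circle. knot_proj K y = knot_proj K x \<and> knot_height K y < knot_height K x}"

definition under_params :: "(complex \<Rightarrow> complex \<times> real) \<Rightarrow> complex set"
  where "under_params K =
    {x \<in> circle. \<exists>y\<in>circle. knot_proj K y = knot_proj K x \<and> knot_height K x < knot_height K y}"

text \<open>
  Of any two consecutive passages \<open>x\<close> and \<open>x * cis t\<close> through crossings, exactly one is an
  over-passage.
\<close>

definition alternating_diagram :: "(complex \<Rightarrow> complex \<times> real) \<Rightarrow> bool"
  where "alternating_diagram K \<longleftrightarrow>
    (let P = over_params K \<union> under_params K in
      \<forall>x\<in>P. \<forall>t>0. x * cis t \<in> P \<and> (\<forall>s. 0 < s \<and> s < t \<longrightarrow> x * cis s \<notin> P) \<longrightarrow>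
        (x \<in> over_params K \<longleftrightarrow> x * cis t \<in> under_params K))"


section \<open>The Fox coloring module and the determinant\<close>

text \<open>
  Arcs run from under-crossing to under-crossing; they are represented by their sets of parameters.
  Without crossings there is one arc, the whole circle.
\<close>

definition arcs :: "(complex \<Rightarrow> complex \<times> real) \<Rightarrow> complex set set"
  where "arcs K = components (circle - under_params K)"

text \<open>The two under-strands at the under-passage \<open>x\<close> are the arcs ending and starting there.\<close>

definition arc_before :: "(complex \<Rightarrow> complex \<times> real) \<Rightarrow> complex \<Rightarrow> complex set"
  where "arc_before K x = (THE b. b \<in> arcs K \<and> (\<forall>\<^sub>F t in at_left 0. x * cis t \<in> b))"

definition arc_after :: "(complex \<Rightarrow> complex \<times> real) \<Rightarrow> complex \<Rightarrow> complex set"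
  where "arc_after K x = (THE c. c \<in> arcs K \<and> (\<forall>\<^sub>F t in at_right 0. x * cis t \<in> c))"

definition fox_relators :: "(complex \<Rightarrow> complex \<times> real) \<Rightarrow> (complex set \<Rightarrow>\<^sub>0 int) set"
  where "fox_relators K =
    {frag_cmul 2 (frag_of a) - frag_of (arc_before K x) - frag_of (arc_after K x) | x y a.
       x \<in> circle \<and> y \<in> circle \<and> knot_proj K x = knot_proj K y \<and> knot_height K x < knot_height K y \<and>
       a \<in> arcs K \<and> y \<in> a}"

definition fox_module :: "(complex \<Rightarrow> complex \<times> real) \<Rightarrow> (complex set \<Rightarrow>\<^sub>0 int) set monoid"
  where "fox_module K =
    free_Abelian_group (arcs K) Mod generate (free_Abelian_group (arcs K)) (fox_relators K)"

definition torsion_part :: "('a, 'b) monoid_scheme \<Rightarrow> 'a set"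
  where "torsion_part G = {g \<in> carrier G. \<exists>n::nat. n > 0 \<and> g [^]\<^bsub>G\<^esub> n = \<one>\<^bsub>G\<^esub>}"

definition knot_det :: "(complex \<Rightarrow> complex \<times> real) \<Rightarrow> nat"
  where "knot_det K = card (torsion_part (fox_module K))"


section \<open>Dimer coverings and balanced overlaid Tait graphs\<close>

text \<open>A graph is a pair of a vertex set and a set of edges, each edge being the set of its two
  endpoints.\<close>

type_synonym 'v graph = "'v set \<times> 'v set set"

definition dimer_coverings :: "'v graph \<Rightarrow> 'v set set set"
  where "dimer_coverings G = {m. m \<subseteq> snd G \<and> (\<forall>v\<in>fst G. \<exists>!e. e \<in> m \<and> v \<in> e)}"

definition adjacent_faces ::
    "(complex \<Rightarrow> complex \<times> real) \<Rightarrow> complex set \<Rightarrow> complex set \<Rightarrow> bool"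
  where "adjacent_faces K F F' \<longleftrightarrow>
    F \<in> faces K \<and> F' \<in> faces K \<and> F \<noteq> F' \<and>
    (\<exists>a\<in>arcs K. \<exists>J\<subseteq>a. connected J \<and> infinite J \<and> knot_proj K ` J \<subseteq> frontier F \<inter> frontier F')"

definition overlaid_graph ::
    "(complex \<Rightarrow> complex \<times> real) \<Rightarrow> complex set set \<Rightarrow> (complex + complex set) graph"
  where "overlaid_graph K W =
    (Inl ` crossings K \<union> Inr ` W,
     {{Inl x, Inr y} | x y. x \<in> crossings K \<and> y \<in> W \<and> x \<in> frontier y})"

definition bot_graph ::
    "(complex \<Rightarrow> complex \<times> real) \<Rightarrow> (complex + complex set) graph \<Rightarrow> bool"
  where "bot_graph K \<Gamma> \<longleftrightarrow>
    (\<exists>U\<in>faces K. \<exists>F\<^sub>0\<in>faces K. \<not> bounded U \<and> bounded F\<^sub>0 \<and> adjacent_faces K F\<^sub>0 U \<and>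
       \<Gamma> = overlaid_graph K ({F \<in> faces K. bounded F} - {F\<^sub>0}))"

end

theory Submission
  imports Defs "Jordan_Normal_Form.Determinant"
begin

text \<open>
  In an alternating diagram every edge (a piece of the knot between consecutive passages through
  crossings) has one end that passes under and one end that passes over. An edge is therefore a pair
  of a crossing and one of its two under half-edges, and so is an integer chain of edges a pair of
  integer functions on the crossings. This simple fact drives the proof; the locale
  \<open>alternating_map\<close> isolates the combinatorics that it needs.

  \<^emph>\<open>From arcs to faces.\<close> Number the arcs by the crossings that they pass over. The torsion of the Fox
  coloring module consists of the combinations of arcs with coefficient sum \<open>0\<close>, modulo the relators. Send an arc to the sum of the two faces beside the edge that
  leaves its over-crossing. Because the face sums of a potential difference vanish, this
  identifies the quotient with \<open>\<int>\<^sup>W\<close> modulo the rows of a square matrix: the crossing-face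
  incidence matrix in which a corner has sign \<open>+1\<close> or \<open>-1\<close> according as it lies beside the outgoing
  or the incoming over half-edge, with the columns of two adjacent faces deleted
  (\<open>row_space_imp_fox_combination\<close>, \<open>arc_faces_surj\<close>). The identification needs that an edge chain
  with vanishing face sums is a potential difference, that is, that the diagram lies on a sphere
  (\<open>exactness\<close>). The order of the quotient is the absolute value of the determinant
  (\<open>row_lattice_index\<close>), which is nonzero by a maximum principle (\<open>incidence_kernel_trivial\<close>).

  \<^emph>\<open>All terms of the determinant have the same sign.\<close> The nonzero terms of the Leibniz expansion are the
  matchings of crossings with incident faces, and each of them is \<open>+1\<close> or \<open>-1\<close>. If two of them had
  opposite signs, then by the intermediate value theorem a convex combination of the two partial
  matrices would be singular (\<open>opposite_terms_kernel\<close>). The signs of a kernel vector give a set of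
  crossings at each of which two matched faces have opposite signed values. This is impossible by
  an averaging argument: a product of corner sums has total \<open>0\<close> over the crossings for all choices of
  signs (\<open>sum_excess\<close>), but its mean over the free signs would be nonpositive at every crossing and
  negative at one of them (\<open>no_balanced_set\<close>).

  \<^emph>\<open>Plane topology.\<close> It remains to see the combinatorics in the plane. Along an edge the adjacent faces
  do not change, by Janiszewski's theorem (\<open>edge_all_or_nothing\<close>); at a crossing the chart shows that
  the four corners and the four half-edges alternate (\<open>closure_face_iff\<close>, \<open>local_orientation\<close>), and
  the corners lie in different faces since the diagram is reduced; and by the Jordan curve theorem
  there are at least two more faces than crossings (\<open>face_count\<close>). A diagram without crossings has one
  bounded face and a free coloring module, so that both sides are \<open>1\<close>.
\<close>

section \<open>The index of the row lattice of an integer matrix\<close>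

text \<open>
  Vectors are functions of the column index whose values beyond the number of columns are
  irrelevant.
\<close>

definition in_row_lattice :: "int mat \<Rightarrow> (nat \<Rightarrow> int) \<Rightarrow> bool"
  where "in_row_lattice A v \<longleftrightarrow>
    (\<exists>z. \<forall>j<dim_col A. v j = (\<Sum>i<dim_row A. z i * A $$ (i, j)))"

definition same_lattice :: "nat \<Rightarrow> int mat \<Rightarrow> int mat \<Rightarrow> bool"
  where "same_lattice n A B \<longleftrightarrow> A \<in> carrier_mat n n \<and> B \<in> carrier_mat n n \<and>
    \<bar>Determinant.det A\<bar> = \<bar>Determinant.det B\<bar> \<and> (\<forall>v. in_row_lattice A v \<longleftrightarrow> in_row_lattice B v)"

lemma same_lattice_refl: "A \<in> carrier_mat n n \<Longrightarrow> same_lattice n A A"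
  by (simp add: same_lattice_def)

lemma same_lattice_trans: "same_lattice n A B \<Longrightarrow> same_lattice n B C \<Longrightarrow> same_lattice n A C"
  by (simp add: same_lattice_def)

lemma same_lattice_addrow:
  assumes A: "A \<in> carrier_mat n n" and k: "k < n" and l: "l < n" and kl: "k \<noteq> l"
  shows "same_lattice n A (addrow a k l A)"
proof -
  have B: "addrow a k l A \<in> carrier_mat n n" using A by simp
  have ent: "addrow a k l A $$ (i, j) = (if i = k then a * A $$ (l, j) + A $$ (k, j) else A $$ (i, j))"
    if "i < n" "j < n" for i j
    using that A by auto
  have upd: "(\<Sum>i<n. (z(l := c)) i * A $$ (i, j)) = (\<Sum>i<n. z i * A $$ (i, j)) + (c - z l) * A $$ (l, j)"
    for z :: "nat \<Rightarrow> int" and c j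
    using l by (simp add: sum.remove[of "{..<n}" l] algebra_simps)
  have addsum: "(\<Sum>i<n. z i * addrow a k l A $$ (i, j)) = (\<Sum>i<n. z i * A $$ (i, j)) + z k * a * A $$ (l, j)"
    if "j < n" for z j
  proof -
    have "(\<Sum>i<n. z i * addrow a k l A $$ (i, j))
      = (\<Sum>i<n. z i * A $$ (i, j) + (if i = k then z k * a * A $$ (l, j) else 0))"
      by (rule sum.cong) (auto simp: ent that algebra_simps)
    also have "\<dots> = (\<Sum>i<n. z i * A $$ (i, j)) + z k * a * A $$ (l, j)"
      using k by (simp add: sum.distrib)
    finally show ?thesis .
  qed
  have "in_row_lattice A v \<longleftrightarrow> in_row_lattice (addrow a k l A) v" for v
  proof
    assume "in_row_lattice A v"
    then obtain z where z: "\<forall>j<n. v j = (\<Sum>i<n. z i * A $$ (i, j))"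
      using A by (auto simp: in_row_lattice_def)
    have "\<forall>j<n. v j = (\<Sum>i<n. (z(l := z l - z k * a)) i * addrow a k l A $$ (i, j))"
      using z kl by (simp add: addsum upd del: fun_upd_apply) (simp add: algebra_simps)
    then show "in_row_lattice (addrow a k l A) v"
      using A B unfolding in_row_lattice_def by auto
  next
    assume "in_row_lattice (addrow a k l A) v"
    then obtain z where z: "\<forall>j<n. v j = (\<Sum>i<n. z i * addrow a k l A $$ (i, j))"
      using B A by (auto simp: in_row_lattice_def)
    have "\<forall>j<n. v j = (\<Sum>i<n. (z(l := z l + z k * a)) i * A $$ (i, j))"
      using z kl by (simp add: addsum upd del: fun_upd_apply)
    then show "in_row_lattice A v"
      using A unfolding in_row_lattice_def by auto
  qed
  then show ?thesis
    using A B det_addrow[OF l kl A] by (simp add: same_lattice_def)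
qed

lemma same_lattice_swaprows:
  assumes A: "A \<in> carrier_mat n n" and k: "k < n" and l: "l < n" and kl: "k \<noteq> l"
  shows "same_lattice n A (swaprows k l A)"
proof -
  let ?B = "swaprows k l A"
  have B: "?B \<in> carrier_mat n n" using A by simp
  have ent: "?B $$ (i, j) = A $$ (Transposition.transpose k l i, j)" if "i < n" "j < n" for i j
    using that A by (auto simp: Transposition.transpose_def)
  have perm: "(\<Sum>i<n. z (Transposition.transpose k l i) * ?B $$ (i, j)) = (\<Sum>i<n. z i * A $$ (i, j))"
    if "j < n" for z :: "nat \<Rightarrow> int" and j
  proof -
    have "Transposition.transpose k l permutes {..<n}"
      using k l by (intro permutes_swap_id) auto
    from sum.permute[OF this, of "\<lambda>i. z i * A $$ (i, j)"]
    have "(\<Sum>i<n. z i * A $$ (i, j)) = (\<Sum>i<n. z (Transposition.transpose k l i) * A $$ (Transposition.transpose k l i, j))"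
      by (simp add: o_def)
    also have "\<dots> = (\<Sum>i<n. z (Transposition.transpose k l i) * ?B $$ (i, j))"
      by (rule sum.cong) (auto simp: ent that)
    finally show ?thesis by simp
  qed
  have "in_row_lattice A v \<longleftrightarrow> in_row_lattice ?B v" for v
  proof
    assume "in_row_lattice A v"
    then obtain z where z: "\<forall>j<n. v j = (\<Sum>i<n. z i * A $$ (i, j))"
      using A by (auto simp: in_row_lattice_def)
    have "\<forall>j<n. v j = (\<Sum>i<n. (z \<circ> Transposition.transpose k l) i * ?B $$ (i, j))"
      using z by (simp add: perm)
    then show "in_row_lattice ?B v"
      using A B unfolding in_row_lattice_def carrier_mat_def by auto
  next
    assume "in_row_lattice ?B v"
    then obtain z where z: "\<forall>j<n. v j = (\<Sum>i<n. z i * ?B $$ (i, j))"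
      using B A by (auto simp: in_row_lattice_def)
    have "\<forall>j<n. v j = (\<Sum>i<n. (z \<circ> Transposition.transpose k l) i * A $$ (i, j))"
      using z perm[of _ "z \<circ> Transposition.transpose k l"] by (simp add: o_def)
    then show "in_row_lattice A v"
      using A unfolding in_row_lattice_def by auto
  qed
  then show ?thesis
    using A B det_swaprows[OF k l kl A] by (simp add: same_lattice_def)
qed

text \<open>
  Euclid's algorithm in column \<open>k\<close>, from the diagonal downwards. The sum of the absolute values
  decreases as long as two of these entries are nonzero; the last nonzero entry is then swapped into
  the diagonal.
\<close>

lemma clear_column:
  assumes "A \<in> carrier_mat n n" and k: "k < n"
    and "\<And>i j. j < k \<Longrightarrow> j < i \<Longrightarrow> i < n \<Longrightarrow> A $$ (i, j) = 0"
  shows "\<exists>B. same_lattice n A B \<and> (\<forall>i j. j < Suc k \<longrightarrow> j < i \<longrightarrow> i < n \<longrightarrow> B $$ (i, j) = 0)"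
  using assms(1,3)
proof (induction "\<Sum>i=k..<n. nat \<bar>A $$ (i, k)\<bar>" arbitrary: A rule: less_induct)
  case less
  note A = less.prems(1)
  note tri = less.prems(2)
  have step: "\<exists>B. same_lattice n A B \<and> (\<forall>i j. j < Suc k \<longrightarrow> j < i \<longrightarrow> i < n \<longrightarrow> B $$ (i, j) = 0)"
    if il: "i \<in> {k..<n}" "l \<in> {k..<n}" "i \<noteq> l" and nz: "A $$ (l, k) \<noteq> 0"
      and le: "\<bar>A $$ (l, k)\<bar> \<le> \<bar>A $$ (i, k)\<bar>" for i l
  proof -
    define a :: int where "a = - (A $$ (i, k) div A $$ (l, k))"
    let ?A' = "addrow a i l A"
    have il': "i < n" "l < n" using il by auto
    have new: "?A' $$ (i, k) = A $$ (i, k) mod A $$ (l, k)"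
      using A il' k by (simp add: a_def minus_div_mult_eq_mod[symmetric] algebra_simps)
    have oth: "?A' $$ (m, k) = A $$ (m, k)" if "m < n" "m \<noteq> i" for m
      using A that il' k by simp
    have dec: "nat \<bar>?A' $$ (i, k)\<bar> < nat \<bar>A $$ (i, k)\<bar>"
      using nz le new abs_mod_less[OF nz, of "A $$ (i, k)"] by auto
    have "(\<Sum>m=k..<n. nat \<bar>?A' $$ (m, k)\<bar>) < (\<Sum>m=k..<n. nat \<bar>A $$ (m, k)\<bar>)"
    proof (rule sum_strict_mono_ex1)
      show "\<forall>m\<in>{k..<n}. nat \<bar>?A' $$ (m, k)\<bar> \<le> nat \<bar>A $$ (m, k)\<bar>"
      proof
        fix m assume "m \<in> {k..<n}"
        then show "nat \<bar>?A' $$ (m, k)\<bar> \<le> nat \<bar>A $$ (m, k)\<bar>"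
          using dec oth[of m] by (cases "m = i") auto
      qed
    qed (use dec il in auto)
    moreover have "?A' \<in> carrier_mat n n" using A by simp
    moreover have "?A' $$ (m, j) = 0" if "j < k" "j < m" "m < n" for m j
      using that A il il' tri[of j m] tri[of j l] k by auto
    ultimately obtain B where "same_lattice n ?A' B"
      "\<forall>i j. j < Suc k \<longrightarrow> j < i \<longrightarrow> i < n \<longrightarrow> B $$ (i, j) = 0"
      using less.hyps[of ?A'] by blast
    moreover have "same_lattice n A ?A'"
      using same_lattice_addrow[OF A il' \<open>i \<noteq> l\<close>] .
    ultimately show ?thesis using same_lattice_trans by blast
  qed
  show ?case
  proof (cases "\<exists>i\<in>{k..<n}. \<exists>l\<in>{k..<n}. i \<noteq> l \<and> A $$ (i, k) \<noteq> 0 \<and> A $$ (l, k) \<noteq> 0")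
    case True
    then obtain i l where *: "i \<in> {k..<n}" "l \<in> {k..<n}" "i \<noteq> l" "A $$ (i, k) \<noteq> 0" "A $$ (l, k) \<noteq> 0"
      by blast
    show ?thesis
    proof (cases "\<bar>A $$ (l, k)\<bar> \<le> \<bar>A $$ (i, k)\<bar>")
      case True
      then show ?thesis using step[of i l] * by blast
    next
      case False
      then show ?thesis using step[of l i] * by force
    qed
  next
    case False
    show ?thesis
    proof (cases "\<exists>l\<in>{k<..<n}. A $$ (l, k) \<noteq> 0")
      case True
      then obtain l where l: "l \<in> {k<..<n}" "A $$ (l, k) \<noteq> 0" by blast
      have z: "A $$ (i, k) = 0" if "i \<in> {k..<n}" "i \<noteq> l" for i
        using False that l by force
      have "same_lattice n A (swaprows k l A)"
        using same_lattice_swaprows[OF A k] l by auto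
      moreover have "swaprows k l A $$ (i, j) = 0" if "j < Suc k" "j < i" "i < n" for i j
      proof (cases "j = k")
        case True
        then show ?thesis using that A l k z[of i] z[of k] by auto
      next
        case False
        then have "j < k" using that by simp
        then show ?thesis using that A l k tri[of j i] tri[of j k] tri[of j l] by auto
      qed
      ultimately show ?thesis by blast
    next
      case False
      then have "A $$ (i, j) = 0" if "j < Suc k" "j < i" "i < n" for i j
        using that tri[of j i] by (cases "j = k") auto
      then show ?thesis using same_lattice_refl[OF A] by blast
    qed
  qed
qed

lemma triangular_basis:
  assumes A: "A \<in> carrier_mat n n"
  shows "\<exists>B. same_lattice n A B \<and> upper_triangular B"
proof -
  have "\<exists>B. same_lattice n A B \<and> (\<forall>i j. j < k \<longrightarrow> j < i \<longrightarrow> i < n \<longrightarrow> B $$ (i, j) = 0)"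
    if "k \<le> n" for k
    using that
  proof (induction k)
    case 0
    then show ?case using same_lattice_refl[OF A] by auto
  next
    case (Suc k)
    from Suc.IH[OF Suc_leD[OF Suc.prems]] obtain B where B: "same_lattice n A B"
      "\<forall>i j. j < k \<longrightarrow> j < i \<longrightarrow> i < n \<longrightarrow> B $$ (i, j) = 0"
      by blast
    then have Bc: "B \<in> carrier_mat n n" by (simp add: same_lattice_def)
    have "k < n" using Suc.prems by simp
    from clear_column[OF Bc this] B(2) obtain B' where B': "same_lattice n B B'"
      "\<forall>i j. j < Suc k \<longrightarrow> j < i \<longrightarrow> i < n \<longrightarrow> B' $$ (i, j) = 0"
      by blast
    have "same_lattice n A B'" using same_lattice_trans[OF B(1) B'(1)] .
    then show ?case using B'(2) by blast
  qed
  from this[OF order_refl] obtain B where B: "same_lattice n A B"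
    "\<forall>i j. j < n \<longrightarrow> j < i \<longrightarrow> i < n \<longrightarrow> B $$ (i, j) = 0" by blast
  then have "upper_triangular B"
    by (auto simp: same_lattice_def upper_triangular_def)
  with B show ?thesis by auto
qed

lemma sum_upper_triangular:
  fixes z :: "nat \<Rightarrow> int"
  assumes "upper_triangular B" "B \<in> carrier_mat n n" "j < n"
  shows "(\<Sum>i<n. z i * B $$ (i, j)) = (\<Sum>i<j. z i * B $$ (i, j)) + z j * B $$ (j, j)"
proof -
  have "(\<Sum>i<n. z i * B $$ (i, j)) = (\<Sum>i\<in>{..j}. z i * B $$ (i, j))"
    using assms by (intro sum.mono_neutral_right) (auto simp: upper_triangular_def)
  also have "\<dots> = (\<Sum>i<j. z i * B $$ (i, j)) + z j * B $$ (j, j)"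
    by (simp add: lessThan_Suc_atMost[symmetric])
  finally show ?thesis .
qed

text \<open>
  The division algorithm, column by column: subtracting a multiple of row \<open>k\<close> brings coordinate \<open>k\<close>
  into its range without disturbing the previous coordinates, since the matrix is upper triangular.
\<close>

lemma residue_exists:
  assumes B: "B \<in> carrier_mat n n" "upper_triangular B" and nz: "\<And>i. i < n \<Longrightarrow> B $$ (i, i) \<noteq> 0"
  shows "\<exists>r\<in>PiE {..<n} (\<lambda>i. {0..<\<bar>B $$ (i, i)\<bar>}). in_row_lattice B (\<lambda>j. v j - r j)"
proof -
  have "\<exists>z. \<forall>j<k. v j - (\<Sum>i<n. z i * B $$ (i, j)) \<in> {0..<\<bar>B $$ (j, j)\<bar>}" if "k \<le> n" for k
    using that
  proof (induction k)
    case (Suc k)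
    then obtain z where z: "\<forall>j<k. v j - (\<Sum>i<n. z i * B $$ (i, j)) \<in> {0..<\<bar>B $$ (j, j)\<bar>}"
      by auto
    define d where "d = B $$ (k, k)"
    define w where "w = v k - (\<Sum>i<k. z i * B $$ (i, k))"
    define z' where "z' = z(k := sgn d * (w div \<bar>d\<bar>))"
    have d: "d \<noteq> 0" using nz Suc.prems by (simp add: d_def)
    have k: "k < n" using Suc.prems by simp
    have same: "(\<Sum>i<j. z' i * B $$ (i, j)) = (\<Sum>i<j. z i * B $$ (i, j))" if "j \<le> k" for j
      using that by (intro sum.cong) (auto simp: z'_def)
    have "v j - (\<Sum>i<n. z' i * B $$ (i, j)) \<in> {0..<\<bar>B $$ (j, j)\<bar>}" if j: "j < Suc k" for j
    proof (cases "j = k")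
      case True
      have "v k - (\<Sum>i<n. z' i * B $$ (i, k)) = w - (w div \<bar>d\<bar>) * \<bar>d\<bar>"
        using sum_upper_triangular[OF B(2,1) k, of z'] same[of k]
        by (simp add: w_def z'_def d_def[symmetric] abs_sgn algebra_simps)
      also have "\<dots> = w mod \<bar>d\<bar>" by (simp add: minus_div_mult_eq_mod)
      finally show ?thesis using True d by (simp add: d_def[symmetric])
    next
      case False
      then have "j < k" "j < n" and z'j: "z' j = z j" using j k by (auto simp: z'_def)
      then show ?thesis
        using z[rule_format, OF \<open>j < k\<close>] sum_upper_triangular[OF B(2,1) \<open>j < n\<close>, of z'] same[of j]
          sum_upper_triangular[OF B(2,1) \<open>j < n\<close>, of z] z'j by simp
    qed
    then show ?case by blast
  qed auto
  from this[of n] obtain z where z: "\<forall>j<n. v j - (\<Sum>i<n. z i * B $$ (i, j)) \<in> {0..<\<bar>B $$ (j, j)\<bar>}"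
    by auto
  define r where "r = restrict (\<lambda>j. v j - (\<Sum>i<n. z i * B $$ (i, j))) {..<n}"
  have "r \<in> PiE {..<n} (\<lambda>i. {0..<\<bar>B $$ (i, i)\<bar>})"
    using z by (auto simp: r_def)
  moreover have "in_row_lattice B (\<lambda>j. v j - r j)"
    unfolding in_row_lattice_def using B by (intro exI[of _ z]) (auto simp: r_def)
  ultimately show ?thesis by blast
qed

lemma residue_unique:
  assumes B: "B \<in> carrier_mat n n" "upper_triangular B"
    and r: "r \<in> PiE {..<n} (\<lambda>i. {0..<\<bar>B $$ (i, i)\<bar>})" and s: "s \<in> PiE {..<n} (\<lambda>i. {0..<\<bar>B $$ (i, i)\<bar>})"
    and "in_row_lattice B (\<lambda>j. r j - s j)"
  shows "r = s"
proof -
  obtain z where z: "\<And>j. j < n \<Longrightarrow> r j - s j = (\<Sum>i<n. z i * B $$ (i, j))"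
    using assms(5) B by (auto simp: in_row_lattice_def)
  have z0: "z j = 0" if "j < n" for j
    using that
  proof (induction j rule: less_induct)
    case (less j)
    have "(\<Sum>i<j. z i * B $$ (i, j)) = 0" using less by (intro sum.neutral) auto
    then have eq: "r j - s j = z j * B $$ (j, j)"
      using z[OF less.prems] sum_upper_triangular[OF B(2,1) less.prems, of z] by simp
    have "r j \<in> {0..<\<bar>B $$ (j, j)\<bar>}" "s j \<in> {0..<\<bar>B $$ (j, j)\<bar>}"
      using PiE_mem[OF r, of j] PiE_mem[OF s, of j] less.prems by simp_all
    then have lt: "\<bar>z j * B $$ (j, j)\<bar> < \<bar>B $$ (j, j)\<bar>"
      using eq by auto
    show "z j = 0"
    proof (rule ccontr)
      assume "z j \<noteq> 0"
      then have "1 \<le> \<bar>z j\<bar>" by simp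
      then have "1 * \<bar>B $$ (j, j)\<bar> \<le> \<bar>z j\<bar> * \<bar>B $$ (j, j)\<bar>"
        by (intro mult_right_mono) auto
      then show False using lt by (simp add: abs_mult)
    qed
  qed
  show ?thesis
  proof (rule PiE_ext[OF r s])
    fix j assume "j \<in> {..<n}"
    then show "r j = s j" using z[of j] z0 by simp
  qed
qed

lemma in_row_lattice_add:
  assumes "in_row_lattice A v" "in_row_lattice A w" 
  shows "in_row_lattice A (\<lambda>j. v j + w j)"
proof -
  obtain y z where "\<forall>j<dim_col A. v j = (\<Sum>i<dim_row A. y i * A $$ (i, j))"
    "\<forall>j<dim_col A. w j = (\<Sum>i<dim_row A. z i * A $$ (i, j))"
    using assms unfolding in_row_lattice_def by blast
  then show ?thesis unfolding in_row_lattice_def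
    by (intro exI[of _ "\<lambda>i. y i + z i"]) (simp add: algebra_simps sum.distrib)
qed

lemma in_row_lattice_uminus:
  assumes "in_row_lattice A v"
  shows "in_row_lattice A (\<lambda>j. - v j)"
proof -
  obtain z where "\<forall>j<dim_col A. v j = (\<Sum>i<dim_row A. z i * A $$ (i, j))"
    using assms unfolding in_row_lattice_def by blast
  then show ?thesis unfolding in_row_lattice_def
    by (intro exI[of _ "\<lambda>i. - z i"]) (simp add: sum_negf)
qed

text \<open>
  For an upper triangular matrix the residues are the boxes of integer points with side lengths the
  absolute values of the diagonal entries, and there are as many of them as the absolute
  determinant. Row operations reduce the general case to this one. The cosets of the lattice are
  represented by the reduction function \<open>red\<close>, so that no quotient group is needed.
\<close>

theorem row_lattice_index:
  assumes A: "A \<in> carrier_mat n n" and det: "Determinant.det A \<noteq> 0"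
  obtains red :: "(nat \<Rightarrow> int) \<Rightarrow> (nat \<Rightarrow> int)"
  where "\<And>v w. red v = red w \<longleftrightarrow> in_row_lattice A (\<lambda>j. v j - w j)"
    and "finite (range red)" and "int (card (range red)) = \<bar>Determinant.det A\<bar>"
proof -
  obtain B where sl: "same_lattice n A B" and ut: "upper_triangular B"
    using triangular_basis[OF A] by blast
  have B: "B \<in> carrier_mat n n" using sl by (simp add: same_lattice_def)
  have detB: "Determinant.det B = (\<Prod>i<n. B $$ (i, i))"
    using det_upper_triangular[OF ut B] B by (simp add: prod_list_diag_prod lessThan_atLeast0)
  have nz: "B $$ (i, i) \<noteq> 0" if "i < n" for i
  proof
    assume "B $$ (i, i) = 0"
    then have "Determinant.det B = 0" using detB that by (auto intro: prod_zero)
    then show False using det sl by (simp add: same_lattice_def)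
  qed
  let ?R = "PiE {..<n} (\<lambda>i. {0..<\<bar>B $$ (i, i)\<bar>})"
  have lat: "in_row_lattice A v \<longleftrightarrow> in_row_lattice B v" for v
    using sl by (simp add: same_lattice_def)
  define red where "red v = (SOME r. r \<in> ?R \<and> in_row_lattice B (\<lambda>j. v j - r j))" for v
  have red: "red v \<in> ?R \<and> in_row_lattice B (\<lambda>j. v j - red v j)" for v
    unfolding red_def using residue_exists[OF B ut nz, of v] unfolding Bex_def by (rule someI_ex)
  note red1 = conjunct1[OF red] and red2 = conjunct2[OF red]
  have iff: "red v = red w \<longleftrightarrow> in_row_lattice B (\<lambda>j. v j - w j)" for v w
  proof
    assume eq: "red v = red w"
    have "in_row_lattice B (\<lambda>j. (v j - red v j) + - (w j - red w j))"
      by (rule in_row_lattice_add[OF red2 in_row_lattice_uminus[OF red2]])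
    then show "in_row_lattice B (\<lambda>j. v j - w j)" by (simp add: eq)
  next
    assume "in_row_lattice B (\<lambda>j. v j - w j)"
    from in_row_lattice_add[OF this in_row_lattice_add[OF red2[of w] in_row_lattice_uminus[OF red2[of v]]]]
    have "in_row_lattice B (\<lambda>j. red v j - red w j)" by simp
    then show "red v = red w" by (rule residue_unique[OF B ut red1 red1])
  qed
  have "red r = r" if "r \<in> ?R" for r
  proof -
    have "in_row_lattice B (\<lambda>j. red r j - r j)"
      using in_row_lattice_uminus[OF red2[of r]] by simp
    then show ?thesis by (rule residue_unique[OF B ut red1 that])
  qed
  note fixed = this
  have range: "range red = ?R"
  proof (rule subset_antisym)
    show "range red \<subseteq> ?R" by (rule image_subsetI) (rule red1)
    show "?R \<subseteq> range red"
    proof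
      fix r assume "r \<in> ?R"
      from fixed[OF this, symmetric] show "r \<in> range red" by (rule range_eqI[where f = red])
    qed
  qed
  have card: "int (card ?R) = \<bar>Determinant.det A\<bar>"
  proof -
    have "card ?R = (\<Prod>i<n. nat \<bar>B $$ (i, i)\<bar>)"
      by (simp add: card_PiE)
    then show ?thesis using sl detB by (simp add: same_lattice_def abs_prod)
  qed
  have fin: "finite ?R" by (intro finite_PiE) auto
  show ?thesis
  proof (rule that[of red])
    show "red v = red w \<longleftrightarrow> in_row_lattice A (\<lambda>j. v j - w j)" for v w by (simp only: iff lat)
    show "finite (range red)" by (simp only: range fin)
    show "int (card (range red)) = \<bar>Determinant.det A\<bar>" by (simp only: range card)
  qed
qed

section \<open>Alternating maps and their sign changes\<close>

definition side :: "bool \<Rightarrow> int"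
  where "side b = (if b then 1 else - 1)"

lemma side_simps [simp]: "side True = 1" "side False = - 1" "side b * side b = 1" "side (\<not> b) = - side b"
  by (auto simp: side_def)

text \<open>
  The crossings \<open>C\<close> of an alternating diagram, with the four corners at each of them. A crossing has an
  outgoing (\<open>True\<close>) and an incoming (\<open>False\<close>) under half-edge, and likewise over half-edges;
  \<open>fc c a b\<close> is the face at the corner between under half-edge \<open>a\<close> and over half-edge \<open>b\<close>. The edge
  that begins with under half-edge \<open>a\<close> of \<open>c\<close> ends at the crossing \<open>t a c\<close>, where it is an over
  half-edge; if it is outgoing at \<open>c\<close>, it is incoming there, and conversely. The assumption \<open>edge\<close> says
  that the two faces beside an edge are the same ones at both ends.
\<close>

locale alternating_map =
  fixes C :: "'c set" and t :: "bool \<Rightarrow> 'c \<Rightarrow> 'c" and fc :: "'c \<Rightarrow> bool \<Rightarrow> bool \<Rightarrow> 'f"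
  assumes finite_C: "finite C" and C_ne: "C \<noteq> {}"
    and t_bij: "bij_betw (t a) C C"
    and corners_distinct: "c \<in> C \<Longrightarrow> fc c a b = fc c a' b' \<Longrightarrow> a = a' \<and> b = b'"
    and edge: "c \<in> C \<Longrightarrow>
      {fc c a False, fc c a True} = {fc (t a c) False (\<not> a), fc (t a c) True (\<not> a)}"
    and strongly_connected: "A \<subseteq> C \<Longrightarrow> A \<noteq> {} \<Longrightarrow> (\<And>c a. c \<in> A \<Longrightarrow> t a c \<in> A) \<Longrightarrow> A = C"
begin

definition Fs :: "'f set"
  where "Fs = {fc c a b | c a b. c \<in> C}"

definition EF :: "'c \<Rightarrow> bool \<Rightarrow> 'f set"
  where "EF c a = {fc c a False, fc c a True}"

lemma t_in: "c \<in> C \<Longrightarrow> t a c \<in> C"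
  using t_bij[of a] by (auto simp: bij_betw_def)

lemma fc_in_Fs: "c \<in> C \<Longrightarrow> fc c a b \<in> Fs"
  by (auto simp: Fs_def)

lemma fc_eq_iff: "c \<in> C \<Longrightarrow> fc c a b = fc c a' b' \<longleftrightarrow> a = a' \<and> b = b'"
  using corners_distinct by blast

lemma EF_over: "c \<in> C \<Longrightarrow> EF c a = {fc (t a c) False (\<not> a), fc (t a c) True (\<not> a)}"
  using edge by (simp add: EF_def)

lemma EF_subset: "c \<in> C \<Longrightarrow> EF c a \<subseteq> Fs"
  by (auto simp: EF_def fc_in_Fs)

lemma finite_Fs: "finite Fs"
proof -
  have "Fs = (\<lambda>(c, a, b). fc c a b) ` (C \<times> UNIV)" by (auto simp: Fs_def image_iff) blast
  then show ?thesis using finite_C by (simp add: finite_cartesian_product)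
qed

lemma sum_reindex_t: "(\<Sum>c\<in>C. h (t a c)) = (\<Sum>c\<in>C. h c)"
  using sum.reindex_bij_betw[OF t_bij] .

text \<open>
  A set of faces that no edge separates from its complement contains, with one corner of a crossing,
  the neighbours of this corner, because adjacent corners share a half-edge. Hence it contains all four
  corners, and the edges carry this property to all crossings.
\<close>

lemma dual_connected:
  assumes A: "A \<subseteq> Fs" "A \<noteq> {}" and no: "\<And>c a. c \<in> C \<Longrightarrow> EF c a \<subseteq> A \<or> EF c a \<inter> A = {}"
  shows "A = Fs"
proof -
  have u: "fc c a b \<in> A \<longleftrightarrow> fc c a b' \<in> A" if "c \<in> C" for c a b b'
    using no[OF that, of a] by (cases b; cases b') (auto simp: EF_def)
  have o: "fc c a b \<in> A \<longleftrightarrow> fc c a' b \<in> A" if cC: "c \<in> C" for c a a' b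
  proof -
    obtain d where d: "d \<in> C" "t (\<not> b) d = c"
    proof -
      have "c \<in> t (\<not> b) ` C" using t_bij[of "\<not> b"] cC by (simp add: bij_betw_def)
      then show thesis using that by blast
    qed
    have "EF d (\<not> b) = {fc c False b, fc c True b}" using EF_over[OF d(1), of "\<not> b"] d(2) by simp
    then show ?thesis using no[OF d(1), of "\<not> b"] by (cases a; cases a') auto
  qed
  have uo: "fc c a b \<in> A \<longleftrightarrow> fc c a' b' \<in> A" if "c \<in> C" for c a b a' b'
    using u[OF that] o[OF that] by blast
  let ?B = "{c \<in> C. fc c True True \<in> A}"
  have "?B = C"
  proof (rule strongly_connected)
    obtain f where "f \<in> A" using A by blast
    then have "f \<in> A \<inter> Fs" using A by blast
    then obtain c a b where "c \<in> C" "fc c a b \<in> A" unfolding Fs_def by blast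
    then show "?B \<noteq> {}" using uo by blast
  next
    fix c a assume c: "c \<in> ?B"
    then have cC: "c \<in> C" and "fc c True True \<in> A" by auto
    then have "fc c a b \<in> A" for b using uo by blast
    then have "EF c a \<subseteq> A" unfolding EF_def by blast
    then have "fc (t a c) True (\<not> a) \<in> A" using EF_over[OF cC] by auto
    then show "t a c \<in> ?B" using uo t_in[OF cC] by blast
  qed blast
  then have all: "fc c a b \<in> A" if "c \<in> C" for c a b using uo that by blast
  have "Fs \<subseteq> A" unfolding Fs_def using all by blast
  then show ?thesis using A by blast
qed

lemma mixed_edge:
  assumes "A \<subseteq> Fs" "A \<noteq> {}" "A \<noteq> Fs"
  obtains c a b where "c \<in> C" "fc c a b \<in> A" "fc c a (\<not> b) \<in> Fs - A" "EF c a = {fc c a b, fc c a (\<not> b)}"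
proof -
  obtain c a where c: "c \<in> C" "\<not> EF c a \<subseteq> A" "EF c a \<inter> A \<noteq> {}"
    using dual_connected[OF assms(1,2)] assms(3) by blast
  then obtain b where b: "fc c a b \<in> A" by (auto simp: EF_def)
  then have "fc c a (\<not> b) \<notin> A" using c by (cases b) (auto simp: EF_def)
  moreover have "EF c a = {fc c a b, fc c a (\<not> b)}" by (cases b) (auto simp: EF_def)
  ultimately show ?thesis using that[of c a b] c(1) b fc_in_Fs by auto
qed

definition theta :: "('f \<Rightarrow> int) \<Rightarrow> 'c \<Rightarrow> bool \<Rightarrow> bool \<Rightarrow> int"
  where "theta e c a b = side b * e (fc c a b)"

text \<open>
  The product of the two sums over opposite corners. In its expansion every term is a
  product of the values at two faces on the two sides of a half-edge.
\<close>

definition excess :: "('f \<Rightarrow> int) \<Rightarrow> 'c \<Rightarrow> int"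
  where "excess e c =
    (theta e c False False + theta e c True True) * (theta e c False True + theta e c True False)"

lemma excess_expand:
  "excess e c = (\<Sum>b\<in>UNIV. e (fc c False b) * e (fc c True b)) - (\<Sum>a\<in>UNIV. e (fc c a False) * e (fc c a True))"
  by (simp add: excess_def theta_def UNIV_bool algebra_simps)

text \<open>
  Each edge contributes the product of the values of its two faces twice: with a plus sign at its over
  end and with a minus sign at its under end.
\<close>

lemma sum_excess: "(\<Sum>c\<in>C. excess e c) = 0"
proof -
  have *: "(\<Sum>c\<in>C. e (fc c a False) * e (fc c a True)) = (\<Sum>c\<in>C. e (fc c False (\<not> a)) * e (fc c True (\<not> a)))" for a
  proof -
    have "e (fc c a False) * e (fc c a True) = e (fc (t a c) False (\<not> a)) * e (fc (t a c) True (\<not> a))"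
      if "c \<in> C" for c
      using edge[OF that, of a] by (auto simp: doubleton_eq_iff)
    then have "(\<Sum>c\<in>C. e (fc c a False) * e (fc c a True))
      = (\<Sum>c\<in>C. e (fc (t a c) False (\<not> a)) * e (fc (t a c) True (\<not> a)))"
      by (rule sum.cong[OF refl])
    also have "\<dots> = (\<Sum>c\<in>C. e (fc c False (\<not> a)) * e (fc c True (\<not> a)))"
      by (rule sum_reindex_t)
    finally show ?thesis .
  qed
  show ?thesis
    using *[of True] *[of False] by (simp add: excess_expand UNIV_bool sum.distrib sum_subtractf)
qed

definition sign_fun :: "('f \<Rightarrow> int) \<Rightarrow> bool"
  where "sign_fun e \<longleftrightarrow> (\<forall>f. e f = 1 \<or> e f = - 1)"

lemma theta_sign: "sign_fun e \<Longrightarrow> theta e c a b = 1 \<or> theta e c a b = - 1"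
  unfolding sign_fun_def theta_def by (cases b) (auto dest: spec[of _ "fc c a b"])

lemma excess_le_0:
  assumes "sign_fun e" and "theta e c a b = - theta e c a' b'"
  shows "excess e c \<le> 0"
proof -
  have four: "(p + s) * (q + r) \<le> 0 \<or> q = p \<and> r = p \<and> s = p"
    if "p = 1 \<or> p = - 1" "q = 1 \<or> q = - 1" "r = 1 \<or> r = - 1" "s = 1 \<or> s = - 1" for p q r s :: int
    using that by auto
  have "excess e c \<le> 0 \<or> (\<forall>a b. theta e c a b = theta e c False False)"
    using four[of "theta e c False False" "theta e c False True" "theta e c True False" "theta e c True True"]
      theta_sign[OF assms(1)]
    unfolding excess_def by (metis (full_types))
  moreover have "\<not> (\<forall>a b. theta e c a b = theta e c False False)"
  proof
    assume "\<forall>a b. theta e c a b = theta e c False False"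
    then have "theta e c a b = theta e c a' b'" by metis
    then show False using assms(2) theta_sign[OF assms(1), of c a b] by simp
  qed
  ultimately show ?thesis by blast
qed

lemma sum_signs_zero:
  fixes R :: "'f set"
  assumes "finite R" "f \<in> R" "f \<noteq> f'"
  shows "(\<Sum>X\<in>Pow R. (if f \<in> X then 1 else - 1) * (if f' \<in> X then 1 else - 1)) = (0 :: int)"
    (is "sum ?h _ = 0")
proof -
  let ?i = "\<lambda>X. if f \<in> X then X - {f} else insert f X"
  have "bij_betw ?i (Pow R) (Pow R)"
    by (rule bij_betw_byWitness[where f' = ?i]) (use assms in auto)
  then have "sum ?h (Pow R) = (\<Sum>X\<in>Pow R. ?h (?i X))"
    by (rule sum.reindex_bij_betw[symmetric])
  also have "\<dots> = (\<Sum>X\<in>Pow R. - ?h X)"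
    by (rule sum.cong) (use assms in auto)
  finally show ?thesis by (simp add: sum_negf)
qed

text \<open>
  Let \<open>P\<close> be maximal with the property of \<open>P0\<close>, for suitable signs. Then no face at a crossing outside \<open>P\<close>
  lies in \<open>\<sigma> ` P\<close>, for otherwise this crossing could be added, choosing the sign of its own
  matched face. Now choose the signs of the faces outside \<open>\<sigma> ` P\<close> at random. The excess of a crossing in
  \<open>P\<close> is never positive, since two of its corners have opposite signs; the excess of a crossing outside
  \<open>P\<close> has mean \<open>0\<close>, since its corners are independent. As the total is always \<open>0\<close>, the excess of
  every crossing in \<open>P\<close> vanishes for all choices. But some edge beginning in \<open>P\<close> has free signs on both
  sides: an edge that leaves \<open>P\<close>, or, if \<open>P\<close> contains all crossings, the edge whose faces are not matched.
  There the signs can be chosen so that the excess is \<open>-4\<close>.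
\<close>

lemma no_balanced_set:
  fixes \<sigma> :: "'c \<Rightarrow> 'f"
  assumes inj: "inj_on \<sigma> C" and inc: "\<And>c. c \<in> C \<Longrightarrow> \<exists>a b. \<sigma> c = fc c a b"
    and c0: "c0 \<in> C" and avoid: "\<sigma> ` C \<inter> EF c0 a0 = {}"
    and P0: "P0 \<subseteq> C" "P0 \<noteq> {}" and e0: "sign_fun e0"
    and bal0: "\<And>c. c \<in> P0 \<Longrightarrow> \<exists>a b a' b'. fc c a b \<in> \<sigma> ` P0 \<and> fc c a' b' \<in> \<sigma> ` P0 \<and>
      theta e0 c a b = - theta e0 c a' b'"
  shows False
proof -
  define good where "good P e \<longleftrightarrow> P \<subseteq> C \<and> P \<noteq> {} \<and> sign_fun e \<and>
    (\<forall>c\<in>P. \<exists>a b a' b'. fc c a b \<in> \<sigma> ` P \<and> fc c a' b' \<in> \<sigma> ` P \<and> theta e c a b = - theta e c a' b')" for P e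
  have "\<exists>P. (\<exists>e. good P e) \<and> (\<forall>Q. (\<exists>e. good Q e) \<longrightarrow> card Q \<le> card P)"
  proof (rule ex_has_greatest_nat[where k = P0 and b = "Suc (card C)"])
    show "\<exists>e. good P0 e" using P0 e0 bal0 unfolding good_def by blast
    show "\<forall>Q. (\<exists>e. good Q e) \<longrightarrow> card Q < Suc (card C)"
      using card_mono[OF finite_C] by (auto simp: good_def less_Suc_eq_le)
  qed
  then obtain P e where good: "good P e" and max: "\<And>Q e'. good Q e' \<Longrightarrow> card Q \<le> card P"
    by blast
  have P: "P \<subseteq> C" "P \<noteq> {}" and e: "sign_fun e" using good by (auto simp: good_def)
  have outside: "fc y a b \<notin> \<sigma> ` P" if y: "y \<in> C - P" for y a b
  proof
    assume ab: "fc y a b \<in> \<sigma> ` P"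
    obtain a1 b1 where s: "\<sigma> y = fc y a1 b1" using inc y by blast
    have nin: "\<sigma> y \<notin> \<sigma> ` P" using inj y P by (auto simp: inj_on_def)
    \<comment> \<open>This value makes the signed value at the matched corner of \<open>y\<close> opposite to the one at \<open>(a, b)\<close>.\<close>
    define e' where "e' = e(\<sigma> y := - side b1 * side b * e (fc y a b))"
    have "sign_fun e'" using e by (auto simp: sign_fun_def e'_def side_def minus_equation_iff)
    have same: "theta e' c a b = theta e c a b" if "fc c a b \<in> \<sigma> ` P" for c a b
      using that nin by (auto simp: theta_def e'_def)
    have "theta e' y a1 b1 = - theta e' y a b"
    proof -
      have "theta e' y a1 b1 = side b1 * (- side b1 * side b * e (fc y a b))"
        by (simp add: theta_def e'_def s)
      also have "\<dots> = - theta e y a b" by (cases b1) (simp_all add: theta_def)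
      finally show ?thesis by (simp add: same[OF ab])
    qed
    moreover have "fc y a1 b1 \<in> \<sigma> ` insert y P" using s by auto
    ultimately have "\<exists>a b a' b'. fc y a b \<in> \<sigma> ` insert y P \<and> fc y a' b' \<in> \<sigma> ` insert y P \<and>
      theta e' y a b = - theta e' y a' b'" using ab by blast
    moreover have "\<exists>a b a' b'. fc c a b \<in> \<sigma> ` insert y P \<and> fc c a' b' \<in> \<sigma> ` insert y P \<and>
      theta e' c a b = - theta e' c a' b'" if c: "c \<in> P" for c
    proof -
      obtain a b a' b' where "fc c a b \<in> \<sigma> ` P" "fc c a' b' \<in> \<sigma> ` P" "theta e c a b = - theta e c a' b'"
        using good c unfolding good_def by blast
      then show ?thesis using same by (metis image_insert insertI2)
    qed
    ultimately have "good (insert y P) e'"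
      using P y \<open>sign_fun e'\<close> unfolding good_def by blast
    then have "card (insert y P) \<le> card P" by (rule max)
    then show False using y P finite_C finite_subset by fastforce
  qed
  define R where "R = Fs - \<sigma> ` P"
  have finR: "finite R" using finite_Fs by (simp add: R_def)
  define eX where "eX X f = (if f \<in> R then (if f \<in> X then 1 else - 1) else e f)" for X f
  have eX: "sign_fun (eX X)" for X using e by (auto simp: sign_fun_def eX_def)
  have outR: "fc y a b \<in> R" if "y \<in> C - P" for y a b
    using outside[OF that] that by (auto simp: R_def fc_in_Fs)
  have le: "excess (eX X) c \<le> 0" if c: "c \<in> P" for c X
  proof -
    obtain a b a' b' where "fc c a b \<in> \<sigma> ` P" "fc c a' b' \<in> \<sigma> ` P" "theta e c a b = - theta e c a' b'"
      using good c unfolding good_def by blast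
    then show ?thesis
      by (intro excess_le_0[OF eX, of X c a b a' b']) (auto simp: theta_def eX_def R_def)
  qed
  have avg: "(\<Sum>X\<in>Pow R. excess (eX X) y) = 0" if y: "y \<in> C - P" for y
  proof -
    have pair: "(\<Sum>X\<in>Pow R. eX X (fc y a b) * eX X (fc y a' b')) = 0" if "(a, b) \<noteq> (a', b')" for a b a' b'
    proof -
      have "(\<Sum>X\<in>Pow R. eX X (fc y a b) * eX X (fc y a' b')) =
        (\<Sum>X\<in>Pow R. (if fc y a b \<in> X then 1 else - 1) * (if fc y a' b' \<in> X then 1 else - 1))"
        by (rule sum.cong) (simp_all add: eX_def outR[OF y])
      also have "\<dots> = 0"
        using y that by (intro sum_signs_zero[OF finR outR[OF y]]) (auto simp: fc_eq_iff)
      finally show ?thesis .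
    qed
    show ?thesis
      by (simp add: excess_expand UNIV_bool sum.distrib sum_subtractf pair)
  qed
  have tot: "(\<Sum>X\<in>Pow R. \<Sum>c\<in>P. excess (eX X) c) = 0"
  proof -
    have "0 = (\<Sum>X\<in>Pow R. \<Sum>c\<in>C. excess (eX X) c)" by (simp add: sum_excess)
    also have "\<dots> = (\<Sum>X\<in>Pow R. (\<Sum>c\<in>C - P. excess (eX X) c) + (\<Sum>c\<in>P. excess (eX X) c))"
      by (rule sum.cong) (simp_all add: sum.subset_diff[OF P(1) finite_C])
    also have "\<dots> = (\<Sum>X\<in>Pow R. \<Sum>c\<in>C - P. excess (eX X) c) + (\<Sum>X\<in>Pow R. \<Sum>c\<in>P. excess (eX X) c)"
      by (rule sum.distrib)
    also have "(\<Sum>X\<in>Pow R. \<Sum>c\<in>C - P. excess (eX X) c) = (\<Sum>c\<in>C - P. \<Sum>X\<in>Pow R. excess (eX X) c)"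
      by (rule sum.swap)
    also have "\<dots> = 0" using avg by simp
    finally show ?thesis by simp
  qed
  have finP: "finite P" using P finite_C finite_subset by blast
  have zero: "excess (eX X) c = 0" if X: "X \<subseteq> R" and c: "c \<in> P" for X c
  proof -
    have "(\<Sum>X\<in>Pow R. - (\<Sum>c\<in>P. excess (eX X) c)) = 0" using tot by (simp add: sum_negf)
    then have "\<forall>X\<in>Pow R. - (\<Sum>c\<in>P. excess (eX X) c) = 0"
      using finR le by (subst (asm) sum_nonneg_eq_0_iff) (auto intro: sum_nonpos)
    then have "(\<Sum>c\<in>P. - excess (eX X) c) = 0" using X by (auto simp: sum_negf)
    then have "\<forall>c\<in>P. - excess (eX X) c = 0"
      using finP le by (subst (asm) sum_nonneg_eq_0_iff) auto
    then show ?thesis using c by auto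
  qed
  obtain p a where p: "p \<in> P" "\<And>b. fc p a b \<in> R"
  proof (cases "P = C")
    case True
    have "fc c0 a0 b \<in> R" for b
      using avoid c0 True by (cases b) (auto simp: R_def EF_def fc_in_Fs)
    then show ?thesis using that[of c0 a0] c0 True by blast
  next
    case False
    then obtain c a where c: "c \<in> P" "t a c \<notin> P" using strongly_connected[OF P] by blast
    then have y: "t a c \<in> C - P" using P t_in by blast
    have "c \<in> C" using c P by blast
    then have "EF c a \<subseteq> R" using EF_over[of c a] outR[OF y] by simp
    then have "fc c a b \<in> R" for b by (cases b) (auto simp: EF_def)
    then show ?thesis using that c by blast
  qed
  have pC: "p \<in> C" using p P by blast
  obtain a1 b1 a2 b2 where q: "fc p a1 b1 \<in> \<sigma> ` P" "fc p a2 b2 \<in> \<sigma> ` P"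
    "theta e p a1 b1 = - theta e p a2 b2"
    using good p unfolding good_def by blast
  have "a1 \<noteq> a" "a2 \<noteq> a" using q(1,2) p(2)[of b1] p(2)[of b2] unfolding R_def by blast+
  then have a12: "a1 = (\<not> a)" "a2 = (\<not> a)" by blast+
  have ne: "b1 \<noteq> b2"
  proof
    assume "b1 = b2"
    then have "theta e p a1 b1 = - theta e p a1 b1" using q(3) a12 by simp
    then show False using theta_sign[OF e, of p a1 b1] by auto
  qed
  have nR: "fc p (\<not> a) b \<notin> R" for b
  proof -
    have "b = b1 \<or> b = b2" using ne by blast
    then show ?thesis using q(1,2) unfolding a12 R_def by blast
  qed
  have op: "theta e p (\<not> a) True = - theta e p (\<not> a) False"
    using q(3) ne unfolding a12 by (cases b1) simp_all
  \<comment> \<open>Opposite corners of \<open>p\<close> get equal signed values, so that the factors of the excess are \<open>2\<close> and \<open>-2\<close>.\<close>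
  define X where "X = {f. \<exists>b. f = fc p a b \<and> side b * theta e p (\<not> a) (\<not> b) = 1}"
  have XR: "X \<subseteq> R" using p by (auto simp: X_def)
  have th1: "theta (eX X) p (\<not> a) b = theta e p (\<not> a) b" for b
    using nR by (simp add: theta_def eX_def)
  have th2: "theta (eX X) p a b = theta e p (\<not> a) (\<not> b)" for b
  proof -
    have "fc p a b \<in> X \<longleftrightarrow> side b * theta e p (\<not> a) (\<not> b) = 1"
      using pC by (auto simp: X_def fc_eq_iff)
    moreover have "side b * theta e p (\<not> a) (\<not> b) = 1 \<or> side b * theta e p (\<not> a) (\<not> b) = - 1"
      using theta_sign[OF e, of p "\<not> a" "\<not> b"] by (cases b) auto
    ultimately have "eX X (fc p a b) = side b * theta e p (\<not> a) (\<not> b)"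
      using p(2) by (auto simp: eX_def)
    then show ?thesis by (simp add: theta_def[of "eX X"] mult.assoc[symmetric])
  qed
  have "excess (eX X) p = - 4"
    using th1[of True] th1[of False] th2[of True] th2[of False] op theta_sign[OF e, of p "\<not> a" False]
    unfolding excess_def by (cases a; elim disjE; simp)
  then show False using zero[OF XR p(1)] by simp
qed

end

section \<open>Edge chains on an alternating map\<close>

context alternating_map
begin

text \<open>
  The dual boundary map: an edge chain \<open>\<phi>\<close> is a function of a crossing and an under half-edge.
\<close>

definition face_sum :: "('c \<Rightarrow> bool \<Rightarrow> int) \<Rightarrow> 'f \<Rightarrow> int"
  where "face_sum \<phi> F = (\<Sum>c\<in>C. \<Sum>a\<in>UNIV. if F \<in> EF c a then \<phi> c a else 0)"

text \<open>
  The sign of a corner is the direction of its over half-edge.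
\<close>

definition incidence :: "'c \<Rightarrow> 'f \<Rightarrow> int"
  where "incidence c F = (\<Sum>a\<in>UNIV. \<Sum>b\<in>UNIV. if F = fc c a b then side b else 0)"

text \<open>
  The same edges, indexed by their over ends.
\<close>

lemma face_sum_over:
  "face_sum (\<lambda>c a. \<rho> (t a c) a) F =
    (\<Sum>c\<in>C. \<Sum>a\<in>UNIV. if F \<in> {fc c False (\<not> a), fc c True (\<not> a)} then \<rho> c a else 0)"
proof -
  have "face_sum (\<lambda>c a. \<rho> (t a c) a) F =
    (\<Sum>a\<in>UNIV. \<Sum>c\<in>C. if F \<in> EF c a then \<rho> (t a c) a else 0)"
    unfolding face_sum_def by (rule sum.swap)
  also have "\<dots> = (\<Sum>a\<in>UNIV. \<Sum>c\<in>C. if F \<in> {fc (t a c) False (\<not> a), fc (t a c) True (\<not> a)} then \<rho> (t a c) a else 0)"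
    by (intro sum.cong refl) (simp add: EF_over)
  also have "\<dots> = (\<Sum>a\<in>UNIV. \<Sum>c\<in>C. if F \<in> {fc c False (\<not> a), fc c True (\<not> a)} then \<rho> c a else 0)"
  proof (rule sum.cong[OF refl])
    fix a
    show "(\<Sum>c\<in>C. if F \<in> {fc (t a c) False (\<not> a), fc (t a c) True (\<not> a)} then \<rho> (t a c) a else 0) =
      (\<Sum>c\<in>C. if F \<in> {fc c False (\<not> a), fc c True (\<not> a)} then \<rho> c a else 0)"
      by (rule sum_reindex_t[where h = "\<lambda>c. if F \<in> {fc c False (\<not> a), fc c True (\<not> a)} then \<rho> c a else 0"])
  qed
  also have "\<dots> = (\<Sum>c\<in>C. \<Sum>a\<in>UNIV. if F \<in> {fc c False (\<not> a), fc c True (\<not> a)} then \<rho> c a else 0)"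
    by (rule sum.swap)
  finally show ?thesis .
qed

lemma face_sum_diff: "face_sum (\<lambda>c a. \<phi> c a - \<phi>' c a) F = face_sum \<phi> F - face_sum \<phi>' F"
  unfolding face_sum_def sum_subtractf[symmetric] by (intro sum.cong refl) auto

lemma face_sum_scale: "face_sum (\<lambda>c a. k * \<phi> c a) F = k * face_sum \<phi> F"
  unfolding face_sum_def sum_distrib_left by (intro sum.cong refl) auto

lemma face_sum_sum: "face_sum (\<lambda>c a. \<Sum>i\<in>I. \<phi> i c a) F = (\<Sum>i\<in>I. face_sum (\<phi> i) F)"
proof -
  have "(\<Sum>i\<in>I. face_sum (\<phi> i) F) = (\<Sum>c\<in>C. \<Sum>i\<in>I. \<Sum>a\<in>UNIV. if F \<in> EF c a then \<phi> i c a else 0)"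
    unfolding face_sum_def by (rule sum.swap)
  also have "\<dots> = (\<Sum>c\<in>C. \<Sum>a\<in>UNIV. \<Sum>i\<in>I. if F \<in> EF c a then \<phi> i c a else 0)"
    by (intro sum.cong refl sum.swap)
  finally show ?thesis unfolding face_sum_def by (auto intro!: sum.cong)
qed

definition single_edge :: "'c \<Rightarrow> bool \<Rightarrow> 'c \<Rightarrow> bool \<Rightarrow> int"
  where "single_edge c0 a0 c a = (if c = c0 \<and> a = a0 then 1 else 0)"

lemma face_sum_single:
  assumes "c0 \<in> C"
  shows "face_sum (single_edge c0 a0) F = (if F \<in> EF c0 a0 then 1 else 0)"
proof -
  have "face_sum (single_edge c0 a0) F = (\<Sum>c\<in>C. if c = c0 then (if F \<in> EF c0 a0 then 1 else 0) else 0)"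
    unfolding face_sum_def
  proof (rule sum.cong[OF refl])
    fix c
    show "(\<Sum>a\<in>UNIV. if F \<in> EF c a then single_edge c0 a0 c a else 0) =
      (if c = c0 then (if F \<in> EF c0 a0 then 1 else 0) else 0)"
      by (cases a0) (simp_all add: single_edge_def UNIV_bool)
  qed
  then show ?thesis using assms finite_C by simp
qed

text \<open>
  At a corner the value of \<open>\<psi>\<close> enters once for the under half-edge and once, with the opposite sign, for
  the over half-edge.
\<close>

lemma face_sum_potential: "face_sum (\<lambda>c a. \<psi> c - \<psi> (t a c)) F = 0"
proof -
  have "face_sum (\<lambda>c a. \<psi> (t a c)) F
    = (\<Sum>c\<in>C. \<Sum>a\<in>UNIV. if F \<in> {fc c False (\<not> a), fc c True (\<not> a)} then \<psi> c else 0)"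
    by (rule face_sum_over)
  also have "\<dots> = face_sum (\<lambda>c a. \<psi> c) F"
    unfolding face_sum_def
  proof (rule sum.cong[OF refl])
    fix c assume c: "c \<in> C"
    show "(\<Sum>a\<in>UNIV. if F \<in> {fc c False (\<not> a), fc c True (\<not> a)} then \<psi> c else 0) =
      (\<Sum>a\<in>UNIV. if F \<in> EF c a then \<psi> c else 0)"
      by (auto simp: UNIV_bool EF_def fc_eq_iff[OF c])
  qed
  finally show ?thesis by (simp add: face_sum_diff)
qed

text \<open>
  \<open>T\<close> is a spanning tree of the dual graph. A chain supported on a tree and with vanishing face sums away
  from the root is zero: peel off the leaves.
\<close>

lemma dual_tree:
  assumes U: "U \<in> Fs"
  obtains T where "T \<subseteq> C \<times> UNIV" "card T = card Fs - 1"
    "\<And>\<phi>. (\<And>c a. (c, a) \<notin> T \<Longrightarrow> \<phi> c a = 0) \<Longrightarrow> (\<And>F. F \<in> Fs - {U} \<Longrightarrow> face_sum \<phi> F = 0) \<Longrightarrow>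
      (\<And>c a. \<phi> c a = 0)"
proof -
  have "\<exists>A T. A \<subseteq> Fs \<and> card A = Suc k \<and> U \<in> A \<and> T \<subseteq> C \<times> UNIV \<and> card T = k \<and>
      (\<forall>(c, a)\<in>T. EF c a \<subseteq> A) \<and>
      (\<forall>\<phi>. (\<forall>c a. (c, a) \<notin> T \<longrightarrow> \<phi> c a = 0) \<longrightarrow> (\<forall>F\<in>A - {U}. face_sum \<phi> F = 0) \<longrightarrow> (\<forall>c a. \<phi> c a = 0))"
    if "Suc k \<le> card Fs" for k
    using that
  proof (induction k)
    case 0
    show ?case using U by (intro exI[of _ "{U}"] exI[of _ "{}"]) auto
  next
    case (Suc k)
    from Suc.IH[OF Suc_leD[OF Suc.prems]]
    obtain A T where A: "A \<subseteq> Fs" "card A = Suc k" "U \<in> A" and T: "T \<subseteq> C \<times> UNIV" "card T = k"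
      and TA': "\<forall>(c, a)\<in>T. EF c a \<subseteq> A"
      and peel: "\<forall>\<phi>. (\<forall>c a. (c, a) \<notin> T \<longrightarrow> \<phi> c a = 0) \<longrightarrow> (\<forall>F\<in>A - {U}. face_sum \<phi> F = 0) \<longrightarrow> (\<forall>c a. \<phi> c a = 0)"
      by (elim exE conjE) (rule that)
    have TA: "EF c a \<subseteq> A" if "(c, a) \<in> T" for c a using TA' that by blast
    have "A \<noteq> {}" "A \<noteq> Fs" using A Suc.prems by auto
    then obtain c a b where e: "c \<in> C" "fc c a b \<in> A" "fc c a (\<not> b) \<in> Fs - A" "EF c a = {fc c a b, fc c a (\<not> b)}"
      using mixed_edge[OF A(1)] by metis
    let ?F = "fc c a (\<not> b)"
    let ?A = "insert ?F A" and ?T = "insert (c, a) T"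
    have finA: "finite A" using A finite_Fs finite_subset by blast
    have finT: "finite T" using T finite_C finite_subset by (metis finite_cartesian_product finite)
    have nT: "(c, a) \<notin> T" using TA e by blast
    have "\<phi> c' a' = 0"
      if supp: "\<forall>c a. (c, a) \<notin> ?T \<longrightarrow> \<phi> c a = 0" and zero: "\<forall>F\<in>?A - {U}. face_sum \<phi> F = 0" for \<phi> c' a'
    proof -
      have "face_sum \<phi> ?F = face_sum (\<lambda>c' a'. \<phi> c a * single_edge c a c' a') ?F"
        unfolding face_sum_def
      proof (intro sum.cong refl)
        fix c' a' assume "c' \<in> C"
        show "(if ?F \<in> EF c' a' then \<phi> c' a' else 0) = (if ?F \<in> EF c' a' then \<phi> c a * single_edge c a c' a' else 0)"
          using supp TA[of c' a'] e(3) by (auto simp: single_edge_def)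
      qed
      also have "\<dots> = \<phi> c a" by (simp add: face_sum_scale face_sum_single[OF e(1)] e(4))
      finally have val: "face_sum \<phi> ?F = \<phi> c a" .
      have "?F \<in> ?A - {U}" using e A by blast
      then have "\<phi> c a = 0" using zero val by metis
      have "\<phi> c' a' = 0" if "(c', a') \<notin> T" for c' a'
      proof (cases "(c', a') = (c, a)")
        case True
        then show ?thesis using \<open>\<phi> c a = 0\<close> by simp
      next
        case False
        then have "(c', a') \<notin> ?T" using that by (simp only: insert_iff simp_thms)
        from supp[rule_format, OF this] show ?thesis .
      qed
      note off_T = this
      have "\<forall>c a. (c, a) \<notin> T \<longrightarrow> \<phi> c a = 0" by (intro allI impI) (rule off_T)
      moreover have "\<forall>F\<in>A - {U}. face_sum \<phi> F = 0" using zero by blast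
      ultimately show ?thesis using peel by blast
    qed
    note peel' = this
    have "?A \<subseteq> Fs" "card ?A = Suc (Suc k)" "U \<in> ?A" using A e finA by auto
    moreover have "?T \<subseteq> C \<times> UNIV" "card ?T = Suc k" using T e finT nT by auto
    moreover have "\<forall>(c, a)\<in>?T. EF c a \<subseteq> ?A"
    proof
      fix x assume "x \<in> ?T"
      moreover have "EF c a \<subseteq> ?A" using e by simp
      ultimately show "case x of (c, a) \<Rightarrow> EF c a \<subseteq> ?A"
        using TA[of "fst x" "snd x"] by (cases x) auto
    qed
    ultimately show ?case
      by (intro exI[of _ ?A] exI[of _ ?T] conjI allI impI) (simp_all only: A insertI1, rule peel')
  qed
  note grow = this
  have pos: "Suc (card Fs - 1) = card Fs"
    using U finite_Fs by (metis Suc_pred' card_gt_0_iff diff_Suc_1 diff_Suc_eq_diff_pred empty_iff)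
  obtain A T where A: "A \<subseteq> Fs" "card A = card Fs" and T: "T \<subseteq> C \<times> UNIV" "card T = card Fs - 1"
    and peel: "\<forall>\<phi>. (\<forall>c a. (c, a) \<notin> T \<longrightarrow> \<phi> c a = 0) \<longrightarrow> (\<forall>F\<in>A - {U}. face_sum \<phi> F = 0) \<longrightarrow> (\<forall>c a. \<phi> c a = 0)"
    using grow[OF eq_refl[OF pos]] unfolding pos by (elim exE conjE) (rule that)
  have "A = Fs" using A finite_Fs card_subset_eq by blast
  then show ?thesis using that[OF T] peel by blast
qed

text \<open>
  \<open>T\<close> is a spanning tree of the graph of crossings, grown one edge at a time; a potential is
  determined along it.
\<close>

lemma potential_on_tree:
  assumes T: "S \<subseteq> C \<times> UNIV"
    and cut: "\<And>B. B \<subseteq> C \<Longrightarrow> B \<noteq> {} \<Longrightarrow> B \<noteq> C \<Longrightarrow> \<exists>(c, a)\<in>S. (c \<in> B) \<noteq> (t a c \<in> B)"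
  obtains T where "T \<subseteq> S" "card T = card C - 1"
    "\<And>\<phi>. \<exists>\<psi> :: 'c \<Rightarrow> int. \<forall>(c, a)\<in>T. \<psi> c - \<psi> (t a c) = \<phi> c a"
proof -
  have "\<exists>B T. B \<subseteq> C \<and> card B = Suc k \<and> T \<subseteq> S \<and> card T = k \<and>
      (\<forall>(c, a)\<in>T. c \<in> B \<and> t a c \<in> B) \<and>
      (\<forall>\<phi>. \<exists>\<psi> :: 'c \<Rightarrow> int. \<forall>(c, a)\<in>T. \<psi> c - \<psi> (t a c) = \<phi> c a)"
    if "Suc k \<le> card C" for k
    using that
  proof (induction k)
    case 0
    obtain c0 where "c0 \<in> C" using C_ne by blast
    then show ?case by (intro exI[of _ "{c0}"] exI[of _ "{}"]) auto
  next
    case (Suc k)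
    from Suc.IH[OF Suc_leD[OF Suc.prems]]
    obtain B T where B: "B \<subseteq> C" "card B = Suc k" and T: "T \<subseteq> S" "card T = k"
      and TB': "\<forall>(c, a)\<in>T. c \<in> B \<and> t a c \<in> B"
      and pot: "\<forall>\<phi>. \<exists>\<psi> :: 'c \<Rightarrow> int. \<forall>(c, a)\<in>T. \<psi> c - \<psi> (t a c) = \<phi> c a"
      by (elim exE conjE) (rule that)
    have TB: "c \<in> B \<and> t a c \<in> B" if "(c, a) \<in> T" for c a using TB' that by blast
    have "B \<noteq> {}" "B \<noteq> C" using B Suc.prems by auto
    then obtain c a where e: "(c, a) \<in> S" "(c \<in> B) \<noteq> (t a c \<in> B)" using cut[OF B(1)] by blast
    define d where "d = (if c \<in> B then t a c else c)"
    have "c \<in> C" using e \<open>S \<subseteq> C \<times> UNIV\<close> by blast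
    have d: "d \<in> C - B" "c \<in> insert d B" "t a c \<in> insert d B" using e \<open>c \<in> C\<close> t_in by (auto simp: d_def)
    have finB: "finite B" using B finite_C finite_subset by blast
    have finT: "finite T"
      using T \<open>S \<subseteq> C \<times> UNIV\<close> finite_C finite_subset by (metis finite_cartesian_product finite)
    have nT: "(c, a) \<notin> T" using TB e by blast
    have "\<exists>\<psi> :: 'c \<Rightarrow> int. \<forall>(c, a)\<in>insert (c, a) T. \<psi> c - \<psi> (t a c) = \<phi> c a" for \<phi>
    proof -
      obtain \<psi> :: "'c \<Rightarrow> int" where psi: "\<forall>(c, a)\<in>T. \<psi> c - \<psi> (t a c) = \<phi> c a" using pot by blast
      define \<psi>' where "\<psi>' = \<psi>(d := if c \<in> B then \<psi> c - \<phi> c a else \<psi> (t a c) + \<phi> c a)"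
      have "\<psi>' x = \<psi> x" if "x \<in> B" for x using that d by (auto simp: \<psi>'_def)
      then have "\<forall>(c, a)\<in>T. \<psi>' c - \<psi>' (t a c) = \<phi> c a" using psi TB by force
      moreover have "\<psi>' c - \<psi>' (t a c) = \<phi> c a"
      proof (cases "c \<in> B")
        case True
        then have "d = t a c" "c \<noteq> d" using d by (auto simp: d_def)
        then show ?thesis using True by (simp add: \<psi>'_def)
      next
        case False
        then have "d = c" "t a c \<noteq> d" using d e by (auto simp: d_def)
        then show ?thesis using False by (simp add: \<psi>'_def)
      qed
      ultimately have "\<forall>(c, a)\<in>insert (c, a) T. \<psi>' c - \<psi>' (t a c) = \<phi> c a" by simp
      then show ?thesis by (rule exI[of _ \<psi>'])
    qed
    note pot' = this
    have "insert d B \<subseteq> C" "card (insert d B) = Suc (Suc k)" using B d finB by auto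
    moreover have "insert (c, a) T \<subseteq> S" "card (insert (c, a) T) = Suc k" using T e finT nT by auto
    moreover have "\<forall>(c, a)\<in>insert (c, a) T. c \<in> insert d B \<and> t a c \<in> insert d B"
      using TB' d by auto
    ultimately show ?case
      by (intro exI[of _ "insert d B"] exI[of _ "insert (c, a) T"] conjI allI pot')
  qed
  note grow = this
  have "Suc (card C - 1) \<le> card C"
    using C_ne finite_C by (simp add: Suc_leI card_gt_0_iff)
  from grow[OF this] show ?thesis using that by blast
qed

text \<open>
  The planar duality of trees. No nonempty proper set of crossings is cut out by edges of a dual
  spanning tree only: the coboundary of its indicator function would be a chain supported on the dual
  tree with vanishing face sums. So the complement of the dual tree contains a spanning
  tree, which gives the upper bound in Euler's formula, and the assumed lower bound forces these two
  trees to exhaust the edges. Subtract from \<open>\<phi>\<close> the potential difference that agrees with it on the second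
  tree; what remains is supported on the first one, hence zero.
\<close>

theorem exactness:
  assumes count: "card C + 2 \<le> card Fs" and U: "U \<in> Fs"
  shows "card Fs = card C + 2"
    and "(\<And>F. F \<in> Fs - {U} \<Longrightarrow> face_sum \<phi> F = 0) \<Longrightarrow> \<exists>\<psi>. \<forall>c\<in>C. \<forall>a. \<phi> c a = \<psi> c - \<psi> (t a c)"
proof -
  obtain T where T: "T \<subseteq> C \<times> UNIV" "card T = card Fs - 1" and
    peel: "\<And>\<phi> c a. (\<And>c a. (c, a) \<notin> T \<Longrightarrow> \<phi> c a = 0) \<Longrightarrow> (\<And>F. F \<in> Fs - {U} \<Longrightarrow> face_sum \<phi> F = 0) \<Longrightarrow> \<phi> c a = 0"
    using dual_tree[OF U] by metis
  let ?S = "C \<times> UNIV - T"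
  have ext: "face_sum (\<lambda>c a. if c \<in> C then \<phi> c a else 0) F = face_sum \<phi> F" for \<phi> F
    unfolding face_sum_def by (intro sum.cong refl) auto
  have cut: "\<exists>(c, a)\<in>?S. (c \<in> B) \<noteq> (t a c \<in> B)" if B: "B \<subseteq> C" "B \<noteq> {}" "B \<noteq> C" for B
  proof (rule ccontr)
    assume no: "\<not> ?thesis"
    let ?psi = "\<lambda>c. if c \<in> B then 1 else 0 :: int"
    let ?phi = "\<lambda>c a. if c \<in> C then ?psi c - ?psi (t a c) else 0"
    have "?phi c a = 0" for c a
    proof (rule peel[of ?phi])
      show "?phi c a = 0" if "(c, a) \<notin> T" for c a 
        using no that by (cases "c \<in> C") auto
      show "face_sum ?phi F = 0" for F
        using ext[of "\<lambda>c a. ?psi c - ?psi (t a c)" F] face_sum_potential[of ?psi F] by simp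
    qed
    note phi0 = this
    have "t a c \<in> B" if "c \<in> B" for c a
      using phi0[of c a] that B by (auto split: if_splits)
    then show False using strongly_connected[OF B(1,2)] B(3) by blast
  qed
  obtain S' where S': "S' \<subseteq> ?S" "card S' = card C - 1"
    and pot: "\<And>\<phi>. \<exists>\<psi> :: 'c \<Rightarrow> int. \<forall>(c, a)\<in>S'. \<psi> c - \<psi> (t a c) = \<phi> c a"
    using potential_on_tree[of ?S, OF _ cut] by blast
  have finE: "finite (C \<times> (UNIV :: bool set))" using finite_C by simp
  have cS: "card ?S = 2 * card C - (card Fs - 1)"
    using T finE by (simp add: card_Diff_subset finite_subset card_cartesian_product)
  have "card S' \<le> card ?S" using S' finE by (intro card_mono) auto
  moreover have "card C > 0" using finite_C C_ne by (simp add: card_gt_0_iff)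
  moreover have "card T \<le> 2 * card C"
    using T finE card_mono[OF finE T(1)] by (simp add: card_cartesian_product)
  ultimately show cF: "card Fs = card C + 2" using cS S' T count by linarith
  then have "card S' = card ?S" using cS S' by simp
  then have eq: "S' = ?S" using S'(1) finE by (intro card_subset_eq) auto
  show "\<exists>\<psi>. \<forall>c\<in>C. \<forall>a. \<phi> c a = \<psi> c - \<psi> (t a c)" if zero: "\<And>F. F \<in> Fs - {U} \<Longrightarrow> face_sum \<phi> F = 0"
  proof -
    obtain \<psi> :: "'c \<Rightarrow> int" where psi: "\<forall>(c, a)\<in>S'. \<psi> c - \<psi> (t a c) = \<phi> c a" using pot by blast
    let ?chi = "\<lambda>c a. if c \<in> C then \<phi> c a - (\<psi> c - \<psi> (t a c)) else 0"
    have "?chi c a = 0" for c a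
    proof (rule peel[of ?chi])
      show "?chi c a = 0" if "(c, a) \<notin> T" for c a
        using bspec[OF psi, of "(c, a)"] that eq by auto
      show "face_sum ?chi F = 0" if "F \<in> Fs - {U}" for F
        using ext[of "\<lambda>c a. \<phi> c a - (\<psi> c - \<psi> (t a c))" F] zero[OF that] face_sum_potential[of \<psi> F]
        by (simp add: face_sum_diff[of \<phi>])
    qed
    note chi0 = this
    have "\<phi> c a = \<psi> c - \<psi> (t a c)" if "c \<in> C" for c a
      using chi0[of c a] that by simp
    then show ?thesis by (intro exI[of _ \<psi>] ballI allI)
  qed
qed

text \<open>
  The kernel condition says that the sum of \<open>v\<close> over the two faces beside an over half-edge of \<open>c\<close> is
  the same for both; call it \<open>k c\<close>. It is then the sum of \<open>v\<close> over the two faces beside each edge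
  ending at \<open>c\<close>, so \<open>k\<close> is harmonic, hence constant by the maximum principle, hence \<open>0\<close>
  because of the edge between the two faces where \<open>v\<close> vanishes. Then \<open>v\<close> changes its sign
  across each edge, and the set of its zeros is not separated by any edge.
\<close>

lemma incidence_kernel_trivial:
  fixes v :: "'f \<Rightarrow> int"
  assumes c0: "c0 \<in> C" and v0: "\<And>F. F \<in> EF c0 a0 \<Longrightarrow> v F = 0"
    and ker: "\<And>c. c \<in> C \<Longrightarrow> v (fc c False True) + v (fc c True True) = v (fc c False False) + v (fc c True False)"
    and F: "F \<in> Fs"
  shows "v F = 0"
proof -
  define k where "k c = v (fc c False True) + v (fc c True True)" for c
  have k': "v (fc c False b) + v (fc c True b) = k c" if "c \<in> C" for c b
    using ker[OF that] by (cases b) (auto simp: k_def)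
  have edge_k: "v (fc c a False) + v (fc c a True) = k (t a c)" if c: "c \<in> C" for c a
    using edge[OF c, of a] k'[OF t_in[OF c], of a "\<not> a"] by (auto simp: doubleton_eq_iff)
  \<comment> \<open>Both sides are the sum over the four corners of \<open>c\<close>, grouped by over and by under half-edges.\<close>
  have harm: "2 * k c = k (t False c) + k (t True c)" if c: "c \<in> C" for c
    using edge_k[OF c, of True] edge_k[OF c, of False] k'[OF c, of True] k'[OF c, of False] by linarith
  define m where "m = Max (k ` C)"
  have le: "k c \<le> m" if "c \<in> C" for c using that finite_C by (simp add: m_def)
  have "{c \<in> C. k c = m} = C"
  proof (rule strongly_connected)
    have "m \<in> k ` C" unfolding m_def using finite_C C_ne by (intro Max_in) auto
    then show "{c \<in> C. k c = m} \<noteq> {}" by auto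
  next
    fix c a assume "c \<in> {c \<in> C. k c = m}"
    then have c: "c \<in> C" "k c = m" by auto
    then show "t a c \<in> {c \<in> C. k c = m}"
      using harm[OF c(1)] le[OF t_in[OF c(1), of True]] le[OF t_in[OF c(1), of False]] t_in[OF c(1)]
      by (cases a) auto
  qed auto
  then have const: "k c = m" if "c \<in> C" for c using that by blast
  have "m = 0"
    using const[OF t_in[OF c0, of a0]] edge_k[OF c0, of a0] v0 by (simp add: EF_def)
  then have opp: "v (fc c a False) = - v (fc c a True)" if "c \<in> C" for c a
    using edge_k[OF that, of a] const[OF t_in[OF that]] by simp
  have "{F \<in> Fs. v F = 0} = Fs"
  proof (rule dual_connected)
    have "fc c0 a0 True \<in> {F \<in> Fs. v F = 0}" using v0 c0 by (auto simp: EF_def fc_in_Fs)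
    then show "{F \<in> Fs. v F = 0} \<noteq> {}" by blast
    show "EF c a \<subseteq> {F \<in> Fs. v F = 0} \<or> EF c a \<inter> {F \<in> Fs. v F = 0} = {}" if "c \<in> C" for c a
      using opp[OF that, of a] that by (auto simp: EF_def fc_in_Fs)
  qed auto
  then show ?thesis using F by blast
qed

text \<open>
  The linear extension of the map that sends the arc over \<open>c\<close> to the two faces beside its outgoing over
  half-edge.
\<close>

definition arc_faces :: "('c \<Rightarrow> int) \<Rightarrow> 'f \<Rightarrow> int"
  where "arc_faces g F = (\<Sum>c\<in>C. if F \<in> {fc c False True, fc c True True} then g c else 0)"

text \<open>
  The edge chain that takes the value \<open>- z c\<close> on the incoming and \<open>g c + z c\<close> on the outgoing over
  half-edge of each crossing \<open>c\<close>. Every edge chain has this form, and its face sums combine the map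
  from arcs to faces with the rows of the incidence matrix.
\<close>

definition edge_lift :: "('c \<Rightarrow> int) \<Rightarrow> ('c \<Rightarrow> int) \<Rightarrow> 'c \<Rightarrow> bool \<Rightarrow> int"
  where "edge_lift g z c a = (if a then - z (t a c) else g (t a c) + z (t a c))"

lemma face_sum_edge_lift: "face_sum (edge_lift g z) F = arc_faces g F + (\<Sum>c\<in>C. z c * incidence c F)"
proof -
  have "face_sum (edge_lift g z) F = (\<Sum>c\<in>C. \<Sum>a\<in>UNIV. if F \<in> {fc c False (\<not> a), fc c True (\<not> a)}
      then (if a then - z c else g c + z c) else 0)"
    unfolding edge_lift_def by (rule face_sum_over[where \<rho> = "\<lambda>c a. if a then - z c else g c + z c"])
  also have "\<dots> = arc_faces g F + (\<Sum>c\<in>C. z c * incidence c F)"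
    unfolding arc_faces_def sum.distrib[symmetric]
    by (intro sum.cong refl) (auto simp: UNIV_bool incidence_def fc_eq_iff)
  finally show ?thesis .
qed

lemma sum_edge_lift: "(\<Sum>c\<in>C. \<Sum>a\<in>UNIV. edge_lift g z c a) = (\<Sum>c\<in>C. g c)"
  using sum_reindex_t[of z True] sum_reindex_t[of z False] sum_reindex_t[of g False]
  by (simp add: edge_lift_def UNIV_bool sum.distrib sum_subtractf)

abbreviation pre :: "bool \<Rightarrow> 'c \<Rightarrow> 'c"
  where "pre a \<equiv> inv_into C (t a)"

lemma pre_in: "c \<in> C \<Longrightarrow> pre a c \<in> C"
  using t_bij[of a] by (metis bij_betw_def inv_into_into)

lemma t_pre [simp]: "c \<in> C \<Longrightarrow> t a (pre a c) = c"
  using t_bij[of a] by (simp add: bij_betw_inv_into_right)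

lemma pre_t [simp]: "c \<in> C \<Longrightarrow> pre a (t a c) = c"
  using t_bij[of a] by (simp add: bij_betw_inv_into_left)

lemma edge_lift_surj:
  obtains g z where "\<And>c a. c \<in> C \<Longrightarrow> \<phi> c a = edge_lift g z c a"
proof -
  define z where "z c = - \<phi> (pre True c) True" for c
  define g where "g c = \<phi> (pre False c) False - z c" for c
  have "\<phi> c a = edge_lift g z c a" if "c \<in> C" for c a
    using that by (cases a) (simp_all add: edge_lift_def g_def z_def)
  then show ?thesis using that by blast
qed

text \<open>
  The coefficients of the combination with weights \<open>\<psi>\<close> of the relators \<open>2 c - t False c - t True c\<close>.
\<close>

definition fox_combination :: "('c \<Rightarrow> int) \<Rightarrow> 'c \<Rightarrow> int"
  where "fox_combination \<psi> c = 2 * \<psi> c - \<psi> (pre False c) - \<psi> (pre True c)"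

definition in_row_space :: "'f set \<Rightarrow> ('f \<Rightarrow> int) \<Rightarrow> bool"
  where "in_row_space W v \<longleftrightarrow> (\<exists>z. \<forall>F\<in>W. v F = (\<Sum>c\<in>C. z c * incidence c F))"

text \<open>
  For a suitable \<open>z\<close> the edge lift is the coboundary of \<open>- \<psi>\<close>, whose face sums vanish.
\<close>

lemma fox_combination_imp_row_space:
  assumes "\<And>c. c \<in> C \<Longrightarrow> g c = fox_combination \<psi> c"
  shows "in_row_space W (arc_faces g)"
proof -
  define z where "z c = \<psi> (pre True c) - \<psi> c" for c
  have "edge_lift g z c a = \<psi> (t a c) - \<psi> c" if "c \<in> C" for c a
    using that assms[OF t_in[OF that, of False]]
    by (cases a) (simp_all add: edge_lift_def z_def fox_combination_def)
  then have "face_sum (edge_lift g z) F = face_sum (\<lambda>c a. (- 1) * (\<psi> c - \<psi> (t a c))) F" for F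
    unfolding face_sum_def by (intro sum.cong refl) auto
  then have "arc_faces g F + (\<Sum>c\<in>C. z c * incidence c F) = 0" for F
    by (simp only: face_sum_scale face_sum_potential face_sum_edge_lift)
  then have "\<forall>F\<in>W. arc_faces g F = (\<Sum>c\<in>C. (- z c) * incidence c F)"
    by (simp add: sum_negf eq_neg_iff_add_eq_0)
  then show ?thesis unfolding in_row_space_def by (intro exI[of _ "\<lambda>c. - z c"])
qed

text \<open>
  The coefficient sum \<open>0\<close> rules out a multiple of the edge between the two omitted
  faces, and exactness applies to the rest.
\<close>

lemma row_space_imp_fox_combination:
  assumes count: "card C + 2 \<le> card Fs" and c0: "c0 \<in> C"
    and total: "(\<Sum>c\<in>C. g c) = 0" and row: "in_row_space (Fs - EF c0 a0) (arc_faces g)"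
  obtains \<psi> where "\<And>c. c \<in> C \<Longrightarrow> g c = fox_combination \<psi> c"
proof -
  obtain z' where z': "\<forall>F\<in>Fs - EF c0 a0. arc_faces g F = (\<Sum>c\<in>C. z' c * incidence c F)"
    using row by (auto simp: in_row_space_def)
  define z where "z c = - z' c" for c
  have z: "face_sum (edge_lift g z) F = 0" if "F \<in> Fs - EF c0 a0" for F
    using z' that by (simp add: face_sum_edge_lift z_def sum_negf)
  let ?F = "fc c0 a0 False" and ?U = "fc c0 a0 True"
  define l where "l = face_sum (edge_lift g z) ?F"
  let ?phi = "\<lambda>c a. edge_lift g z c a - l * single_edge c0 a0 c a"
  have "face_sum ?phi F = 0" if "F \<in> Fs - {?U}" for F
  proof (cases "F = ?F")
    case True
    then show ?thesis
      by (simp add: face_sum_diff[of "edge_lift g z"] face_sum_scale face_sum_single[OF c0] EF_def l_def)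
  next
    case False
    then have "F \<in> Fs - EF c0 a0" using that by (auto simp: EF_def)
    then show ?thesis using z
      by (simp add: face_sum_diff[of "edge_lift g z"] face_sum_scale face_sum_single[OF c0])
  qed
  then obtain \<psi> where psi: "\<And>c a. c \<in> C \<Longrightarrow> ?phi c a = \<psi> c - \<psi> (t a c)"
    using exactness(2)[OF count fc_in_Fs[OF c0, of a0 True], of ?phi] by blast
  have "(\<Sum>c\<in>C. \<Sum>a\<in>UNIV. ?phi c a) = (\<Sum>c\<in>C. \<Sum>a\<in>UNIV. \<psi> c - \<psi> (t a c))"
    by (intro sum.cong refl psi)
  also have "\<dots> = 0"
    by (simp add: UNIV_bool sum_subtractf sum.distrib sum_reindex_t sum_distrib_left)
  finally have "(\<Sum>c\<in>C. \<Sum>a\<in>UNIV. l * single_edge c0 a0 c a) = 0"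
    using sum_edge_lift[of g z] total by (simp add: sum_subtractf)
  moreover have "(\<Sum>c\<in>C. \<Sum>a\<in>UNIV. l * single_edge c0 a0 c a) = (\<Sum>c\<in>C. if c = c0 then l else 0)"
    by (intro sum.cong refl) (cases a0; auto simp: single_edge_def UNIV_bool)
  ultimately have "l = 0" using c0 finite_C by simp
  then have lift: "edge_lift g z c a = \<psi> c - \<psi> (t a c)" if "c \<in> C" for c a
    using psi[OF that] by simp
  have "g c = fox_combination (\<lambda>c. - \<psi> c) c" if c: "c \<in> C" for c
    using lift[OF pre_in[OF c, of True], of True] lift[OF pre_in[OF c, of False], of False] c
    by (simp add: edge_lift_def fox_combination_def)
  then show ?thesis using that by blast
qed

text \<open>
  It suffices to reach the indicator function of each face. The omitted faces are trivially reached, and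
  a single edge moves from one of its faces to the other one. The coefficient sum is corrected by
  a multiple of the edge between the omitted faces.
\<close>

lemma arc_faces_surj:
  assumes c0: "c0 \<in> C"
  obtains g where "(\<Sum>c\<in>C. g c) = 0" "in_row_space (Fs - EF c0 a0) (\<lambda>F. v F - arc_faces g F)"
proof -
  let ?W = "Fs - EF c0 a0"
  let ?A = "{F \<in> Fs. \<exists>\<phi>. \<forall>F'\<in>?W. face_sum \<phi> F' = (if F' = F then 1 else 0)}"
  have "?A = Fs"
  proof (rule dual_connected)
    have "face_sum (\<lambda>c a. 0 * 0) F' = 0" for F' by (simp add: face_sum_def)
    then have "fc c0 a0 False \<in> ?A" using c0 by (auto simp: fc_in_Fs EF_def intro!: exI[of _ "\<lambda>c a. 0 * 0"])
    then show "?A \<noteq> {}" by blast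
  next
    fix c a assume c: "c \<in> C"
    have step: "F' \<in> ?A" if F: "F \<in> ?A" "EF c a = {F, F'}" "F \<noteq> F'" for F F'
    proof -
      obtain \<phi> where phi: "\<forall>G\<in>?W. face_sum \<phi> G = (if G = F then 1 else 0)" using F by blast
      have "face_sum (\<lambda>c' a'. single_edge c a c' a' - \<phi> c' a') G = (if G = F' then 1 else 0)" if "G \<in> ?W" for G
        using phi that F by (auto simp: face_sum_diff face_sum_single[OF c])
      moreover have "F' \<in> Fs" using F EF_subset[OF c, of a] by auto
      ultimately show ?thesis by blast
    qed
    have ne: "fc c a False \<noteq> fc c a True" using fc_eq_iff[OF c] by simp
    show "EF c a \<subseteq> ?A \<or> EF c a \<inter> ?A = {}"
    proof (cases "fc c a False \<in> ?A \<or> fc c a True \<in> ?A")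
      case True
      have ends: "EF c a = {fc c a False, fc c a True}" "EF c a = {fc c a True, fc c a False}"
        by (auto simp: EF_def)
      have "fc c a True \<in> ?A" if "fc c a False \<in> ?A" by (rule step[OF that ends(1) ne])
      moreover have "fc c a False \<in> ?A" if "fc c a True \<in> ?A"
        by (rule step[OF that ends(2) ne[symmetric]])
      ultimately have "fc c a False \<in> ?A \<and> fc c a True \<in> ?A" using True by argo
      then show ?thesis unfolding EF_def by blast
    next
      case False
      then show ?thesis unfolding EF_def by blast
    qed
  qed auto
  then have "\<forall>F\<in>Fs. \<exists>\<phi>. \<forall>F'\<in>?W. face_sum \<phi> F' = (if F' = F then 1 else 0)" by blast
  then obtain \<phi> where phi: "\<And>F F'. F \<in> Fs \<Longrightarrow> F' \<in> ?W \<Longrightarrow> face_sum (\<phi> F) F' = (if F' = F then 1 else 0)"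
    by (metis bchoice)
  define \<kappa> where "\<kappa> c a = (\<Sum>F\<in>Fs. v F * \<phi> F c a)" for c a
  have chi: "face_sum \<kappa> F = v F" if "F \<in> ?W" for F
  proof -
    have "face_sum \<kappa> F = (\<Sum>F'\<in>Fs. v F' * face_sum (\<phi> F') F)"
      unfolding \<kappa>_def face_sum_sum face_sum_scale ..
    also have "\<dots> = (\<Sum>F'\<in>Fs. if F = F' then v F' else 0)"
      by (intro sum.cong refl) (simp add: phi[OF _ that])
    also have "\<dots> = v F" using that finite_Fs by simp
    finally show ?thesis .
  qed
  define l where "l = (\<Sum>c\<in>C. \<Sum>a\<in>UNIV. \<kappa> c a)"
  let ?phi = "\<lambda>c a. \<kappa> c a - l * single_edge c0 a0 c a"
  obtain g z where gz: "\<And>c a. c \<in> C \<Longrightarrow> ?phi c a = edge_lift g z c a"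
    using edge_lift_surj[of ?phi] by blast
  have "(\<Sum>c\<in>C. \<Sum>a\<in>UNIV. l * single_edge c0 a0 c a) = (\<Sum>c\<in>C. if c = c0 then l else 0)"
    by (intro sum.cong refl) (cases a0; auto simp: single_edge_def UNIV_bool)
  then have "(\<Sum>c\<in>C. \<Sum>a\<in>UNIV. ?phi c a) = 0"
    using c0 finite_C by (simp add: sum_subtractf l_def)
  moreover have "(\<Sum>c\<in>C. \<Sum>a\<in>UNIV. ?phi c a) = (\<Sum>c\<in>C. \<Sum>a\<in>UNIV. edge_lift g z c a)"
    by (intro sum.cong refl gz)
  ultimately have "(\<Sum>c\<in>C. g c) = 0" by (simp add: sum_edge_lift)
  moreover have "v F - arc_faces g F = (\<Sum>c\<in>C. z c * incidence c F)" if F: "F \<in> ?W" for F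
  proof -
    have "face_sum ?phi F = face_sum (edge_lift g z) F"
      unfolding face_sum_def by (intro sum.cong refl) (simp add: gz)
    moreover have "face_sum ?phi F = v F"
      using F chi[OF F] by (simp add: face_sum_diff[of \<kappa>] face_sum_scale face_sum_single[OF c0])
    ultimately show ?thesis by (simp add: face_sum_edge_lift)
  qed
  ultimately show ?thesis using that[of g] unfolding in_row_space_def by blast
qed

end

section \<open>Fox combinations and matchings\<close>

text \<open>
  Along the segment between the two matrices that keep only the entries at \<open>p\<close>, respectively at \<open>q\<close>, the
  determinant changes its sign, so it vanishes at an interior point.
\<close>

lemma opposite_terms_kernel:
  fixes M :: "nat \<Rightarrow> nat \<Rightarrow> real"
  assumes p: "p permutes {0..<n}" and q: "q permutes {0..<n}"
    and opp: "(signof p * (\<Prod>i<n. M i (p i))) * (signof q * (\<Prod>i<n. M i (q i))) < 0"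
  obtains s g where "0 < s" "s < 1" "\<exists>j<n. g j \<noteq> 0"
    "\<And>i. i < n \<Longrightarrow> (1 - s) * M i (p i) * g (p i) + s * M i (q i) * g (q i) = 0"
proof -
  define N where "N s = mat n n (\<lambda>(i, j). (1 - s) * (if j = p i then M i j else 0) +
      s * (if j = q i then M i j else 0))" for s :: real
  define d where "d s = Determinant.det (N s)" for s
  have N: "N s \<in> carrier_mat n n" for s by (simp add: N_def)
  have d: "d s = (\<Sum>r\<in>{r. r permutes {0..<n}}. signof r * (\<Prod>i = 0..<n.
      (1 - s) * (if r i = p i then M i (r i) else 0) + s * (if r i = q i then M i (r i) else 0)))" for s
    unfolding d_def det_def'[OF N]
  proof (rule sum.cong[OF refl])
    fix r assume "r \<in> {r. r permutes {0..<n}}"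
    then have "r i < n" if "i < n" for i
      using that permutes_in_image[of r "{0..<n}" i] by auto
    then show "signof r * (\<Prod>i = 0..<n. N s $$ (i, r i)) = signof r * (\<Prod>i = 0..<n.
      (1 - s) * (if r i = p i then M i (r i) else 0) + s * (if r i = q i then M i (r i) else 0))"
      by (auto simp: N_def intro!: prod.cong)
  qed
  have one: "(\<Sum>r\<in>{r. r permutes {0..<n}}. signof r * (\<Prod>i = 0..<n. if r i = u i then M i (r i) else 0))
      = signof u * (\<Prod>i<n. M i (u i))" if u: "u permutes {0..<n}" for u
  proof -
    have "(\<Sum>r\<in>{r. r permutes {0..<n}}. signof r * (\<Prod>i = 0..<n. if r i = u i then M i (r i) else 0))
      = (\<Sum>r\<in>{r. r permutes {0..<n}}. if r = u then signof u * (\<Prod>i<n. M i (u i)) else 0)"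
    proof (rule sum.cong[OF refl])
      fix r assume "r \<in> {r. r permutes {0..<n}}"
      then have r: "r permutes {0..<n}" by simp
      show "signof r * (\<Prod>i = 0..<n. if r i = u i then M i (r i) else 0) =
        (if r = u then signof u * (\<Prod>i<n. M i (u i)) else 0)"
      proof (cases "r = u")
        case True
        then show ?thesis by (simp add: lessThan_atLeast0)
      next
        case False
        then obtain i where i: "r i \<noteq> u i" by blast
        then have "i < n" using r u by (metis atLeastLessThan_iff le0 permutes_not_in)
        then have "(\<Prod>i = 0..<n. if r i = u i then M i (r i) else 0) = 0"
          using i by (intro prod_zero) auto
        then show ?thesis using False by simp
      qed
    qed
    also have "\<dots> = signof u * (\<Prod>i<n. M i (u i))"
      using u by (simp add: finite_permutations)
    finally show ?thesis .
  qed
  have d0: "d 0 = signof p * (\<Prod>i<n. M i (p i))" using one[OF p] by (simp add: d)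
  have d1: "d 1 = signof q * (\<Prod>i<n. M i (q i))" using one[OF q] by (simp add: d)
  have cont: "continuous_on {0..1} d"
    unfolding d by (intro continuous_intros)
  have prod: "d 0 * d 1 < 0" using opp by (simp add: d0 d1)
  have "\<exists>s\<in>{0..1}. d s = 0"
  proof (cases "d 0 \<le> 0")
    case True
    then have "0 \<le> d 1" using prod by (auto simp: mult_less_0_iff)
    then show ?thesis using IVT'[of d 0 0 1] True cont by auto
  next
    case False
    then have "d 1 \<le> 0" using prod by (auto simp: mult_less_0_iff)
    then show ?thesis using IVT2'[of d 1 0 0] False cont by auto
  qed
  then obtain s where s: "0 \<le> s" "s \<le> 1" "d s = 0" by auto
  have "s \<noteq> 0" "s \<noteq> 1" using s prod by auto
  with s have s01: "0 < s" "s < 1" by auto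
  obtain v where v: "v \<in> carrier_vec n" "v \<noteq> 0\<^sub>v n" "N s *\<^sub>v v = 0\<^sub>v n"
    using s(3) det_0_iff_vec_prod_zero_field[OF N] by (auto simp: d_def)
  have "\<exists>j<n. v $ j \<noteq> 0"
  proof (rule ccontr)
    assume "\<not> ?thesis"
    then have "v = 0\<^sub>v n" using v(1) by (intro eq_vecI) auto
    then show False using v by simp
  qed
  moreover have "(1 - s) * M i (p i) * v $ (p i) + s * M i (q i) * v $ (q i) = 0" if i: "i < n" for i
  proof -
    have pq: "p i < n" "q i < n"
      using i permutes_in_image[OF p, of i] permutes_in_image[OF q, of i] by auto
    have "0 = (N s *\<^sub>v v) $ i" using v i by simp
    also have "\<dots> = (\<Sum>j = 0..<n. ((1 - s) * (if j = p i then M i j else 0) + s * (if j = q i then M i j else 0)) * v $ j)"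
      using i v(1) by (simp add: N_def scalar_prod_def)
    also have "\<dots> = (\<Sum>j = 0..<n. (if j = p i then (1 - s) * M i j * v $ j else 0) + (if j = q i then s * M i j * v $ j else 0))"
      by (rule sum.cong) (auto simp: algebra_simps)
    also have "\<dots> = (1 - s) * M i (p i) * v $ (p i) + s * M i (q i) * v $ (q i)"
      using pq by (simp add: sum.distrib)
    finally show ?thesis by simp
  qed
  ultimately show ?thesis using that[of s "\<lambda>j. v $ j"] s01 by blast
qed

context alternating_map
begin

lemma incidence_corner [simp]: "c \<in> C \<Longrightarrow> incidence c (fc c a b) = side b"
  by (cases a; cases b) (simp_all add: incidence_def UNIV_bool fc_eq_iff)

lemma incidence_nonzero_iff: "c \<in> C \<Longrightarrow> incidence c F \<noteq> 0 \<longleftrightarrow> (\<exists>a b. F = fc c a b)"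
proof
  assume "incidence c F \<noteq> 0"
  then show "\<exists>a b. F = fc c a b" by (auto simp: incidence_def UNIV_bool split: if_splits)
qed (auto simp: side_def split: if_splits)

lemma sum_incidence:
  assumes c: "c \<in> C"
  shows "(\<Sum>F\<in>Fs. incidence c F * v F) =
    v (fc c False True) + v (fc c True True) - v (fc c False False) - v (fc c True False)"
proof -
  have "(\<Sum>F\<in>Fs. incidence c F * v F) = (\<Sum>F\<in>{fc c False True, fc c True True, fc c False False, fc c True False}. incidence c F * v F)"
    using c finite_Fs incidence_nonzero_iff[OF c]
    by (intro sum.mono_neutral_right) (auto simp: fc_in_Fs, metis (full_types))
  then show ?thesis using c by (simp add: fc_eq_iff)
qed

definition face_matchings :: "'f set \<Rightarrow> ('c \<Rightarrow> 'f) set"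
  where "face_matchings W =
    {m \<in> extensional C. bij_betw m C W \<and> (\<forall>c\<in>C. \<exists>a b. m c = fc c a b)}"

text \<open>
  The row lattice of the incidence matrix with the columns of \<open>EF c0 a0\<close> deleted has index its absolute
  determinant, and \<open>arc_faces\<close> transports this to the combinations of arcs. In the Leibniz expansion
  two terms with opposite signs would give a kernel vector \<open>g\<close> of a mixture of two matchings. Take for the
  crossings those matched to faces where \<open>g\<close> is nonzero, and for the signs those of \<open>g\<close>: the kernel
  equation at a crossing makes the contributions of its two matched faces opposite, as
  \<open>no_balanced_set\<close> forbids.
\<close>

theorem fox_index:
  assumes count: "card C + 2 \<le> card Fs" and c0: "c0 \<in> C"
  obtains red :: "('c \<Rightarrow> int) \<Rightarrow> nat \<Rightarrow> int"
  where "\<And>g g'. sum g C = 0 \<Longrightarrow> sum g' C = 0 \<Longrightarrow>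
      red g = red g' \<longleftrightarrow> (\<exists>\<psi>. \<forall>c\<in>C. g c - g' c = fox_combination \<psi> c)"
    and "finite (red ` {g. sum g C = 0})"
    and "card (red ` {g. sum g C = 0}) = card (face_matchings (Fs - EF c0 a0))"
proof -
  let ?W = "Fs - EF c0 a0"
  define n where "n = card C"
  have "card (EF c0 a0) = 2" using c0 by (simp add: EF_def fc_eq_iff)
  then have cW: "card ?W = n"
    using exactness(1)[OF count fc_in_Fs[OF c0]]
      card_Diff_subset[OF finite_subset[OF EF_subset[OF c0, of a0] finite_Fs] EF_subset[OF c0, of a0]]
    by (simp add: n_def)
  obtain ci where ci: "bij_betw ci {0..<n} C"
    using ex_bij_betw_nat_finite[OF finite_C] by (auto simp: n_def)
  obtain wi where wi: "bij_betw wi {0..<n} ?W"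
    using ex_bij_betw_nat_finite[of ?W] finite_Fs cW by auto
  define ic where "ic = inv_into {0..<n} ci"
  define iw where "iw = inv_into {0..<n} wi"
  have ci_in: "ci i \<in> C" if "i < n" for i using ci that by (auto simp: bij_betw_def)
  have wi_in: "wi i \<in> ?W" if "i < n" for i using wi that by (auto simp: bij_betw_def)
  have ic: "ic c < n" "ci (ic c) = c" if "c \<in> C" for c
    using that bij_betw_inv_into_right[OF ci that] bij_betwE[OF bij_betw_inv_into[OF ci]]
    by (auto simp: ic_def)
  have iw: "iw F < n" "wi (iw F) = F" if "F \<in> ?W" for F
    using that bij_betw_inv_into_right[OF wi that] bij_betwE[OF bij_betw_inv_into[OF wi]]
    by (auto simp: iw_def)
  have ic_ci: "ic (ci i) = i" if "i < n" for i
    using that bij_betw_inv_into_left[OF ci, of i] by (simp add: ic_def)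
  have iw_wi: "iw (wi i) = i" if "i < n" for i
    using that bij_betw_inv_into_left[OF wi, of i] by (simp add: iw_def)
  define A where "A = mat n n (\<lambda>(i, j). incidence (ci i) (wi j))"
  have A: "A \<in> carrier_mat n n" by (simp add: A_def)
  have Aij: "A $$ (i, j) = incidence (ci i) (wi j)" if "i < n" "j < n" for i j
    using that by (simp add: A_def)
  have det: "Determinant.det A \<noteq> 0"
  proof
    assume "Determinant.det A = 0"
    then obtain v where v: "v \<in> carrier_vec n" "v \<noteq> 0\<^sub>v n" "A *\<^sub>v v = 0\<^sub>v n"
      using det_0_iff_vec_prod_zero[OF A] by auto
    define v' where "v' F = (if F \<in> ?W then v $ (iw F) else 0)" for F
    have "v' F = 0" if F: "F \<in> Fs" for F
    proof (rule incidence_kernel_trivial[OF c0 _ _ F])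
      show "v' F = 0" if "F \<in> EF c0 a0" for F using that by (simp add: v'_def)
    next
      fix c assume c: "c \<in> C"
      have "(\<Sum>F\<in>Fs. incidence c F * v' F) = (\<Sum>F\<in>?W. incidence c F * v' F)"
        using finite_Fs by (intro sum.mono_neutral_right) (auto simp: v'_def)
      also have "\<dots> = (\<Sum>j\<in>{0..<n}. incidence c (wi j) * v' (wi j))"
        by (rule sum.reindex_bij_betw[OF wi, symmetric])
      also have "\<dots> = (\<Sum>j\<in>{0..<n}. A $$ (ic c, j) * v $ j)"
        using ic[OF c] wi_in by (intro sum.cong refl) (simp add: Aij v'_def iw_wi)
      also have "\<dots> = (A *\<^sub>v v) $ (ic c)"
        using ic[OF c] v(1) A by (simp add: scalar_prod_def)
      also have "\<dots> = 0" using v(3) ic[OF c] by simp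
      finally show "v' (fc c False True) + v' (fc c True True) = v' (fc c False False) + v' (fc c True False)"
        using sum_incidence[OF c, of v'] by simp
    qed
    then have "v $ j = 0" if "j < n" for j
      using that wi_in[OF that] iw_wi[OF that] by (metis Diff_iff v'_def)
    then have "v = 0\<^sub>v n" using v(1) by (intro eq_vecI) auto
    then show False using v by simp
  qed
  obtain red0 :: "(nat \<Rightarrow> int) \<Rightarrow> nat \<Rightarrow> int" where red0: "\<And>v w. red0 v = red0 w \<longleftrightarrow> in_row_lattice A (\<lambda>j. v j - w j)"
    and fin0: "finite (range red0)" and card0: "int (card (range red0)) = \<bar>Determinant.det A\<bar>"
    by (rule row_lattice_index[OF A det]) (rule that)
  have lat: "in_row_lattice A (\<lambda>j. v (wi j)) \<longleftrightarrow> in_row_space ?W v" for v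
  proof
    assume "in_row_lattice A (\<lambda>j. v (wi j))"
    then obtain z where z: "\<And>j. j < n \<Longrightarrow> v (wi j) = (\<Sum>i<n. z i * A $$ (i, j))"
      using A by (auto simp: in_row_lattice_def)
    have "v F = (\<Sum>c\<in>C. z (ic c) * incidence c F)" if F: "F \<in> ?W" for F
    proof -
      have "v F = (\<Sum>i\<in>{0..<n}. z i * A $$ (i, iw F))" using z[OF iw(1)[OF F]] iw(2)[OF F] by (simp add: lessThan_atLeast0)
      also have "\<dots> = (\<Sum>i\<in>{0..<n}. z (ic (ci i)) * incidence (ci i) F)"
        by (intro sum.cong refl) (simp add: Aij iw[OF F] ic_ci)
      also have "\<dots> = (\<Sum>c\<in>C. z (ic c) * incidence c F)"
        by (rule sum.reindex_bij_betw[OF ci])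
      finally show ?thesis .
    qed
    then show "in_row_space ?W v" unfolding in_row_space_def by (intro exI[of _ "\<lambda>c. z (ic c)"]) blast
  next
    assume "in_row_space ?W v"
    then obtain z where z: "\<And>F. F \<in> ?W \<Longrightarrow> v F = (\<Sum>c\<in>C. z c * incidence c F)"
      by (auto simp: in_row_space_def)
    have "v (wi j) = (\<Sum>i<n. z (ci i) * A $$ (i, j))" if j: "j < n" for j
    proof -
      have "v (wi j) = (\<Sum>i\<in>{0..<n}. z (ci i) * incidence (ci i) (wi j))"
        unfolding z[OF wi_in[OF j]] by (rule sum.reindex_bij_betw[OF ci, symmetric])
      also have "\<dots> = (\<Sum>i<n. z (ci i) * A $$ (i, j))"
        by (intro sum.cong) (auto simp: Aij j)
      finally show ?thesis .
    qed
    then show "in_row_lattice A (\<lambda>j. v (wi j))"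
      unfolding in_row_lattice_def using A by (intro exI[of _ "\<lambda>i. z (ci i)"]) auto
  qed

  define Q where "Q = {p. p permutes {0..<n} \<and> (\<forall>i<n. A $$ (i, p i) \<noteq> 0)}"
  define trm where "trm p = signof p * (\<Prod>i = 0..<n. A $$ (i, p i))" for p
  have Q_lt: "p i < n" if "p \<in> Q" "i < n" for p i
    using that permutes_in_image[of p "{0..<n}" i] by (auto simp: Q_def)
  have Q_corner: "\<exists>a b. wi (p i) = fc (ci i) a b" if "p \<in> Q" "i < n" for p i
    using that Q_lt[OF that] incidence_nonzero_iff[OF ci_in[OF that(2)], of "wi (p i)"]
    by (auto simp: Q_def Aij)
  have Q_abs: "\<bar>A $$ (i, p i)\<bar> = 1" if p: "p \<in> Q" and i: "i < n" for p i
    using Q_corner[OF p i] Q_lt[OF p i] i ci_in[OF i] by (auto simp: Aij side_def)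
  have trm_abs: "\<bar>trm p\<bar> = 1" if p: "p \<in> Q" for p
  proof -
    have "\<bar>trm p\<bar> = (\<Prod>i = 0..<n. \<bar>A $$ (i, p i)\<bar>)"
      by (simp add: trm_def abs_mult abs_prod sign_def)
    also have "\<dots> = 1" using Q_abs[OF p] by (intro prod.neutral) auto
    finally show ?thesis .
  qed
  have same: "trm p = trm q" if p: "p \<in> Q" and q: "q \<in> Q" for p q
  proof (rule ccontr)
    assume "trm p \<noteq> trm q"
    then have neg: "trm p * trm q < 0"
      using trm_abs[OF p] trm_abs[OF q] by (auto simp: abs_if split: if_splits)
    let ?M = "\<lambda>i j. real_of_int (A $$ (i, j))"
    have re: "real_of_int (trm p) = signof p * (\<Prod>i<n. ?M i (p i))" for p
      by (simp add: trm_def lessThan_atLeast0 sign_def)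
    have pp: "p permutes {0..<n}" "q permutes {0..<n}" using p q by (auto simp: Q_def)
    have opp: "(signof p * (\<Prod>i<n. ?M i (p i))) * (signof q * (\<Prod>i<n. ?M i (q i))) < 0"
      using neg unfolding re[symmetric] by (simp only: of_int_mult[symmetric] of_int_less_0_iff)
    obtain s g where s: "0 < s" "s < 1" and gne: "\<exists>j<n. g j \<noteq> (0 :: real)"
      and ker: "\<And>i. i < n \<Longrightarrow> (1 - s) * ?M i (p i) * g (p i) + s * ?M i (q i) * g (q i) = 0"
      by (rule opposite_terms_kernel[OF pp opp]) (rule that)
    define \<sigma> where "\<sigma> c = wi (p (ic c))" for c
    define P0 where "P0 = {c \<in> C. g (p (ic c)) \<noteq> 0}"
    define e0 where "e0 F = (if F \<in> ?W \<and> g (iw F) < 0 then - 1 else 1 :: int)" for F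
    have sig_in: "\<sigma> c \<in> ?W" if "c \<in> C" for c using wi_in Q_lt[OF p] ic[OF that] by (simp add: \<sigma>_def)
    show False
    proof (rule no_balanced_set[of \<sigma> c0 a0 P0 e0])
      show "inj_on \<sigma> C"
      proof (rule inj_onI)
        fix c d assume cd: "c \<in> C" "d \<in> C" "\<sigma> c = \<sigma> d"
        then have "iw (wi (p (ic c))) = iw (wi (p (ic d)))" by (simp add: \<sigma>_def)
        then have "p (ic c) = p (ic d)" using cd by (simp add: iw_wi Q_lt[OF p] ic)
        then have "ic c = ic d" using permutes_inj[OF pp(1)] by (simp add: inj_eq)
        then have "ci (ic c) = ci (ic d)" by simp
        then show "c = d" using cd by (simp add: ic)
      qed
      show "\<exists>a b. \<sigma> c = fc c a b" if "c \<in> C" for c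
        using Q_corner[OF p ic(1)[OF that]] ic(2)[OF that] by (simp add: \<sigma>_def)
      show "c0 \<in> C" by (rule c0)
      show "\<sigma> ` C \<inter> EF c0 a0 = {}" using sig_in by blast
      show "P0 \<subseteq> C" by (auto simp: P0_def)
      show "sign_fun e0" by (auto simp: sign_fun_def e0_def)
      obtain j where j: "j < n" "g j \<noteq> 0" using gne by blast
      obtain i where i: "i < n" "p i = j"
        using j permutes_image[OF pp(1)] by (metis atLeastLessThan_iff imageE le0)
      have "ci i \<in> P0" using i j ci_in ic_ci by (simp add: P0_def)
      then show "P0 \<noteq> {}" by blast
    next
      fix c assume cP: "c \<in> P0"
      then have c: "c \<in> C" and gp: "g (p (ic c)) \<noteq> 0" by (auto simp: P0_def)
      let ?i = "ic c"
      have i: "?i < n" "ci ?i = c" using ic[OF c] by auto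
      obtain a b where ab: "wi (p ?i) = fc c a b" using Q_corner[OF p i(1)] i(2) by auto
      obtain a' b' where ab': "wi (q ?i) = fc c a' b'" using Q_corner[OF q i(1)] i(2) by auto
      have M: "?M ?i (p ?i) = of_int (side b)" "?M ?i (q ?i) = of_int (side b')"
        using Q_lt[OF p i(1)] Q_lt[OF q i(1)] i ab ab' c by (simp_all add: Aij)
      have eq: "(1 - s) * of_int (side b) * g (p ?i) + s * of_int (side b') * g (q ?i) = 0"
        using ker[OF i(1)] by (simp only: M)
      have gq: "g (q ?i) \<noteq> 0"
      proof
        assume "g (q ?i) = 0"
        then show False using eq gp s by (auto simp: side_def split: if_splits)
      qed
      obtain k where k: "k < n" "p k = q ?i"
        using Q_lt[OF q i(1)] permutes_image[OF pp(1)] by (metis atLeastLessThan_iff imageE le0)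
      have "ci k \<in> P0" "\<sigma> (ci k) = fc c a' b'"
        using k gq ab' ci_in ic_ci by (simp_all add: P0_def \<sigma>_def)
      then have "fc c a' b' \<in> \<sigma> ` P0" by (intro image_eqI[of _ _ "ci k"]) simp_all
      moreover have "fc c a b \<in> \<sigma> ` P0" using cP ab by (intro image_eqI[of _ _ c]) (simp_all add: \<sigma>_def)
      moreover have "theta e0 c a b = - theta e0 c a' b'"
      proof -
        have W: "fc c a b \<in> ?W" "fc c a' b' \<in> ?W"
          using wi_in[OF Q_lt[OF p i(1)]] wi_in[OF Q_lt[OF q i(1)]] ab ab' by simp_all
        have "iw (fc c a b) = p ?i" "iw (fc c a' b') = q ?i"
          using iw_wi[OF Q_lt[OF p i(1)]] iw_wi[OF Q_lt[OF q i(1)]] ab ab' by simp_all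
        then have e: "e0 (fc c a b) = (if g (p ?i) < 0 then - 1 else 1)"
            "e0 (fc c a' b') = (if g (q ?i) < 0 then - 1 else 1)"
          using W by (simp_all add: e0_def)
        have sign_swap: "x < 0 \<longleftrightarrow> 0 < y" if "(1 - s) * x = - (s * y)" for x y :: real
        proof -
          have "x < 0 \<longleftrightarrow> (1 - s) * x < 0" using s by (simp add: mult_less_0_iff)
          also have "\<dots> \<longleftrightarrow> 0 < s * y" by (simp add: that)
          also have "\<dots> \<longleftrightarrow> 0 < y" using s by (simp add: zero_less_mult_iff)
          finally show ?thesis .
        qed
        have "(1 - s) * (of_int (side b) * g (p ?i)) = - (s * (of_int (side b') * g (q ?i)))"
          using eq by (simp add: algebra_simps)
        then have "(of_int (side b) * g (p ?i) < 0) = (of_int (side b') * g (q ?i) > 0)"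
          by (rule sign_swap)
        then show ?thesis
          unfolding theta_def e using gp gq by (cases b; cases b') (auto split: if_splits)
      qed
      ultimately show "\<exists>a b a' b'. fc c a b \<in> \<sigma> ` P0 \<and> fc c a' b' \<in> \<sigma> ` P0 \<and>
          theta e0 c a b = - theta e0 c a' b'" by blast
    qed
  qed
  have finQ: "finite Q"
    by (rule finite_subset[OF _ finite_permutations[of "{0..<n}"]]) (auto simp: Q_def)
  have "\<bar>Determinant.det A\<bar> = int (card Q)"
  proof -
    have "Determinant.det A = (\<Sum>p\<in>Q. trm p)"
      unfolding det_def'[OF A] trm_def Q_def
    proof (rule sum.mono_neutral_right)
      show "finite {p. p permutes {0..<n}}" by (simp add: finite_permutations)
      show "\<forall>p\<in>{p. p permutes {0..<n}} - {p. p permutes {0..<n} \<and> (\<forall>i<n. A $$ (i, p i) \<noteq> 0)}.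
         signof p * (\<Prod>i = 0..<n. A $$ (i, p i)) = 0"
        by (auto intro!: prod_zero)
    qed auto
    then show ?thesis
    proof (cases "Q = {}")
      case False
      then obtain p where p: "p \<in> Q" by blast
      have "(\<Sum>q\<in>Q. trm q) = (\<Sum>q\<in>Q. trm p)" by (intro sum.cong refl same p)
      then show ?thesis using \<open>Determinant.det A = _\<close> trm_abs[OF p] by (simp add: abs_mult)
    qed simp
  qed
  moreover have "card Q = card (face_matchings ?W)"
  proof (rule bij_betw_same_card)
    show "bij_betw (\<lambda>p. restrict (\<lambda>c. wi (p (ic c))) C) Q (face_matchings ?W)"
    proof (rule bij_betw_imageI)
      show "inj_on (\<lambda>p. restrict (\<lambda>c. wi (p (ic c))) C) Q"
      proof (rule inj_onI)
        fix p q assume p: "p \<in> Q" and q: "q \<in> Q"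
          and eq: "restrict (\<lambda>c. wi (p (ic c))) C = restrict (\<lambda>c. wi (q (ic c))) C"
        show "p = q"
        proof
          fix i
          show "p i = q i"
          proof (cases "i < n")
            case True
            have "restrict (\<lambda>c. wi (p (ic c))) C (ci i) = restrict (\<lambda>c. wi (q (ic c))) C (ci i)"
              by (simp only: eq)
            then have "wi (p i) = wi (q i)" using ci_in[OF True] ic_ci[OF True] by simp
            then have "iw (wi (p i)) = iw (wi (q i))" by (simp only:)
            then show ?thesis by (simp only: iw_wi[OF Q_lt[OF p True]] iw_wi[OF Q_lt[OF q True]])
          next
            case False
            then show ?thesis using p q by (simp add: Q_def permutes_def)
          qed
        qed
      qed
      show "(\<lambda>p. restrict (\<lambda>c. wi (p (ic c))) C) ` Q = face_matchings ?W"
      proof (intro subset_antisym subsetI)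
        fix m assume "m \<in> (\<lambda>p. restrict (\<lambda>c. wi (p (ic c))) C) ` Q"
        then obtain p where p: "p \<in> Q" and m: "m = restrict (\<lambda>c. wi (p (ic c))) C" by blast
        have icb: "bij_betw ic C {0..<n}" unfolding ic_def by (rule bij_betw_inv_into[OF ci])
        have "p permutes {0..<n}" using p by (simp add: Q_def)
        then have "bij_betw (wi \<circ> (p \<circ> ic)) C ?W"
          by (intro bij_betw_trans[OF bij_betw_trans[OF icb permutes_imp_bij] wi])
        then have "bij_betw m C ?W" 
          by (rule bij_betw_cong[THEN iffD1, rotated]) (simp add: m)
        moreover have "\<exists>a b. m c = fc c a b" if "c \<in> C" for c
          using Q_corner[OF p ic(1)[OF that]] ic(2)[OF that] that by (simp add: m)
        ultimately show "m \<in> face_matchings ?W" by (simp add: face_matchings_def m)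
      next
        fix m assume "m \<in> face_matchings ?W"
        then have m: "m \<in> extensional C" "bij_betw m C ?W" "\<And>c. c \<in> C \<Longrightarrow> \<exists>a b. m c = fc c a b"
          by (auto simp: face_matchings_def)
        define p where "p i = (if i < n then iw (m (ci i)) else i)" for i
        have mW: "m (ci i) \<in> ?W" if "i < n" for i using m(2) ci_in[OF that] by (rule bij_betw_apply)
        have "bij_betw (iw \<circ> (m \<circ> ci)) {0..<n} {0..<n}"
          unfolding iw_def by (intro bij_betw_trans[OF bij_betw_trans[OF ci m(2)] bij_betw_inv_into[OF wi]])
        then have "bij_betw p {0..<n} {0..<n}"
          by (rule bij_betw_cong[THEN iffD1, rotated]) (simp add: p_def)
        then have "p permutes {0..<n}" by (intro bij_imp_permutes) (auto simp: p_def)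
        moreover have wp: "wi (p i) = m (ci i)" "p i < n" if "i < n" for i
          using iw[OF mW[OF that]] that by (simp_all add: p_def)
        ultimately have pQ: "p \<in> Q"
          unfolding Q_def using m(3) ci_in incidence_nonzero_iff by (auto simp: Aij)
        have "m = restrict (\<lambda>c. wi (p (ic c))) C"
          using m(1) ic wp by (intro extensionalityI[of _ C]) auto
        then show "m \<in> (\<lambda>p. restrict (\<lambda>c. wi (p (ic c))) C) ` Q" using pQ by (rule image_eqI)
      qed
    qed
  qed
  ultimately have card1: "card (range red0) = card (face_matchings ?W)" using card0 by simp
  define red where "red g = red0 (\<lambda>j. arc_faces g (wi j))" for g
  have af_diff: "arc_faces (\<lambda>c. g c - g' c) F = arc_faces g F - arc_faces g' F" for g g' :: "'c \<Rightarrow> int" and F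
    unfolding arc_faces_def sum_subtractf[symmetric] by (intro sum.cong refl) auto
  show ?thesis
  proof (rule that[of red])
    fix g g' :: "'c \<Rightarrow> int" assume tot: "sum g C = 0" "sum g' C = 0"
    have "red g = red g' \<longleftrightarrow> in_row_space ?W (\<lambda>F. arc_faces g F - arc_faces g' F)"
      unfolding red_def red0 by (rule lat)
    also have "\<dots> \<longleftrightarrow> in_row_space ?W (arc_faces (\<lambda>c. g c - g' c))"
      by (simp only: af_diff[symmetric])
    also have "\<dots> \<longleftrightarrow> (\<exists>\<psi>. \<forall>c\<in>C. g c - g' c = fox_combination \<psi> c)"
    proof
      assume row: "in_row_space ?W (arc_faces (\<lambda>c. g c - g' c))"
      have "(\<Sum>c\<in>C. g c - g' c) = 0" using tot by (simp add: sum_subtractf)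
      from row_space_imp_fox_combination[OF count c0 this row]
      show "\<exists>\<psi>. \<forall>c\<in>C. g c - g' c = fox_combination \<psi> c" by metis
    next
      assume "\<exists>\<psi>. \<forall>c\<in>C. g c - g' c = fox_combination \<psi> c"
      then show "in_row_space ?W (arc_faces (\<lambda>c. g c - g' c))"
        by (elim exE) (rule fox_combination_imp_row_space, rule bspec)
    qed
    finally show "red g = red g' \<longleftrightarrow> (\<exists>\<psi>. \<forall>c\<in>C. g c - g' c = fox_combination \<psi> c)" .
  next
    have img: "red ` {g. sum g C = 0} = range red0"
    proof (intro subset_antisym subsetI)
      fix x assume "x \<in> range red0"
      then obtain v where x: "x = red0 v" by blast
      obtain g where g: "(\<Sum>c\<in>C. g c) = 0" and row: "in_row_space ?W (\<lambda>F. v (iw F) - arc_faces g F)"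
        by (rule arc_faces_surj[OF c0]) (rule that)
      have "in_row_lattice A (\<lambda>j. v (iw (wi j)) - arc_faces g (wi j))"
        using row by (simp add: lat[of "\<lambda>F. v (iw F) - arc_faces g F"])
      then have "in_row_lattice A (\<lambda>j. v j - arc_faces g (wi j))"
        using A by (simp add: in_row_lattice_def iw_wi)
      then have "red0 v = red g" unfolding red_def by (simp only: red0)
      then show "x \<in> red ` {g. sum g C = 0}" using g x by blast
    qed (auto simp: red_def)
    show "finite (red ` {g. sum g C = 0})" by (simp only: img fin0)
    show "card (red ` {g. sum g C = 0}) = card (face_matchings ?W)" by (simp only: img card1)
  qed
qed

end

section \<open>Arcs and components in the plane\<close>

text \<open>
  An interior point disconnects an arc locally but not a disc.
\<close>

lemma open_not_subset_arc:
  fixes c :: "real \<Rightarrow> complex"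
  assumes c: "arc c" and B: "open B" "B \<noteq> {}"
  shows "\<not> B \<subseteq> path_image c"
proof
  assume sub: "B \<subseteq> path_image c"
  have inj: "inj_on c {0..1}" and cont: "continuous_on {0..1} c"
    using c by (auto simp: arc_def path_def)
  have "infinite B" using B finite_imp_not_open by blast
  then have "\<not> B \<subseteq> {c 0, c 1}" by (meson finite_subset finite.intros)
  then obtain m where m: "m \<in> B" "m \<noteq> c 0" "m \<noteq> c 1" by blast
  then obtain t where t: "t \<in> {0..1}" "m = c t" using sub by (auto simp: path_image_def)
  then have t01: "0 < t" "t < 1" using m by (auto simp: less_le)
  obtain e where e: "e > 0" "ball m e \<subseteq> B" using B(1) m(1) open_contains_ball by blast
  have "connected (ball m e - {m})" by (rule connected_punctured_ball) simp
  have clo: "closed (c ` {0..t})" "closed (c ` {t..1})"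
    using t01 by (auto intro!: compact_imp_closed compact_continuous_image continuous_on_subset[OF cont])
  have cover: "ball m e - {m} \<subseteq> c ` {0..t} \<union> c ` {t..1}"
  proof
    fix z assume "z \<in> ball m e - {m}"
    then have "z \<in> c ` {0..1}" using sub e unfolding path_image_def by blast
    then obtain s where "s \<in> {0..1}" "z = c s" by blast
    then show "z \<in> c ` {0..t} \<union> c ` {t..1}" by (cases "s \<le> t") auto
  qed
  have int: "c ` {0..t} \<inter> c ` {t..1} \<inter> (ball m e - {m}) = {}"
  proof -
    have "z = m" if "z \<in> c ` {0..t}" "z \<in> c ` {t..1}" for z
    proof -
      from that obtain s u where su: "s \<in> {0..t}" "u \<in> {t..1}" "z = c s" "z = c u" by blast
      then have "s = u" using inj t01 by (auto dest: inj_onD)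
      then have "s = t" using su by auto
      then show ?thesis using su t by simp
    qed
    then show ?thesis by blast
  qed
  have "isCont c t"
    using cont t01 by (metis continuous_on_interior interior_atLeastAtMost_real greaterThanLessThan_iff)
  then obtain d where d: "d > 0" "\<And>s. \<bar>s - t\<bar> < d \<Longrightarrow> dist (c s) (c t) < e"
    using e(1) unfolding continuous_at_eps_delta dist_real_def by metis
  define h where "h = min (d / 2) (min t (1 - t))"
  have h: "0 < h" "h < d" "h \<le> t" "h \<le> 1 - t" using d t01 by (auto simp: h_def min_def)
  have "c (t - h) \<in> c ` {0..t} \<inter> (ball m e - {m})"
    using d(2)[of "t - h"] h t inj_onD[OF inj, of "t - h" t] by (auto simp: dist_commute)
  moreover have "c (t + h) \<in> c ` {t..1} \<inter> (ball m e - {m})"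
    using d(2)[of "t + h"] h t inj_onD[OF inj, of "t + h" t] by (auto simp: dist_commute)
  ultimately show False
    using connected_closedD[OF \<open>connected (ball m e - {m})\<close> int cover clo] by blast
qed

text \<open>
  Each component of the complement of \<open>S\<close> contains one of the complement of \<open>T\<close>. The count is strict if
  some component is cut into pieces.
\<close>

lemma card_components_mono:
  fixes S T :: "complex set"
  assumes ST: "S \<subseteq> T" and fin: "finite (components (- T))"
    and meets: "\<And>G. G \<in> components (- S) \<Longrightarrow> \<not> G \<subseteq> T"
  shows "finite (components (- S))" and "card (components (- S)) \<le> card (components (- T))"
    and "connected_component (- S) a b \<Longrightarrow> a \<notin> T \<Longrightarrow> b \<notin> T \<Longrightarrow> \<not> connected_component (- T) a b
      \<Longrightarrow> card (components (- S)) + 1 \<le> card (components (- T))"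
proof -
  define r where "r D = connected_component_set (- S) (SOME p. p \<in> D)" for D
  have r: "r (connected_component_set (- T) p) = connected_component_set (- S) p" if "p \<notin> T" for p
  proof -
    have "p \<in> connected_component_set (- T) p" using that by simp
    then have "(SOME q. q \<in> connected_component_set (- T) p) \<in> connected_component_set (- T) p"
      by (rule someI)
    then have "connected_component (- S) p (SOME q. q \<in> connected_component_set (- T) p)"
      using connected_component_of_subset[of "- T" p _ "- S"] ST by auto
    then show ?thesis unfolding r_def by (metis connected_component_eq mem_Collect_eq)
  qed
  have sub: "components (- S) \<subseteq> r ` components (- T)"
  proof
    fix G assume G: "G \<in> components (- S)"
    then obtain p where p: "p \<in> G" "p \<notin> T" using meets by blast
    have "G = connected_component_set (- S) p"
      using G p by (metis connected_component_eq components_iff)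
    then have "G = r (connected_component_set (- T) p)" using r p by simp
    moreover have "connected_component_set (- T) p \<in> components (- T)"
      using p by (intro componentsI) simp
    ultimately show "G \<in> r ` components (- T)" by blast
  qed
  then show "finite (components (- S))" using fin finite_surj by blast
  show "card (components (- S)) \<le> card (components (- T))"
    using sub fin by (meson card_image_le card_mono finite_imageI le_trans)
  assume ab: "connected_component (- S) a b" "a \<notin> T" "b \<notin> T" "\<not> connected_component (- T) a b"
  have "\<not> inj_on r (components (- T))"
  proof
    assume inj: "inj_on r (components (- T))"
    have "connected_component_set (- S) a = connected_component_set (- S) b"
      using ab(1) by (metis connected_component_eq mem_Collect_eq)
    then have "r (connected_component_set (- T) a) = r (connected_component_set (- T) b)"
      using r ab by simp
    moreover have "connected_component_set (- T) a \<in> components (- T)"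
      "connected_component_set (- T) b \<in> components (- T)"
      using ab by (auto intro: componentsI)
    ultimately have "connected_component_set (- T) a = connected_component_set (- T) b"
      using inj by (auto dest: inj_onD)
    then have "b \<in> connected_component_set (- T) a" using ab by simp
    then show False using ab by simp
  qed
  then have "card (r ` components (- T)) < card (components (- T))"
    using fin card_image_le[OF fin, of r] eq_card_imp_inj_on[OF fin, of r] by linarith
  moreover have "card (components (- S)) \<le> card (r ` components (- T))"
    using sub fin by (intro card_mono) auto
  ultimately show "card (components (- S)) + 1 \<le> card (components (- T))" by simp
qed

lemma simple_closed_curve_separates_locally:
  fixes c :: "real \<Rightarrow> complex"
  assumes c: "simple_path c" "pathfinish c = pathstart c" and S: "closed S"
    and q: "q \<in> path_image c" "q \<notin> S"
  obtains a b where "a \<notin> S \<union> path_image c" "b \<notin> S \<union> path_image c"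
    "connected_component (- S) a b" "\<not> connected_component (- path_image c) a b"
proof -
  let ?J = "path_image c"
  note J = Jordan_inside_outside[OF c]
  obtain e where e: "e > 0" "ball q e \<subseteq> - S"
    using S q open_contains_ball[of "- S"] by (auto simp: open_Compl)
  have "q \<in> closure (inside ?J)" "q \<in> closure (outside ?J)"
    using J q by (auto simp: frontier_def)
  then obtain a b where a: "a \<in> inside ?J" "dist a q < e" and b: "b \<in> outside ?J" "dist b q < e"
    using e(1) unfolding closure_approachable by blast
  have ab: "a \<in> ball q e" "b \<in> ball q e" using a b by (auto simp: dist_commute)
  have nJ: "a \<notin> ?J" "b \<notin> ?J" using a b J by blast+
  have "connected_component (- S) a b"
    using ab e connected_ball[of q e] unfolding connected_component_def by blast
  moreover have "\<not> connected_component (- ?J) a b"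
  proof
    assume "connected_component (- ?J) a b"
    then obtain T where T: "connected T" "T \<subseteq> - ?J" "a \<in> T" "b \<in> T"
      unfolding connected_component_def by blast
    have "T \<subseteq> inside ?J \<union> outside ?J" using T J by blast
    then show False
      using connectedD[OF T(1), of "inside ?J" "outside ?J"] J T a b by blast
  qed
  ultimately show ?thesis using that[of a b] ab e nJ by blast
qed

lemma components_of_partition:
  assumes A: "A = (\<Union>i\<in>I. B i)" and op: "\<And>i. i \<in> I \<Longrightarrow> openin (top_of_set A) (B i)"
    and con: "\<And>i. i \<in> I \<Longrightarrow> connected (B i)" and ne: "\<And>i. i \<in> I \<Longrightarrow> B i \<noteq> {}"
    and disj: "\<And>i j. i \<in> I \<Longrightarrow> j \<in> I \<Longrightarrow> i \<noteq> j \<Longrightarrow> B i \<inter> B j = {}"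
  shows "components A = B ` I"
proof -
  have comp: "connected_component_set A x = B i" if "i \<in> I" "x \<in> B i" for i x
  proof
    show "B i \<subseteq> connected_component_set A x"
      using that A con by (intro connected_component_maximal) auto
    let ?O = "\<Union>j\<in>I - {i}. B j"
    let ?D = "connected_component_set A x"
    have "openin (top_of_set A) ?O" using op by auto
    have rel: "openin (top_of_set ?D) (?D \<inter> U)" if U: "openin (top_of_set A) U" for U
    proof -
      obtain T where T: "open T" "U = A \<inter> T" using U unfolding openin_open by blast
      then have "?D \<inter> U = ?D \<inter> T" using connected_component_subset[of A x] by blast
      then show ?thesis using T by (simp add: openin_open_Int)
    qed
    have "openin (top_of_set ?D) (?D \<inter> ?O)" "openin (top_of_set ?D) (?D \<inter> B i)"
      by (rule rel, fact) (rule rel[OF op[OF that(1)]])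
    moreover have "?D \<subseteq> (?D \<inter> B i) \<union> (?D \<inter> ?O)" using A connected_component_subset[of A x] by blast
    moreover have "(?D \<inter> B i) \<inter> (?D \<inter> ?O) = {}" using disj that by blast
    moreover have "?D \<inter> B i \<noteq> {}"
    proof -
      have "x \<in> A" using that A by blast
      then have "x \<in> ?D" by simp
      then show ?thesis using that by blast
    qed
    ultimately have "?D \<inter> ?O = {}"
      using connected_connected_component[of A x] unfolding connected_openin by blast
    then show "?D \<subseteq> B i" using A connected_component_subset[of A x] by blast
  qed
  show ?thesis
  proof (intro subset_antisym subsetI)
    fix D assume "D \<in> components A"
    then obtain x where x: "x \<in> A" "D = connected_component_set A x" by (auto simp: components_iff)
    then obtain i where "i \<in> I" "x \<in> B i" using A by blast
    then show "D \<in> B ` I" using comp x by blast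
  next
    fix D assume "D \<in> B ` I"
    then obtain i where i: "i \<in> I" "D = B i" by blast
    then obtain x where x: "x \<in> B i" using ne by blast
    then show "D \<in> components A" using comp[OF i(1) x] i A by (auto simp: components_iff)
  qed
qed

text \<open>
  Janiszewski's theorem for an arc that meets \<open>X\<close> in a single point.
\<close>

lemma connected_component_avoiding_hair:
  fixes h :: "real \<Rightarrow> complex"
  assumes X: "closed X" and h: "arc h" and hX: "path_image h \<inter> X = {w}"
    and ab: "connected_component (- X) a b" "a \<notin> path_image h" "b \<notin> path_image h"
  shows "connected_component (- (path_image h \<union> X)) a b"
proof (rule Janiszewski)
  show "compact (path_image h)" using h by (rule compact_arc_image)
  have "connected (- path_image h)" using h by (intro connected_arc_complement) auto
  then show "connected_component (- path_image h) a b"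
    using ab unfolding connected_component_def by blast
qed (use X hX ab in auto)

section \<open>Finitely many points on the circle\<close>

lemma rot_in [simp]: "z * cis t \<in> circle \<longleftrightarrow> z \<in> circle"
  by (simp add: norm_mult)

lemma rot_rot: "z * cis s * cis t = z * cis (s + t)"
  by (simp add: cis_mult mult.assoc)

lemma rot_2pi [simp]: "z * cis (2 * pi) = z"
  by (simp add: complex_eq_iff)

lemma cis_eq_imp:
  assumes "cis s = cis t" "\<bar>s - t\<bar> < 2 * pi"
  shows "s = t"
proof -
  have "sin s = sin t \<and> cos s = cos t" using assms(1) by (simp add: complex_eq_iff)
  then obtain k :: int where k: "s = t + 2 * pi * k" using sin_cos_eq_iff by blast
  have "\<bar>s - t\<bar> = 2 * pi * \<bar>real_of_int k\<bar>" using k by (simp add: abs_mult)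
  then have "\<bar>real_of_int k\<bar> < 1" using assms(2) by simp
  then show ?thesis using k by simp
qed

lemma rot_eq_imp:
  assumes "z * cis s = z * cis t" "z \<in> circle" "\<bar>s - t\<bar> < 2 * pi"
  shows "s = t"
proof -
  have "z \<noteq> 0" using assms(2) by auto
  then show ?thesis using assms cis_eq_imp by simp
qed

lemma rot_eq_shift: "x * cis s = y * cis t \<Longrightarrow> x = y * cis (t - s)"
proof -
  assume "x * cis s = y * cis t"
  then have "x * cis s * cis (- s) = y * cis t * cis (- s)" by simp
  then show ?thesis by (simp add: rot_rot)
qed

lemma on_circle_rot:
  assumes "z \<in> circle" "w \<in> circle"
  obtains t where "0 < t" "t \<le> 2 * pi" "w = z * cis t"
proof -
  have "norm (w / z) = 1" using assms by (simp add: norm_divide)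
  then obtain s where s: "w / z = cis s" "0 \<le> s" "s < 2 * pi"
    by (metis Arg2pi_ge_0 Arg2pi_lt_2pi Arg2pi_eq cis_conv_exp of_real_1 mult_1)
  have z: "z \<noteq> 0" using assms by auto
  then have w: "w = z * cis s" using s by (simp add: field_simps)
  show ?thesis
  proof (cases "s = 0")
    case True
    then show ?thesis using w by (intro that[of "2 * pi"]) auto
  next
    case False
    then show ?thesis using w s by (intro that[of s]) auto
  qed
qed

definition circle_arc :: "complex \<Rightarrow> real set \<Rightarrow> complex set"
  where "circle_arc x T = (\<lambda>t. x * cis t) ` T"

lemma continuous_rot [continuous_intros]: "continuous_on T (\<lambda>t. x * cis t)"
  by (intro continuous_intros)

lemma circle_arc_subset: "x \<in> circle \<Longrightarrow> circle_arc x T \<subseteq> circle"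
  by (auto simp: circle_arc_def norm_mult)

lemma compact_circle_arc: "compact (circle_arc x {s..t})"
  unfolding circle_arc_def by (intro compact_continuous_image continuous_rot) auto

lemma connected_circle_arc: "is_interval T \<Longrightarrow> connected (circle_arc x T)"
  unfolding circle_arc_def by (intro connected_continuous_image continuous_rot) (simp add: is_interval_connected)

lemma circle_arc_complement:
  assumes x: "x \<in> circle" and st: "s < t" "t \<le> s + 2 * pi"
  shows "circle_arc x {s<..<t} = circle - circle_arc x {t..s + 2 * pi}"
proof (intro subset_antisym subsetI)
  fix z assume "z \<in> circle_arc x {s<..<t}"
  then obtain u where u: "s < u" "u < t" "z = x * cis u" by (auto simp: circle_arc_def)
  have "z \<notin> circle_arc x {t..s + 2 * pi}"
  proof
    assume "z \<in> circle_arc x {t..s + 2 * pi}"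
    then obtain v where v: "t \<le> v" "v \<le> s + 2 * pi" "z = x * cis v" by (auto simp: circle_arc_def)
    then have "u = v" using u x by (intro rot_eq_imp[of x u v]) auto
    then show False using u v by simp
  qed
  then show "z \<in> circle - circle_arc x {t..s + 2 * pi}" using u x by (simp add: norm_mult)
next
  fix z assume z: "z \<in> circle - circle_arc x {t..s + 2 * pi}"
  have "x * cis s \<in> circle" "z \<in> circle" using x z by (simp_all add: norm_mult)
  then obtain u where u: "0 < u" "u \<le> 2 * pi" "z = x * cis s * cis u" by (rule on_circle_rot)
  then have zu: "z = x * cis (s + u)" by (simp add: rot_rot)
  then have "\<not> t \<le> s + u" using z u by (auto simp: circle_arc_def)
  then show "z \<in> circle_arc x {s<..<t}" using zu u by (auto simp: circle_arc_def)
qed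

lemma openin_circle_arc:
  assumes "x \<in> circle" "s < t" "t \<le> s + 2 * pi"
  shows "openin (top_of_set circle) (circle_arc x {s<..<t})"
  unfolding circle_arc_complement[OF assms]
  by (intro openin_diff openin_subtopology_self closed_subset circle_arc_subset assms
        compact_imp_closed compact_circle_arc)

locale circle_points =
  fixes P :: "complex set"
  assumes finite_P: "finite P" and P_circle: "P \<subseteq> circle" and P_ne: "P \<noteq> {}"
begin

definition gap :: "complex \<Rightarrow> real"
  where "gap x = Min {t \<in> {0<..2 * pi}. x * cis t \<in> P}"

text \<open>
  The next point of \<open>P\<close> in the direction of rotation. If \<open>P\<close> is a single point, it is this point itself, and
  the gap is the full turn.
\<close>

definition nxt :: "complex \<Rightarrow> complex"
  where "nxt x = x * cis (gap x)"

lemma finite_gaps: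
  assumes "x \<in> circle"
  shows "finite {t \<in> {0<..2 * pi}. x * cis t \<in> P}"
proof (rule inj_on_finite[OF _ _ finite_P])
  show "inj_on (\<lambda>t. x * cis t) {t \<in> {0<..2 * pi}. x * cis t \<in> P}"
    by (rule inj_onI) (use rot_eq_imp assms in auto)
qed auto

lemma gaps_ne:
  assumes "x \<in> circle"
  shows "{t \<in> {0<..2 * pi}. x * cis t \<in> P} \<noteq> {}"
proof -
  obtain p where p: "p \<in> P" using P_ne by blast
  then have "p \<in> circle" using P_circle by blast
  then obtain t where "0 < t" "t \<le> 2 * pi" "p = x * cis t" by (rule on_circle_rot[OF assms])
  then have "t \<in> {t \<in> {0<..2 * pi}. x * cis t \<in> P}" using p by simp
  then show ?thesis by blast
qed

lemma gap:
  assumes "x \<in> circle"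
  shows "0 < gap x" "gap x \<le> 2 * pi" "nxt x \<in> P" "0 < t \<Longrightarrow> t < gap x \<Longrightarrow> x * cis t \<notin> P"
proof -
  have "gap x \<in> {t \<in> {0<..2 * pi}. x * cis t \<in> P}"
    unfolding gap_def using finite_gaps[OF assms] gaps_ne[OF assms] by (rule Min_in)
  then show g: "0 < gap x" "gap x \<le> 2 * pi" "nxt x \<in> P" by (auto simp: nxt_def)
  assume t: "0 < t" "t < gap x"
  show "x * cis t \<notin> P"
  proof
    assume "x * cis t \<in> P"
    then have "gap x \<le> t"
      unfolding gap_def using t g finite_gaps[OF assms] by (intro Min_le) auto
    then show False using t by simp
  qed
qed

lemma P_in: "x \<in> P \<Longrightarrow> x \<in> circle"
  using P_circle by blast

lemma position_unique:
  assumes x: "x \<in> P" and y: "y \<in> P" and eq: "x * cis s = y * cis t"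
    and s: "0 \<le> s" "s < gap x" and t: "0 \<le> t" "t < gap y"
  shows "x = y \<and> s = t"
proof -
  have le: "x = y \<and> s = t" if "x \<in> P" "y \<in> P" "x * cis s = y * cis t" "0 \<le> s" "s \<le> t" "t < gap y"
    for x y s t
  proof -
    have "x = y * cis (t - s)" using that by (intro rot_eq_shift)
    then have "t - s = 0" using gap(4)[OF P_in[OF that(2)], of "t - s"] that by force
    then show ?thesis using \<open>x = y * cis (t - s)\<close> by simp
  qed
  show ?thesis
  proof (cases "s \<le> t")
    case True
    then show ?thesis using le[OF x y eq] s t by simp
  next
    case False
    then show ?thesis using le[OF y x eq[symmetric]] s t by simp
  qed
qed

lemma position_exists:
  assumes z: "z \<in> circle"
  obtains x s where "x \<in> P" "0 \<le> s" "s < gap x" "z = x * cis s"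
proof -
  let ?U = "{u \<in> {0..<2 * pi}. z * cis (- u) \<in> P}"
  have "finite ?U"
  proof (rule inj_on_finite[OF _ _ finite_P])
    show "inj_on (\<lambda>u. z * cis (- u)) ?U"
    proof (rule inj_onI)
      fix u v assume "u \<in> ?U" "v \<in> ?U" "z * cis (- u) = z * cis (- v)"
      then have "- u = - v" using z by (intro rot_eq_imp[of z]) auto
      then show "u = v" by simp
    qed
  qed auto
  moreover have "?U \<noteq> {}"
  proof -
    obtain p where p: "p \<in> P" using P_ne by blast
    then have "p \<in> circle" using P_circle by blast
    then obtain t where t: "0 < t" "t \<le> 2 * pi" "p = z * cis t" by (rule on_circle_rot[OF z])
    have "z * cis (- (2 * pi - t)) = z * cis t * cis (- (2 * pi))" by (simp add: rot_rot)
    also have "\<dots> = p" using t by (simp add: complex_eq_iff)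
    finally show ?thesis using t p by (intro ex_in_conv[THEN iffD1] exI[of _ "2 * pi - t"]) auto
  qed
  ultimately have u: "Min ?U \<in> ?U" by (rule Min_in)
  define u where "u = Min ?U"
  have u: "0 \<le> u" "u < 2 * pi" "z * cis (- u) \<in> P" using \<open>Min ?U \<in> ?U\<close> by (auto simp: u_def)
  have zu: "z = z * cis (- u) * cis u" by (simp add: rot_rot)
  have "u < gap (z * cis (- u))"
  proof (rule ccontr)
    let ?g = "gap (z * cis (- u))"
    assume "\<not> u < ?g"
    note g = gap[OF P_in[OF u(3)]]
    have "z * cis (- (u - ?g)) \<in> P" using g(3) by (simp add: nxt_def rot_rot)
    then have "u - ?g \<in> ?U" using \<open>\<not> u < ?g\<close> u g by auto
    then have "u \<le> u - ?g" unfolding u_def using \<open>finite ?U\<close> by (intro Min_le)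
    then show False using g by simp
  qed
  then show ?thesis using that[OF u(3) u(1) _ zu] by blast
qed

lemma nxt_bij: "bij_betw nxt P P"
proof -
  have inj: "inj_on nxt P"
  proof (rule inj_onI)
    have le: "x = y" if x: "x \<in> P" and y: "y \<in> P" and eq: "nxt x = nxt y" and "gap x \<le> gap y" for x y
    proof -
      have "x * cis 0 = y * cis (gap y - gap x)"
        using eq rot_eq_shift[of x "gap x" y "gap y"] by (simp add: nxt_def)
      moreover have "0 \<le> gap y - gap x" "gap y - gap x < gap y"
        using \<open>gap x \<le> gap y\<close> gap(1)[OF P_in[OF x]] by simp_all
      ultimately have "x = y \<and> 0 = gap y - gap x"
        by (intro position_unique[OF x y]) (simp_all only: gap(1)[OF P_in[OF x]] order_refl)
      then show ?thesis by (rule conjunct1)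
    qed
    fix x y assume "x \<in> P" "y \<in> P" "nxt x = nxt y"
    then show "x = y" using le[of x y] le[of y x] by (cases "gap x \<le> gap y") auto
  qed
  have "nxt ` P \<subseteq> P" using gap(3) P_in by blast
  then have "nxt ` P = P" using inj finite_P by (simp add: endo_inj_surj)
  then show ?thesis using inj by (simp add: bij_betw_def)
qed

lemma nxt_cycle:
  assumes A: "A \<subseteq> P" "A \<noteq> {}" and closed: "\<And>x. x \<in> A \<Longrightarrow> nxt x \<in> A"
  shows "A = P"
proof (rule ccontr)
  assume "A \<noteq> P"
  then obtain z where z: "z \<in> P" "z \<notin> A" using A by blast
  let ?T = "{t \<in> {0<..2 * pi}. z * cis (- t) \<in> A}"
  have "finite ?T"
  proof (rule inj_on_finite[OF _ _ finite_P])
    show "inj_on (\<lambda>u. z * cis (- u)) ?T"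
    proof (rule inj_onI)
      fix u v assume "u \<in> ?T" "v \<in> ?T" "z * cis (- u) = z * cis (- v)"
      then have "- u = - v" using P_in[OF z(1)] by (intro rot_eq_imp[of z]) auto
      then show "u = v" by simp
    qed
    show "(\<lambda>u. z * cis (- u)) ` ?T \<subseteq> P" using A by auto
  qed
  moreover have "?T \<noteq> {}"
  proof -
    obtain a where a: "a \<in> A" using A by blast
    then have "a \<in> circle" using P_in A by blast
    then obtain t where t: "0 < t" "t \<le> 2 * pi" "z = a * cis t"
      using P_in[OF z(1)] by (rule on_circle_rot)
    then have "z * cis (- t) = a" by (simp add: rot_rot)
    then show ?thesis using a t by force
  qed
  ultimately have "Min ?T \<in> ?T" by (rule Min_in)
  define t where "t = Min ?T"
  have t: "0 < t" "t \<le> 2 * pi" "z * cis (- t) \<in> A" using \<open>Min ?T \<in> ?T\<close> by (auto simp: t_def)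
  let ?a = "z * cis (- t)"
  have a: "?a \<in> P" using t A by blast
  have za: "z = ?a * cis t" by (simp add: rot_rot)
  note g = gap[OF P_in[OF a]]
  have "gap ?a \<le> t" using g(4)[of t] z za t by (cases "t < gap ?a") auto
  moreover have n: "nxt ?a = z * cis (- (t - gap ?a))" by (simp add: nxt_def rot_rot)
  moreover have "nxt ?a \<in> A" using closed t by blast
  ultimately show False
  proof (cases "gap ?a = t")
    case True
    then show False using n \<open>nxt ?a \<in> A\<close> z by simp
  next
    case False
    then have "t - gap ?a \<in> ?T" using \<open>gap ?a \<le> t\<close> n \<open>nxt ?a \<in> A\<close> t g by auto
    then have "t \<le> t - gap ?a" unfolding t_def using \<open>finite ?T\<close> by (intro Min_le)
    then show False using g by simp
  qed
qed

end

section \<open>Corners at a crossing\<close>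

definition sgb :: "bool \<Rightarrow> real"
  where "sgb b = (if b then 1 else - 1)"

lemma sgb_simps [simp]: "sgb True = 1" "sgb False = - 1" "sgb (\<not> b) = - sgb b"
  by (auto simp: sgb_def)

definition quadrant :: "bool \<Rightarrow> bool \<Rightarrow> complex set"
  where "quadrant a b = {w \<in> ball 0 1. 0 < sgb a * Re w \<and> 0 < sgb b * Im w}"

lemma open_quadrant: "open (quadrant a b)"
proof -
  have "quadrant a b = ball 0 1 \<inter> {w. 0 < sgb a * Re w} \<inter> {w. 0 < sgb b * Im w}"
    by (auto simp: quadrant_def)
  then show ?thesis
    by (auto intro!: open_Int open_Collect_less continuous_intros)
qed

lemma convex_quadrant: "convex (quadrant a b)"
proof -
  have "{w :: complex. 0 < sgb a * Re w} = {w. inner (of_real (sgb a)) w > 0}"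
    "{w :: complex. 0 < sgb b * Im w} = {w. inner (of_real (sgb b) * \<i>) w > 0}"
    by (auto simp: inner_complex_def)
  then have "convex {w :: complex. 0 < sgb a * Re w}" "convex {w :: complex. 0 < sgb b * Im w}"
    using convex_halfspace_gt by metis+
  moreover have "quadrant a b = ball 0 1 \<inter> {w. 0 < sgb a * Re w} \<inter> {w. 0 < sgb b * Im w}"
    by (auto simp: quadrant_def)
  ultimately show ?thesis by (simp add: convex_Int)
qed

lemma in_quadrant:
  assumes "w \<in> ball 0 1" "Re w \<noteq> 0" "Im w \<noteq> 0"
  shows "w \<in> quadrant (0 < Re w) (0 < Im w)"
  using assms by (auto simp: quadrant_def sgb_def)

lemma quadrant_unique: "w \<in> quadrant a b \<Longrightarrow> w \<in> quadrant a' b' \<Longrightarrow> a = a' \<and> b = b'"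
  by (cases a; cases b; cases a'; cases b') (auto simp: quadrant_def)

lemma closure_quadrant:
  assumes w: "w \<in> ball 0 1" "0 \<le> sgb a * Re w" "0 \<le> sgb b * Im w"
  shows "w \<in> closure (quadrant a b)"
proof -
  define f where "f n = w + of_real (1 / real (Suc n)) * Complex (sgb a) (sgb b)" for n
  have null: "(\<lambda>n. of_real (1 / real (Suc n)) :: complex) \<longlonglongrightarrow> of_real 0"
    by (intro tendsto_of_real LIMSEQ_Suc lim_1_over_n)
  have lim: "f \<longlonglongrightarrow> w"
    using tendsto_add[OF tendsto_const[of w] tendsto_mult[OF null tendsto_const[of "Complex (sgb a) (sgb b)"]]]
    unfolding f_def by (simp only: of_real_0 mult_zero_left add_0_right)
  have "\<forall>\<^sub>F n in sequentially. f n \<in> ball 0 1"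
    using lim w(1) by (intro topological_tendstoD) auto
  moreover have "0 < sgb a * Re (f n)" "0 < sgb b * Im (f n)" for n
  proof -
    define r where "r = 1 / real (Suc n)"
    have r: "0 < r" by (simp add: r_def)
    have fn: "f n = w + of_real r * Complex (sgb a) (sgb b)" by (simp only: f_def r_def)
    have "sgb a * Re (f n) = sgb a * Re w + r" "sgb b * Im (f n) = sgb b * Im w + r"
      unfolding fn by (cases a; simp) (cases b; simp)
    then show "0 < sgb a * Re (f n)" "0 < sgb b * Im (f n)" using w r by simp_all
  qed
  ultimately have "\<forall>\<^sub>F n in sequentially. f n \<in> closure (quadrant a b)"
    by (auto elim!: eventually_mono intro!: closure_subset[THEN subsetD] simp: quadrant_def)
  then show ?thesis using lim by (intro Lim_in_closed_set[of "closure (quadrant a b)" f sequentially w]) auto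
qed

text \<open>
  Cutting the circle open at \<open>y0\<close> turns \<open>X\<close> into an interval, on which an injective continuous function is
  strictly monotone. So \<open>f\<close> changes its sign at \<open>z\<close>, in a direction \<open>s\<close> that depends on the chart.
\<close>

lemma local_orientation:
  fixes f :: "complex \<Rightarrow> real"
  assumes X: "X \<subseteq> circle" "connected X" and z: "z \<in> X" and y0: "y0 \<in> circle - X"
    and f: "continuous_on X f" "inj_on f X" "f z = 0" and im: "x1 \<in> X" "f x1 < 0" "x2 \<in> X" "0 < f x2"
  obtains s d where "0 < d" "\<And>t. 0 < t \<Longrightarrow> t < d \<Longrightarrow>
    z * cis t \<in> X \<and> z * cis (- t) \<in> X \<and> 0 < sgb s * f (z * cis t) \<and> sgb s * f (z * cis (- t)) < 0"
proof -
  have y0c: "y0 \<in> circle" "y0 \<noteq> 0" using y0 by auto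
  define A where "A w = Arg2pi (w / y0)" for w
  have A: "w = y0 * cis (A w)" if "w \<in> X" for w
  proof -
    have "norm (w / y0) = 1" using that X y0c by (auto simp: norm_divide)
    then have "w / y0 = cis (A w)"
      using Arg2pi_eq[of "w / y0"] by (simp add: A_def cis_conv_exp)
    then show ?thesis using y0c by (simp add: field_simps)
  qed
  have cA: "continuous_on X A"
  proof -
    have "w / y0 \<notin> \<real>\<^sub>\<ge>\<^sub>0" if w: "w \<in> X" for w
    proof
      assume "w / y0 \<in> \<real>\<^sub>\<ge>\<^sub>0"
      then obtain r where r: "w / y0 = of_real r" "0 \<le> r" by (auto simp: nonneg_Reals_def)
      have "norm (w / y0) = 1" using w X y0c by (auto simp: norm_divide)
      then have "r = 1" using r by simp
      then have "w = y0" using r y0c by simp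
      then show False using w y0 by blast
    qed
    then show ?thesis unfolding A_def
      by (intro continuous_at_imp_continuous_on ballI isCont_o2[OF _ continuous_at_Arg2pi]) (auto intro!: continuous_intros y0c)
  qed
  define I where "I = A ` X"
  have I: "is_interval I" using X(2) cA unfolding I_def is_interval_connected_1 by (rule connected_continuous_image[rotated])
  have IX: "y0 * cis t \<in> X" "A (y0 * cis t) = t" if "t \<in> I" for t
    using that A by (auto simp: I_def)
  define \<phi> where "\<phi> t = f (y0 * cis t)" for t
  have c\<phi>: "continuous_on I \<phi>"
    unfolding \<phi>_def by (rule continuous_on_compose2[OF f(1)]) (use IX in \<open>auto intro!: continuous_intros\<close>)
  have "inj_on \<phi> I"
  proof (rule inj_onI)
    fix s t assume st: "s \<in> I" "t \<in> I" "\<phi> s = \<phi> t"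
    then have "y0 * cis s = y0 * cis t" using f(2) IX unfolding \<phi>_def by (meson inj_onD)
    then show "s = t" using IX(2) st by metis
  qed
  then have mono: "strict_mono_on I \<phi> \<or> strict_antimono_on I \<phi>"
    using injective_eq_monotone_map[OF I c\<phi>] by blast
  define t0 t1 t2 where "t0 = A z" and "t1 = A x1" and "t2 = A x2"
  have ts: "t0 \<in> I" "t1 \<in> I" "t2 \<in> I" using z im by (auto simp: I_def t0_def t1_def t2_def)
  have ph: "\<phi> t0 = 0" "\<phi> t1 < 0" "0 < \<phi> t2"
    using A[OF z] A[OF im(1)] A[OF im(3)] f(3) im by (auto simp: \<phi>_def t0_def t1_def t2_def)
  have zrot: "z * cis t = y0 * cis (t0 + t)" for t
    using A[OF z] by (metis rot_rot t0_def)
  have btw: "t \<in> I" if "a \<in> I" "b \<in> I" "a \<le> t" "t \<le> b" for a b t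
    using I that unfolding is_interval_1 by blast
  from mono show ?thesis
  proof
    assume m: "strict_mono_on I \<phi>"
    have lt: "t1 < t0" "t0 < t2"
      using strict_mono_onD[OF m] ts ph by (metis linorder_neqE_linordered_idom less_irrefl less_trans order_less_imp_not_less)+
    show ?thesis
    proof (rule that[of "min (t0 - t1) (t2 - t0)" True])
      show "0 < min (t0 - t1) (t2 - t0)" using lt by simp
      fix t assume t: "0 < t" "t < min (t0 - t1) (t2 - t0)"
      have ii: "t0 + t \<in> I" "t0 - t \<in> I" using t lt btw[OF ts(2,3)] by auto
      have "0 < \<phi> (t0 + t)" "\<phi> (t0 - t) < 0"
        using strict_mono_onD[OF m ts(1) ii(1)] strict_mono_onD[OF m ii(2) ts(1)] t ph by auto
      then show "z * cis t \<in> X \<and> z * cis (- t) \<in> X \<and> 0 < sgb True * f (z * cis t) \<and> sgb True * f (z * cis (- t)) < 0"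
        using IX(1) ii unfolding zrot \<phi>_def by simp
    qed
  next
    assume m: "strict_antimono_on I \<phi>"
    have md: "\<phi> b < \<phi> a" if "a \<in> I" "b \<in> I" "a < b" for a b
      using m that by (simp add: monotone_on_def)
    have lt: "t2 < t0" "t0 < t1"
      using md ts ph by (metis linorder_neqE_linordered_idom less_irrefl less_trans order_less_imp_not_less)+
    show ?thesis
    proof (rule that[of "min (t0 - t2) (t1 - t0)" False])
      show "0 < min (t0 - t2) (t1 - t0)" using lt by simp
      fix t assume t: "0 < t" "t < min (t0 - t2) (t1 - t0)"
      have ii: "t0 + t \<in> I" "t0 - t \<in> I" using t lt btw[OF ts(3,2)] by auto
      have "\<phi> (t0 + t) < 0" "0 < \<phi> (t0 - t)"
        using md[OF ts(1) ii(1)] md[OF ii(2) ts(1)] t ph by auto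
      then show "z * cis t \<in> X \<and> z * cis (- t) \<in> X \<and> 0 < sgb False * f (z * cis t) \<and> sgb False * f (z * cis (- t)) < 0"
        using IX(1) ii unfolding zrot \<phi>_def by simp
    qed
  qed
qed

locale crossing_chart =
  fixes K :: "complex \<Rightarrow> complex \<times> real" and p :: complex and N :: "complex set"
    and h h' :: "complex \<Rightarrow> complex" and X Y :: "complex set"
  assumes regular: "regular_knot K"
    and nbhd: "crossing_nbhd K p N"
    and hom: "homeomorphism N (ball 0 1) h h'" and h_p: "h p = 0"
    and con: "connected X" "connected Y" and XY: "X \<inter> Y = {}" "X \<union> Y = {z \<in> circle. knot_proj K z \<in> N}"
    and inj: "inj_on (knot_proj K) X" "inj_on (knot_proj K) Y"
    and im_X: "h ` knot_proj K ` X = {w \<in> ball 0 1. Im w = 0}"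
    and im_Y: "h ` knot_proj K ` Y = {w \<in> ball 0 1. Re w = 0}"
begin

lemma open_N: "open N" and p_N: "p \<in> N"
  using nbhd by (auto simp: crossing_nbhd_def)

text \<open>
  Reflecting the chart exchanges the two strands, so that only one of them need be considered.
\<close>

lemma swap: "crossing_chart K p N ((\<lambda>w. Complex (Im w) (Re w)) \<circ> h) (h' \<circ> (\<lambda>w. Complex (Im w) (Re w))) Y X"
proof -
  let ?s = "\<lambda>w. Complex (Im w) (Re w)"
  have norm: "norm (?s w) = norm w" for w by (simp add: cmod_def add.commute)
  have inv: "?s ` A = {w. ?s w \<in> A}" for A
  proof (rule Set.set_eqI)
    fix w
    have "w \<in> ?s ` A" if "?s w \<in> A" using that by (rule image_eqI[rotated]) simp
    then show "w \<in> ?s ` A \<longleftrightarrow> w \<in> {w. ?s w \<in> A}" by auto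
  qed
  have img: "?s ` {w \<in> ball 0 1. Im w = 0} = {w \<in> ball 0 1. Re w = 0}"
    "?s ` {w \<in> ball 0 1. Re w = 0} = {w \<in> ball 0 1. Im w = 0}"
    unfolding inv by (simp_all only: mem_Collect_eq mem_ball_0 norm complex.sel)
  have cont: "continuous_on A ?s" for A
    unfolding Complex_eq by (intro continuous_intros)
  have "homeomorphism (ball 0 1) (ball 0 1) ?s ?s"
    unfolding homeomorphism_def inv using cont by (simp add: norm ball_def)
  then have homs: "homeomorphism N (ball 0 1) (?s \<circ> h) (h' \<circ> ?s)"
    by (rule homeomorphism_compose[OF hom])
  have sp: "(?s \<circ> h) p = 0" by (simp add: h_p complex_eq_iff)
  have YX: "Y \<inter> X = {}" "Y \<union> X = {z \<in> circle. knot_proj K z \<in> N}"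
    using XY by (simp_all only: Int_commute Un_commute)
  have ims: "(?s \<circ> h) ` knot_proj K ` Y = {w \<in> ball 0 1. Im w = 0}"
    "(?s \<circ> h) ` knot_proj K ` X = {w \<in> ball 0 1. Re w = 0}"
    by (simp_all only: image_comp[of ?s h, symmetric] im_X im_Y img)
  show ?thesis
    by unfold_locales (fact regular nbhd homs sp con YX inj ims)+
qed

lemma X_in: "z \<in> X \<Longrightarrow> z \<in> circle \<and> knot_proj K z \<in> N"
  and Y_in: "z \<in> Y \<Longrightarrow> z \<in> circle \<and> knot_proj K z \<in> N"
  using XY(2) by blast+

lemma h_in: "q \<in> N \<Longrightarrow> h q \<in> ball 0 1" and h'_in: "w \<in> ball 0 1 \<Longrightarrow> h' w \<in> N"
  and h'_h: "q \<in> N \<Longrightarrow> h' (h q) = q" and h_h': "w \<in> ball 0 1 \<Longrightarrow> h (h' w) = w"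
  and cont_h: "continuous_on N h" and cont_h': "continuous_on (ball 0 1) h'"
  using hom by (auto simp: homeomorphism_def)

lemma shadow_in_chart:
  assumes "q \<in> N"
  shows "q \<in> shadow K \<longleftrightarrow> Re (h q) = 0 \<or> Im (h q) = 0"
proof
  assume "q \<in> shadow K"
  then obtain z where z: "z \<in> circle" "q = knot_proj K z" by (auto simp: shadow_def)
  then have "z \<in> X \<or> z \<in> Y" using XY(2) assms by blast
  then have "h q \<in> h ` knot_proj K ` X \<or> h q \<in> h ` knot_proj K ` Y" using z by blast
  then show "Re (h q) = 0 \<or> Im (h q) = 0" unfolding im_X im_Y by blast
next
  assume "Re (h q) = 0 \<or> Im (h q) = 0"
  then have "h q \<in> h ` knot_proj K ` X \<or> h q \<in> h ` knot_proj K ` Y"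
    unfolding im_X im_Y using h_in[OF assms] by blast
  then obtain z where z: "z \<in> X \<union> Y" "h q = h (knot_proj K z)" by blast
  then have "knot_proj K z \<in> N" "z \<in> circle" using X_in Y_in by blast+
  then have "q = knot_proj K z" using z assms h'_h by metis
  then show "q \<in> shadow K" using \<open>z \<in> circle\<close> by (simp add: shadow_def)
qed

lemma preimages:
  obtains x y where "x \<in> X" "y \<in> Y" "knot_proj K x = p" "knot_proj K y = p"
    "{z \<in> circle. knot_proj K z = p} = {x, y}"
proof -
  have "0 \<in> h ` knot_proj K ` X" "0 \<in> h ` knot_proj K ` Y" unfolding im_X im_Y by auto
  then obtain x y where x: "x \<in> X" "h (knot_proj K x) = 0" and y: "y \<in> Y" "h (knot_proj K y) = 0"
    by (metis imageE)
  have xy: "knot_proj K x = p" "knot_proj K y = p"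
    using x y X_in Y_in p_N h_p h'_h by metis+
  have "{z \<in> circle. knot_proj K z = p} = {x, y}"
  proof (rule Set.set_eqI)
    fix z
    show "z \<in> {z \<in> circle. knot_proj K z = p} \<longleftrightarrow> z \<in> {x, y}"
    proof
      assume "z \<in> {z \<in> circle. knot_proj K z = p}"
      then have z: "z \<in> circle" "knot_proj K z = p" by auto
      then have "z \<in> X \<or> z \<in> Y" using XY(2) p_N by blast
      then show "z \<in> {x, y}"
      proof
        assume "z \<in> X"
        then have "z = x" using inj_onD[OF inj(1), of z x] x(1) xy z by simp
        then show ?thesis by simp
      next
        assume "z \<in> Y"
        then have "z = y" using inj_onD[OF inj(2), of z y] y(1) xy z by simp
        then show ?thesis by simp
      qed
    next
      assume "z \<in> {x, y}"
      then show "z \<in> {z \<in> circle. knot_proj K z = p}" using x y xy X_in Y_in by blast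
    qed
  qed
  then show ?thesis using that x y xy by blast
qed

lemma strand_X:
  assumes x: "x \<in> X" "knot_proj K x = p"
  obtains s d where "0 < d" "\<And>t. 0 < t \<Longrightarrow> t < d \<Longrightarrow>
    knot_proj K (x * cis t) \<in> N \<and> knot_proj K (x * cis (- t)) \<in> N \<and>
    Im (h (knot_proj K (x * cis t))) = 0 \<and> Im (h (knot_proj K (x * cis (- t)))) = 0 \<and>
    0 < sgb s * Re (h (knot_proj K (x * cis t))) \<and> sgb s * Re (h (knot_proj K (x * cis (- t)))) < 0"
proof -
  let ?f = "\<lambda>z. Re (h (knot_proj K z))"
  have im0: "Im (h (knot_proj K z)) = 0" if "z \<in> X" for z
  proof -
    have "h (knot_proj K z) \<in> h ` knot_proj K ` X" using that by blast
    then show ?thesis unfolding im_X by blast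
  qed
  have Xc: "X \<subseteq> circle" using X_in by blast
  have "0 \<in> h ` knot_proj K ` Y" unfolding im_Y by auto
  then obtain y0 where "y0 \<in> Y" by blast
  then have y0: "y0 \<in> circle - X" using Y_in XY(1) by blast
  have "continuous_on circle (knot_proj K)"
    using regular unfolding regular_knot_def knot_proj_def by (intro continuous_intros) auto
  then have cf: "continuous_on X ?f"
    using Xc X_in by (intro continuous_intros continuous_on_compose2[OF cont_h]) (auto intro: continuous_on_subset)
  have injf: "inj_on ?f X"
  proof (rule inj_onI)
    fix z w assume zw: "z \<in> X" "w \<in> X" "?f z = ?f w"
    then have "h (knot_proj K z) = h (knot_proj K w)" using im0 by (simp add: complex_eq_iff)
    then have "knot_proj K z = knot_proj K w" using zw X_in h'_h by metis
    then show "z = w" using inj(1) zw by (auto dest: inj_onD)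
  qed
  have half: "of_real (- 1 / 2) \<in> h ` knot_proj K ` X" "of_real (1 / 2) \<in> h ` knot_proj K ` X"
    unfolding im_X by auto
  obtain x1 where x1: "x1 \<in> X" "of_real (- 1 / 2) = h (knot_proj K x1)" using half(1) by blast
  obtain x2 where x2: "x2 \<in> X" "of_real (1 / 2) = h (knot_proj K x2)" using half(2) by blast
  have f12: "?f x1 < 0" "0 < ?f x2" unfolding x1(2)[symmetric] x2(2)[symmetric] by simp_all
  have fx: "?f x = 0" using x h_p by simp
  obtain s d where d: "0 < d" and sd: "\<And>t. 0 < t \<Longrightarrow> t < d \<Longrightarrow>
      x * cis t \<in> X \<and> x * cis (- t) \<in> X \<and> 0 < sgb s * ?f (x * cis t) \<and> sgb s * ?f (x * cis (- t)) < 0"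
    by (rule local_orientation[OF Xc con(1) x(1) y0 cf injf fx x1(1) f12(1) x2(1) f12(2)]) (rule that)
  show ?thesis
    by (rule that[OF d]) (use sd X_in im0 in blast)
qed

definition corner_set :: "bool \<Rightarrow> bool \<Rightarrow> complex set"
  where "corner_set a b = h' ` quadrant a b"

lemma quadrant_ball: "quadrant a b \<subseteq> ball 0 1"
  by (auto simp: quadrant_def)

lemma corner_set_eq: "corner_set a b = {q \<in> N. h q \<in> quadrant a b}"
proof (intro subset_antisym subsetI)
  fix q assume "q \<in> corner_set a b"
  then obtain w where w: "w \<in> quadrant a b" "q = h' w" by (auto simp: corner_set_def)
  then have "w \<in> ball 0 1" using quadrant_ball by blast
  then show "q \<in> {q \<in> N. h q \<in> quadrant a b}" using w h'_in h_h' by simp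
next
  fix q assume "q \<in> {q \<in> N. h q \<in> quadrant a b}"
  then have "q = h' (h q)" "h q \<in> quadrant a b" using h'_h by simp_all
  then show "q \<in> corner_set a b" unfolding corner_set_def by (rule image_eqI)
qed

lemma corner_set_disjoint_shadow: "corner_set a b \<subseteq> N - shadow K"
proof
  fix q assume "q \<in> corner_set a b"
  then have q: "q \<in> N" "h q \<in> quadrant a b" by (auto simp: corner_set_eq)
  then have "Re (h q) \<noteq> 0 \<and> Im (h q) \<noteq> 0" by (auto simp: quadrant_def)
  then show "q \<in> N - shadow K" using q shadow_in_chart by blast
qed

lemma corner_set_cover: "q \<in> N - shadow K \<Longrightarrow> \<exists>a b. q \<in> corner_set a b"
  using shadow_in_chart[of q] in_quadrant[OF h_in[of q]] by (auto simp: corner_set_eq)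

lemma corner_set_ne: "corner_set a b \<noteq> {}"
proof -
  have "Complex (sgb a / 2) (sgb b / 2) \<in> quadrant a b"
    by (cases a; cases b) (auto simp: quadrant_def cmod_def power2_eq_square)
  then show ?thesis by (auto simp: corner_set_def)
qed

lemma corner_set_inj: "q \<in> corner_set a b \<Longrightarrow> q \<in> corner_set a' b' \<Longrightarrow> a = a' \<and> b = b'"
  by (rule quadrant_unique[of "h q"]) (simp_all add: corner_set_eq)

lemma connected_corner_set: "connected (corner_set a b)"
  unfolding corner_set_def
  by (intro connected_continuous_image convex_connected convex_quadrant continuous_on_subset[OF cont_h' quadrant_ball])

lemma corner_components: "components (N - shadow K) = (\<lambda>(a, b). corner_set a b) ` UNIV"
proof (rule components_of_partition)
  show "N - shadow K = (\<Union>i\<in>UNIV. case i of (a, b) \<Rightarrow> corner_set a b)"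
  proof (rule subset_antisym)
    show "N - shadow K \<subseteq> (\<Union>i\<in>UNIV. case i of (a, b) \<Rightarrow> corner_set a b)"
    proof
      fix q assume "q \<in> N - shadow K"
      then obtain a b where "q \<in> corner_set a b" using corner_set_cover[of q] by auto
      then show "q \<in> (\<Union>i\<in>UNIV. case i of (a, b) \<Rightarrow> corner_set a b)" by (intro UN_I[of "(a, b)"]) simp_all
    qed
    show "(\<Union>i\<in>UNIV. case i of (a, b) \<Rightarrow> corner_set a b) \<subseteq> N - shadow K"
      using corner_set_disjoint_shadow by (intro UN_least) (simp add: case_prod_beta)
  qed
  fix i :: "bool \<times> bool"
  obtain a b where i: "i = (a, b)" by (cases i)
  have "open (N \<inter> h -` quadrant a b)"
    by (rule continuous_open_preimage[OF cont_h open_N open_quadrant])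
  moreover have "N \<inter> h -` quadrant a b = corner_set a b" by (auto simp: corner_set_eq)
  ultimately have "open (corner_set a b)" by simp
  then show "openin (top_of_set (N - shadow K)) (case i of (a, b) \<Rightarrow> corner_set a b)"
    using corner_set_disjoint_shadow i by (simp add: open_subset)
  show "connected (case i of (a, b) \<Rightarrow> corner_set a b)" using i connected_corner_set by simp
  show "(case i of (a, b) \<Rightarrow> corner_set a b) \<noteq> {}" using i corner_set_ne by simp
  fix j assume "i \<noteq> j"
  then show "(case i of (a, b) \<Rightarrow> corner_set a b) \<inter> (case j of (a, b) \<Rightarrow> corner_set a b) = {}"
  proof (cases i; cases j)
    fix a b a' b' assume ij: "i = (a, b)" "j = (a', b')"
    then have "\<not> (a = a' \<and> b = b')" using \<open>i \<noteq> j\<close> by blast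
    then have "corner_set a b \<inter> corner_set a' b' = {}" using corner_set_inj[of _ a b a' b'] by blast
    then show ?thesis using ij by simp
  qed
qed

definition corner_face :: "bool \<Rightarrow> bool \<Rightarrow> complex set"
  where "corner_face a b = (THE F. F \<in> faces K \<and> corner_set a b \<subseteq> F)"

lemma corner_face_iff: "F \<in> faces K \<and> corner_set a b \<subseteq> F \<longleftrightarrow> F = corner_face a b"
proof -
  have sub: "corner_set a b \<subseteq> - shadow K" using corner_set_disjoint_shadow by blast
  obtain q where q: "q \<in> corner_set a b" using corner_set_ne by blast
  let ?F = "connected_component_set (- shadow K) q"
  have F: "?F \<in> faces K \<and> corner_set a b \<subseteq> ?F"
  proof
    show "?F \<in> faces K" unfolding faces_def using q sub by (intro componentsI) blast
    show "corner_set a b \<subseteq> ?F" by (rule connected_component_maximal[OF q connected_corner_set sub])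
  qed
  have uniq: "G = ?F" if "G \<in> faces K \<and> corner_set a b \<subseteq> G" for G
    using that F q components_nonoverlap[of G "- shadow K" ?F] unfolding faces_def by blast
  have "corner_face a b = ?F"
    unfolding corner_face_def using F uniq by (rule the_equality)
  then show ?thesis using F uniq by metis
qed

lemma corner_face: "corner_face a b \<in> faces K" "corner_set a b \<subseteq> corner_face a b"
  using corner_face_iff by blast+

lemma corner_set_meets_face:
  assumes "F \<in> faces K" "q \<in> corner_set a b" "q \<in> F"
  shows "F = corner_face a b"
  using assms corner_face[of a b] components_nonoverlap[of F "- shadow K" "corner_face a b"]
  unfolding faces_def by blast

lemma corner_face_inj:
  assumes red: "reduced_diagram K" and p: "p \<in> crossings K" and eq: "corner_face a b = corner_face a' b'"
  shows "a = a' \<and> b = b'"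
proof -
  have "corner_set a b \<in> components (N - shadow K)" "corner_set a' b' \<in> components (N - shadow K)"
    unfolding corner_components by auto
  then have "corner_set a b = corner_set a' b'"
    using red p nbhd corner_face[of a b] corner_face[of a' b'] eq unfolding reduced_diagram_def by metis
  then show ?thesis using corner_set_ne corner_set_inj by blast
qed

text \<open>
  In the chart the faces near a crossing are the four quadrants, so closures can be read off from the signs
  of the coordinates.
\<close>

lemma closure_face_iff:
  assumes F: "F \<in> faces K" and q: "q \<in> N"
  shows "q \<in> closure F \<longleftrightarrow> (\<exists>a b. F = corner_face a b \<and> 0 \<le> sgb a * Re (h q) \<and> 0 \<le> sgb b * Im (h q))"
proof
  assume "\<exists>a b. F = corner_face a b \<and> 0 \<le> sgb a * Re (h q) \<and> 0 \<le> sgb b * Im (h q)"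
  then obtain a b where ab: "F = corner_face a b" "0 \<le> sgb a * Re (h q)" "0 \<le> sgb b * Im (h q)" by blast
  then have "h q \<in> closure (quadrant a b)" using h_in[OF q] by (intro closure_quadrant)
  then obtain w where w: "\<And>n. w n \<in> quadrant a b" "w \<longlonglongrightarrow> h q"
    unfolding closure_sequential by blast
  have "(\<lambda>n. h' (w n)) \<longlonglongrightarrow> h' (h q)"
    by (rule continuous_on_tendsto_compose[OF cont_h' w(2) h_in[OF q]])
      (intro always_eventually allI subsetD[OF quadrant_ball[of a b]] w(1))
  moreover have "h' (w n) \<in> F" for n
    using w(1) corner_face(2)[of a b] ab(1) by (auto simp: corner_set_def)
  ultimately show "q \<in> closure F"
    unfolding closure_sequential h'_h[OF q] by (intro exI[of _ "\<lambda>n. h' (w n)"]) simp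
next
  assume clos: "q \<in> closure F"
  show "\<exists>a b. F = corner_face a b \<and> 0 \<le> sgb a * Re (h q) \<and> 0 \<le> sgb b * Im (h q)"
  proof (rule ccontr)
    assume no: "\<not> ?thesis"
    define D where "D = (\<Union>i\<in>{(a, b). F = corner_face a b}. {w. 0 \<le> sgb (fst i) * Re w} \<inter> {w. 0 \<le> sgb (snd i) * Im w})"
    have "closed {w. 0 \<le> sgb a * Re w}" "closed {w. 0 \<le> sgb b * Im w}" for a b
      by (intro closed_Collect_le continuous_intros)+
    then have "closed D" unfolding D_def by (intro closed_UN ballI closed_Int) auto
    then have "open (N \<inter> h -` (- D))"
      by (intro continuous_open_preimage[OF cont_h open_N]) auto
    moreover have "q \<in> N \<inter> h -` (- D)" using q no by (auto simp: D_def)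
    ultimately obtain r where r: "r \<in> F" "r \<in> N" "h r \<notin> D"
      using clos unfolding closure_iff_nhds_not_empty by blast
    have "r \<notin> shadow K" using r(1) F in_components_subset unfolding faces_def by blast
    then obtain a b where ab: "r \<in> corner_set a b" using corner_set_cover r by blast
    then have "F = corner_face a b" using corner_set_meets_face F r by blast
    moreover have "h r \<in> quadrant a b" using ab by (simp add: corner_set_eq)
    ultimately have "h r \<in> D" by (force simp: D_def quadrant_def)
    then show False using r by blast
  qed
qed

end

lemma obtain_chart:
  assumes "regular_knot K" "p \<in> crossings K"
  obtains N h h' X Y where "crossing_chart K p N h h' X Y"
proof -
  obtain N where N: "crossing_nbhd K p N" using assms by (auto simp: regular_knot_def)
  then obtain h h' X Y where "homeomorphism N (ball (0::complex) 1) h h'" "h p = 0"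
       "connected X" "connected Y" "X \<inter> Y = {}" "X \<union> Y = {z \<in> circle. knot_proj K z \<in> N}"
       "inj_on (knot_proj K) X" "inj_on (knot_proj K) Y"
       "h ` knot_proj K ` X = {w \<in> ball 0 1. Im w = 0}"
       "h ` knot_proj K ` Y = {w \<in> ball 0 1. Re w = 0}"
    unfolding crossing_nbhd_def by (elim conjE exE) (rule that)
  then have "crossing_chart K p N h h' X Y" using assms(1) N by unfold_locales
  then show ?thesis by (rule that)
qed

context crossing_chart
begin

lemma strand_Y:
  assumes y: "y \<in> Y" "knot_proj K y = p"
  obtains s d where "0 < d" "\<And>t. 0 < t \<Longrightarrow> t < d \<Longrightarrow>
    knot_proj K (y * cis t) \<in> N \<and> knot_proj K (y * cis (- t)) \<in> N \<and>
    Re (h (knot_proj K (y * cis t))) = 0 \<and> Re (h (knot_proj K (y * cis (- t)))) = 0 \<and>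
    0 < sgb s * Im (h (knot_proj K (y * cis t))) \<and> sgb s * Im (h (knot_proj K (y * cis (- t)))) < 0"
proof -
  interpret S: crossing_chart K p N "(\<lambda>w. Complex (Im w) (Re w)) \<circ> h" "h' \<circ> (\<lambda>w. Complex (Im w) (Re w))" Y X
    by (rule swap)
  obtain s d where d: "0 < d" and sd: "\<And>t. 0 < t \<Longrightarrow> t < d \<Longrightarrow>
    knot_proj K (y * cis t) \<in> N \<and> knot_proj K (y * cis (- t)) \<in> N \<and>
    Im (((\<lambda>w. Complex (Im w) (Re w)) \<circ> h) (knot_proj K (y * cis t))) = 0 \<and>
    Im (((\<lambda>w. Complex (Im w) (Re w)) \<circ> h) (knot_proj K (y * cis (- t)))) = 0 \<and>
    0 < sgb s * Re (((\<lambda>w. Complex (Im w) (Re w)) \<circ> h) (knot_proj K (y * cis t))) \<and>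
    sgb s * Re (((\<lambda>w. Complex (Im w) (Re w)) \<circ> h) (knot_proj K (y * cis (- t)))) < 0"
    by (rule S.strand_X[OF y]) (rule that)
  show ?thesis
  proof (rule that[OF d])
    fix t assume "0 < t" "t < d"
    from sd[OF this] show "knot_proj K (y * cis t) \<in> N \<and> knot_proj K (y * cis (- t)) \<in> N \<and>
      Re (h (knot_proj K (y * cis t))) = 0 \<and> Re (h (knot_proj K (y * cis (- t)))) = 0 \<and>
      0 < sgb s * Im (h (knot_proj K (y * cis t))) \<and> sgb s * Im (h (knot_proj K (y * cis (- t)))) < 0"
      by simp
  qed
qed

lemma closure_face_axis_X:
  assumes F: "F \<in> faces K" and q: "q \<in> N" "Im (h q) = 0" "0 < sgb s * Re (h q)"
  shows "q \<in> closure F \<longleftrightarrow> F \<in> {corner_face s False, corner_face s True}"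
proof -
  have "0 \<le> sgb a * Re (h q) \<longleftrightarrow> a = s" for a
    using q(3) by (cases a; cases s) auto
  then have "q \<in> closure F \<longleftrightarrow> (\<exists>b. F = corner_face s b)"
    unfolding closure_face_iff[OF F q(1)] using q(2) by simp
  then show ?thesis unfolding ex_bool_eq by blast
qed

lemma closure_face_axis_Y:
  assumes F: "F \<in> faces K" and q: "q \<in> N" "Re (h q) = 0" "0 < sgb s * Im (h q)"
  shows "q \<in> closure F \<longleftrightarrow> F \<in> {corner_face False s, corner_face True s}"
proof -
  have "0 \<le> sgb b * Im (h q) \<longleftrightarrow> b = s" for b
    using q(3) by (cases b; cases s) auto
  then have "q \<in> closure F \<longleftrightarrow> (\<exists>a. F = corner_face a s)"
    unfolding closure_face_iff[OF F q(1)] using q(2) by simp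
  then show ?thesis unfolding ex_bool_eq by blast
qed

text \<open>
  Passing through the crossing along a strand, the knot moves from one side of the other strand to the
  opposite one; \<open>s\<close> and \<open>r\<close> record which quadrants are ahead.
\<close>

lemma chart_faces:
  assumes x: "x \<in> X" "knot_proj K x = p" and y: "y \<in> Y" "knot_proj K y = p"
  obtains s r d where "0 < d" "\<And>t F. 0 < t \<Longrightarrow> t < d \<Longrightarrow> F \<in> faces K \<Longrightarrow>
    (knot_proj K (x * cis t) \<in> closure F \<longleftrightarrow> F \<in> {corner_face s False, corner_face s True}) \<and>
    (knot_proj K (x * cis (- t)) \<in> closure F \<longleftrightarrow> F \<in> {corner_face (\<not> s) False, corner_face (\<not> s) True}) \<and>
    (knot_proj K (y * cis t) \<in> closure F \<longleftrightarrow> F \<in> {corner_face False r, corner_face True r}) \<and>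
    (knot_proj K (y * cis (- t)) \<in> closure F \<longleftrightarrow> F \<in> {corner_face False (\<not> r), corner_face True (\<not> r)})"
proof -
  obtain s d1 where d1: "0 < d1" and sd: "\<And>t. 0 < t \<Longrightarrow> t < d1 \<Longrightarrow>
    knot_proj K (x * cis t) \<in> N \<and> knot_proj K (x * cis (- t)) \<in> N \<and>
    Im (h (knot_proj K (x * cis t))) = 0 \<and> Im (h (knot_proj K (x * cis (- t)))) = 0 \<and>
    0 < sgb s * Re (h (knot_proj K (x * cis t))) \<and> sgb s * Re (h (knot_proj K (x * cis (- t)))) < 0"
    by (rule strand_X[OF x]) (rule that)
  obtain r d2 where d2: "0 < d2" and rd: "\<And>t. 0 < t \<Longrightarrow> t < d2 \<Longrightarrow>
    knot_proj K (y * cis t) \<in> N \<and> knot_proj K (y * cis (- t)) \<in> N \<and>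
    Re (h (knot_proj K (y * cis t))) = 0 \<and> Re (h (knot_proj K (y * cis (- t)))) = 0 \<and>
    0 < sgb r * Im (h (knot_proj K (y * cis t))) \<and> sgb r * Im (h (knot_proj K (y * cis (- t)))) < 0"
    by (rule strand_Y[OF y]) (rule that)
  show ?thesis
  proof (rule that[of "min d1 d2" s r])
    show "0 < min d1 d2" using d1 d2 by simp
    fix t F assume t: "0 < t" "t < min d1 d2" and F: "F \<in> faces K"
    have t1: "t < d1" and t2: "t < d2" using t by simp_all
    note S = sd[OF t(1) t1] and R = rd[OF t(1) t2]
    show "(knot_proj K (x * cis t) \<in> closure F \<longleftrightarrow> F \<in> {corner_face s False, corner_face s True}) \<and>
      (knot_proj K (x * cis (- t)) \<in> closure F \<longleftrightarrow> F \<in> {corner_face (\<not> s) False, corner_face (\<not> s) True}) \<and>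
      (knot_proj K (y * cis t) \<in> closure F \<longleftrightarrow> F \<in> {corner_face False r, corner_face True r}) \<and>
      (knot_proj K (y * cis (- t)) \<in> closure F \<longleftrightarrow> F \<in> {corner_face False (\<not> r), corner_face True (\<not> r)})"
    proof (intro conjI)
      show "knot_proj K (x * cis t) \<in> closure F \<longleftrightarrow> F \<in> {corner_face s False, corner_face s True}"
        using S by (intro closure_face_axis_X[OF F]) simp_all
      show "knot_proj K (x * cis (- t)) \<in> closure F \<longleftrightarrow> F \<in> {corner_face (\<not> s) False, corner_face (\<not> s) True}"
        using S by (intro closure_face_axis_X[OF F]) simp_all
      show "knot_proj K (y * cis t) \<in> closure F \<longleftrightarrow> F \<in> {corner_face False r, corner_face True r}"
        using R by (intro closure_face_axis_Y[OF F]) simp_all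
      show "knot_proj K (y * cis (- t)) \<in> closure F \<longleftrightarrow> F \<in> {corner_face False (\<not> r), corner_face True (\<not> r)}"
        using R by (intro closure_face_axis_Y[OF F]) simp_all
    qed
  qed
qed

lemma closure_face_center:
  assumes F: "F \<in> faces K"
  shows "p \<in> closure F \<longleftrightarrow> (\<exists>a b. F = corner_face a b)"
  unfolding closure_face_iff[OF F p_N] h_p by simp

end

lemma two_preimages:
  assumes K: "regular_knot K" and p: "p \<in> crossings K"
  obtains x y where "x \<noteq> y" "{z \<in> circle. knot_proj K z = p} = {x, y}"
proof -
  obtain N h h' X Y where "crossing_chart K p N h h' X Y" by (rule obtain_chart[OF K p])
  then interpret crossing_chart K p N h h' X Y .
  obtain x y where "x \<in> X" "y \<in> Y" "{z \<in> circle. knot_proj K z = p} = {x, y}"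
    by (rule preimages) (rule that)
  then show ?thesis using XY(1) by (intro that[of x y]) auto
qed

lemma crossing_parameters:
  assumes K: "regular_knot K"
  shows "finite {z \<in> circle. knot_proj K z \<in> crossings K}"
    and "card {z \<in> circle. knot_proj K z \<in> crossings K} = 2 * card (crossings K)"
proof -
  let ?B = "\<lambda>p. {z \<in> circle. knot_proj K z = p}"
  have eq: "{z \<in> circle. knot_proj K z \<in> crossings K} = (\<Union>p\<in>crossings K. ?B p)" by blast
  have fin: "finite (crossings K)" using K by (simp add: regular_knot_def)
  have B: "finite (?B p)" "card (?B p) = 2" if p: "p \<in> crossings K" for p
  proof -
    obtain x y where "x \<noteq> y" "?B p = {x, y}" by (rule two_preimages[OF K p])
    then show "finite (?B p)" "card (?B p) = 2" by simp_all
  qed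
  show "finite {z \<in> circle. knot_proj K z \<in> crossings K}"
    unfolding eq using fin B by (intro finite_UN_I)
  have "card (\<Union>p\<in>crossings K. ?B p) = (\<Sum>p\<in>crossings K. card (?B p))"
    using fin B by (intro card_UN_disjoint) auto
  then show "card {z \<in> circle. knot_proj K z \<in> crossings K} = 2 * card (crossings K)"
    unfolding eq using B by simp
qed

section \<open>Edges and faces of a diagram\<close>

lemma open_not_subset_arcs:
  fixes c :: "'i \<Rightarrow> real \<Rightarrow> complex"
  assumes "finite I" "\<And>i. i \<in> I \<Longrightarrow> arc (c i)" "open B" "B \<noteq> {}"
  shows "\<not> B \<subseteq> (\<Union>i\<in>I. path_image (c i))"
  using assms
proof (induction I arbitrary: B)
  case (insert i I)
  have "closed (path_image (c i))" using insert.prems by (intro closed_arc_image) simp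
  then have "open (B - path_image (c i))" using insert.prems by (intro open_Diff) auto
  moreover have "B - path_image (c i) \<noteq> {}" using open_not_subset_arc[of "c i" B] insert.prems by auto
  ultimately have "\<not> B - path_image (c i) \<subseteq> (\<Union>i\<in>I. path_image (c i))"
    using insert by simp
  then show ?case by auto
qed simp

lemma under_over_params:
  assumes K: "regular_knot K"
  shows "over_params K \<union> under_params K = {z \<in> circle. knot_proj K z \<in> crossings K}"
proof (rule Set.set_eqI)
  fix z
  have 1: "z \<in> over_params K \<or> z \<in> under_params K \<longleftrightarrow> z \<in> circle \<and> (\<exists>y\<in>circle. knot_proj K y = knot_proj K z \<and> knot_height K y \<noteq> knot_height K z)"
    unfolding over_params_def under_params_def mem_Collect_eq neq_iff by blast
  have inj: "inj_on K circle" using K by (simp add: regular_knot_def)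
  have 3: "knot_height K y \<noteq> knot_height K z \<longleftrightarrow> y \<noteq> z" if "z \<in> circle" "y \<in> circle" "knot_proj K y = knot_proj K z" for y
    using inj_onD[OF inj, of y z] that by (auto simp: knot_height_def knot_proj_def prod_eq_iff)
  have 2: "knot_proj K z \<in> crossings K \<longleftrightarrow> (\<exists>y\<in>circle. knot_proj K y = knot_proj K z \<and> y \<noteq> z)" if "z \<in> circle"
    unfolding crossings_def mem_Collect_eq using that by metis
  show "(z \<in> over_params K \<union> under_params K) = (z \<in> {z \<in> circle. knot_proj K z \<in> crossings K})"
    unfolding Un_iff 1 mem_Collect_eq using 2 3 by blast
qed

locale knot_diagram =
  fixes K :: "complex \<Rightarrow> complex \<times> real"
  assumes regular: "regular_knot K" and crossings_ne: "crossings K \<noteq> {}"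
begin

abbreviation g :: "complex \<Rightarrow> complex"
  where "g \<equiv> knot_proj K"

definition P :: "complex set"
  where "P = {z \<in> circle. g z \<in> crossings K}"

lemma mem_P: "z \<in> P \<longleftrightarrow> z \<in> circle \<and> g z \<in> crossings K"
  by (simp add: P_def)

lemma cont_g: "continuous_on circle g"
  using regular unfolding regular_knot_def knot_proj_def by (intro continuous_intros) auto

sublocale circle_points P
proof
  show "finite P" unfolding P_def by (rule crossing_parameters(1)[OF regular])
  show "P \<noteq> {}" using crossings_ne unfolding P_def crossings_def by blast
  show "P \<subseteq> circle" unfolding P_def by blast
qed

lemma compact_shadow: "compact (shadow K)"
  unfolding shadow_def by (intro compact_continuous_image cont_g) simp

lemma g_inj: "z \<in> circle \<Longrightarrow> w \<in> circle \<Longrightarrow> g z = g w \<Longrightarrow> z \<notin> P \<Longrightarrow> z = w"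
proof (rule ccontr)
  assume zw: "z \<in> circle" "w \<in> circle" "g z = g w" "z \<notin> P" "z \<noteq> w"
  then have "g z \<in> crossings K"
    unfolding crossings_def by (intro CollectI bexI[of _ z] bexI[of _ w]) auto
  then show False using zw by (simp add: mem_P)
qed

lemma gap_pos: "x \<in> P \<Longrightarrow> 0 < gap x" and gap_le: "x \<in> P \<Longrightarrow> gap x \<le> 2 * pi"
  and nxt_in: "x \<in> P \<Longrightarrow> nxt x \<in> P"
  and gap_free: "x \<in> P \<Longrightarrow> 0 < t \<Longrightarrow> t < gap x \<Longrightarrow> x * cis t \<notin> P"
  using gap P_in by blast+

lemma inner_inj:
  assumes x: "x \<in> P" and t: "0 < t" "t < gap x" and w: "w \<in> circle" "g (x * cis t) = g w"
  shows "w = x * cis t"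
  using g_inj[OF _ w(1) w(2) gap_free[OF x t]] P_in[OF x] by (simp add: norm_mult)

lemma inner_inj':
  assumes x: "x \<in> P" and s: "0 \<le> s" "s \<le> 2 * pi" and t: "0 < t" "t < gap x" and eq: "g (x * cis s) = g (x * cis t)"
  shows "s = t"
proof -
  have c: "x \<in> circle" using P_in[OF x] .
  have "x * cis s = x * cis t" using inner_inj[OF x t, of "x * cis s"] c eq by (simp add: norm_mult)
  then show ?thesis using s t gap_le[OF x] by (intro rot_eq_imp[OF _ c]) auto
qed

lemma edge_inj:
  assumes x: "x \<in> P" and s: "0 \<le> s" "s \<le> gap x" and t: "0 \<le> t" "t \<le> gap x"
    and eq: "g (x * cis s) = g (x * cis t)" and ne: "s \<noteq> t"
  shows "s = 0 \<and> t = gap x \<or> s = gap x \<and> t = 0"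
proof -
  have "\<not> (0 < s \<and> s < gap x)"
    using inner_inj'[OF x t(1) _ _ _ eq[symmetric]] t gap_le[OF x] ne by auto
  moreover have "\<not> (0 < t \<and> t < gap x)"
    using inner_inj'[OF x s(1) _ _ _ eq] s gap_le[OF x] ne by auto
  ultimately show ?thesis using s t ne by linarith
qed

definition seg :: "complex \<Rightarrow> real \<Rightarrow> real \<Rightarrow> real \<Rightarrow> complex"
  where "seg x s t = (\<lambda>u. g (x * cis (s + u * (t - s))))"

lemma cont_rot: "x \<in> circle \<Longrightarrow> continuous_on T (\<lambda>t. g (x * cis t))"
  by (rule continuous_on_compose2[OF cont_g continuous_rot]) (auto simp: norm_mult)

lemma path_seg: "x \<in> circle \<Longrightarrow> path (seg x s t)"
  unfolding path_def seg_def
  by (rule continuous_on_compose2[OF cont_rot[of x UNIV]]) (auto intro!: continuous_intros)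

lemma path_image_seg: "s \<le> t \<Longrightarrow> path_image (seg x s t) = g ` circle_arc x {s..t}"
proof -
  assume st: "s \<le> t"
  have "(\<lambda>u. s + u * (t - s)) ` {0..1} = {s..t}"
    using image_affinity_atLeastAtMost[of "t - s" s 0 1] st by (auto simp: mult.commute add.commute)
  then show ?thesis
    unfolding path_image_def seg_def circle_arc_def
    by (metis (no_types, lifting) image_cong image_image)
qed

lemma g_circle_arc: "g ` circle_arc x T = (\<lambda>u. g (x * cis u)) ` T"
  by (simp add: circle_arc_def image_image)

lemma seg_ends [simp]: "pathstart (seg x s t) = g (x * cis s)" "pathfinish (seg x s t) = g (x * cis t)"
  by (simp_all add: seg_def pathstart_def pathfinish_def)

lemma seg_inj:
  assumes x: "x \<in> P" and s: "0 \<le> s" "s < t" "t \<le> gap x"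
    and u: "0 \<le> u" "u \<le> 1" and v: "0 \<le> v" "v \<le> 1" and eq: "seg x s t u = seg x s t v"
  shows "u = v \<or> s = 0 \<and> t = gap x \<and> (u = 0 \<and> v = 1 \<or> u = 1 \<and> v = 0)"
proof -
  let ?a = "s + u * (t - s)" and ?b = "s + v * (t - s)"
  have bound: "0 \<le> s + w * (t - s) \<and> s + w * (t - s) \<le> gap x" if "0 \<le> w" "w \<le> 1" for w
  proof -
    define p where "p = w * (t - s)"
    have "w * (t - s) \<le> 1 * (t - s)" using s that by (intro mult_right_mono) auto
    then have "p \<le> t - s" by (simp add: p_def)
    moreover have "0 \<le> p" using s that by (simp add: p_def)
    ultimately show ?thesis unfolding p_def[symmetric] using s by auto
  qed
  have ab: "0 \<le> ?a" "?a \<le> gap x" "0 \<le> ?b" "?b \<le> gap x"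
    using bound[OF u] bound[OF v] by simp_all
  have eq': "g (x * cis ?a) = g (x * cis ?b)" using eq by (simp add: seg_def)
  show ?thesis
  proof (cases "?a = ?b")
    case True
    then show ?thesis using s by simp
  next
    case False
    have *: "?a = 0 \<and> ?b = gap x \<or> ?a = gap x \<and> ?b = 0"
      by (rule edge_inj[OF x ab eq' False])
    have z: "s = 0 \<and> w = 0" if "s + w * (t - s) = 0" "0 \<le> w" for w
    proof -
      have "0 \<le> w * (t - s)" using that s by simp
      then have "s = 0 \<and> w * (t - s) = 0"
        using add_nonneg_eq_0_iff[OF s(1), of "w * (t - s)"] that(1) by argo
      then show ?thesis using s(2) by simp
    qed
    have o: "t = gap x \<and> w = 1" if "s + w * (t - s) = gap x" "0 \<le> w" "w \<le> 1" for w
    proof -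
      define p where "p = w * (t - s)"
      have "p \<le> 1 * (t - s)" unfolding p_def using that s by (intro mult_right_mono) auto
      moreover have "s + p = gap x" using that(1) by (simp add: p_def)
      ultimately have "t = gap x" using s(3) by simp
      then have "(w - 1) * (t - s) = 0" using that by (simp add: algebra_simps)
      then show ?thesis using \<open>t = gap x\<close> s by simp
    qed
    show ?thesis using * z[of u] z[of v] o[of u] o[of v] u v by blast
  qed
qed

lemma arc_seg:
  assumes x: "x \<in> P" and s: "0 \<le> s" "s < t" "t \<le> gap x" and ne: "0 < s \<or> t < gap x \<or> g x \<noteq> g (nxt x)"
  shows "arc (seg x s t)"
proof -
  have "inj_on (seg x s t) {0..1}"
  proof (rule inj_onI)
    fix u v assume uv: "u \<in> {0..1}" "v \<in> {0..1}" "seg x s t u = seg x s t v"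
    show "u = v"
    proof (rule ccontr)
      assume "u \<noteq> v"
      then have *: "s = 0" "t = gap x" "u = 0 \<and> v = 1 \<or> u = 1 \<and> v = 0"
        using seg_inj[OF x s, of u v] uv by auto
      then have "g x = g (nxt x)" using uv(3) by (auto simp: seg_def nxt_def)
      then show False using ne * by simp
    qed
  qed
  then show ?thesis using path_seg P_in[OF x] by (simp add: arc_def)
qed

lemma loop_seg:
  assumes x: "x \<in> P" and eq: "g x = g (nxt x)"
  shows "simple_path (seg x 0 (gap x))" "pathfinish (seg x 0 (gap x)) = pathstart (seg x 0 (gap x))"
proof -
  show "simple_path (seg x 0 (gap x))"
    unfolding simple_path_def loop_free_def
    using path_seg[of x 0 "gap x"] P_in[OF x] seg_inj[OF x order_refl gap_pos[OF x] order_refl] by fastforce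
  show "pathfinish (seg x 0 (gap x)) = pathstart (seg x 0 (gap x))"
    using eq by (simp add: nxt_def)
qed

text \<open>
  Edges are indexed by the parameters at which they start.
\<close>

abbreviation edge_arc :: "complex \<Rightarrow> complex set"
  where "edge_arc x \<equiv> g ` circle_arc x {0..gap x}"

lemma shadow_edges: "shadow K = (\<Union>x\<in>P. edge_arc x)"
proof (intro subset_antisym subsetI)
  fix q assume "q \<in> shadow K"
  then obtain z where z: "z \<in> circle" "q = g z" by (auto simp: shadow_def)
  obtain x s where x: "x \<in> P" and s: "0 \<le> s" "s < gap x" "z = x * cis s" by (rule position_exists[OF z(1)])
  have "z \<in> circle_arc x {0..gap x}" unfolding circle_arc_def s(3) using s by (intro imageI) simp
  then show "q \<in> (\<Union>x\<in>P. edge_arc x)" using x z by blast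
next
  fix q assume "q \<in> (\<Union>x\<in>P. edge_arc x)"
  then show "q \<in> shadow K" using circle_arc_subset P_in unfolding shadow_def by blast
qed

lemma open_not_subset_shadow:
  assumes "open B" "B \<noteq> {}"
  shows "\<not> B \<subseteq> shadow K"
proof -
  let ?c = "\<lambda>(x, b). if b then seg x 0 (gap x / 2) else seg x (gap x / 2) (gap x)"
  have "shadow K \<subseteq> (\<Union>i\<in>P \<times> UNIV. path_image (?c i))"
  proof
    fix q assume "q \<in> shadow K"
    then obtain x t where x: "x \<in> P" and t: "0 \<le> t" "t \<le> gap x" "q = g (x * cis t)"
      unfolding shadow_edges g_circle_arc by auto
    have "q \<in> path_image (?c (x, t \<le> gap x / 2))"
      using t gap_pos[OF x] by (auto simp: path_image_seg g_circle_arc)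
    then show "q \<in> (\<Union>i\<in>P \<times> UNIV. path_image (?c i))" using x by blast
  qed
  moreover have "\<not> B \<subseteq> (\<Union>i\<in>P \<times> UNIV. path_image (?c i))"
  proof (rule open_not_subset_arcs[OF _ _ assms])
    show "finite (P \<times> (UNIV :: bool set))" using finite_P by simp
    show "arc (?c i)" if "i \<in> P \<times> UNIV" for i
    proof (cases i)
      case (Pair x b)
      then have x: "x \<in> P" using that by blast
      then show ?thesis using Pair gap_pos[OF x] by (cases b) (auto intro!: arc_seg)
    qed
  qed
  ultimately show ?thesis by blast
qed

lemma face_facts:
  assumes F: "F \<in> faces K"
  shows "open F" "connected F" "F \<noteq> {}" "F \<inter> shadow K = {}" "frontier F \<subseteq> shadow K"
proof -
  have cS: "closed (shadow K)" using compact_shadow compact_imp_closed by blast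
  show "open F" using F cS unfolding faces_def by (metis open_Compl open_components)
  show "connected F" "F \<noteq> {}" using F unfolding faces_def by (auto simp: in_components_connected in_components_nonempty)
  show "F \<inter> shadow K = {}" using F in_components_subset unfolding faces_def by blast
  show "frontier F \<subseteq> shadow K"
    using F frontier_of_components_closed_complement[OF cS] unfolding faces_def by blast
qed

lemma frontier_face: "F \<in> faces K \<Longrightarrow> q \<in> shadow K \<Longrightarrow> q \<in> frontier F \<longleftrightarrow> q \<in> closure F"
  using face_facts[of F] by (auto simp: frontier_def interior_open)

text \<open>
  If the closure of \<open>F\<close> contains one inner point of the edge but misses another one, remove a small
  piece around the latter. The rest of the edge consists of two hairs on the rest of the shadow. Without
  the hairs, \<open>F\<close> is connected to the missed point along the edge; hairs do not separate, by Janiszewski's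
  theorem, so it still is in their presence. But then \<open>F\<close> could be left only through the removed piece, which
  is away from its closure.
\<close>

lemma edge_all_or_nothing:
  assumes x: "x \<in> P" and F: "F \<in> faces K" and s: "0 < s" "s < gap x" and t: "0 < t" "t < gap x"
    and clos: "g (x * cis s) \<in> closure F"
  shows "g (x * cis t) \<in> closure F"
proof (rule ccontr)
  assume far: "g (x * cis t) \<notin> closure F"
  have xc: "x \<in> circle" using P_in[OF x] .
  let ?e = "\<lambda>u. g (x * cis u)"
  have "isCont ?e t" using cont_rot[OF xc, of UNIV] by (simp add: continuous_on_eq_continuous_at)
  then have "\<forall>\<^sub>F u in at t. ?e u \<in> - closure F"
    using far by (intro topological_tendstoD) (auto simp: isCont_def)
  then obtain d where d: "d > 0" "\<And>u. u \<noteq> t \<Longrightarrow> dist u t < d \<Longrightarrow> ?e u \<notin> closure F"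
    by (auto simp: eventually_at)
  then have d2: "?e u \<notin> closure F" if "dist u t < d" for u using far that by (cases "u = t") auto
  define m where "m = min d (min t (gap x - t)) / 2"
  have m: "0 < m" "m < d" "m < t" "m < gap x - t" using d(1) t by (auto simp: m_def min_def)
  define a where "a = t - m"
  define b where "b = t + m"
  have ab: "0 < a" "a < t" "t < b" "b < gap x" using m by (auto simp: a_def b_def)
  have away: "?e u \<notin> closure F" if "a < u" "u < b" for u
    using that m by (intro d2) (auto simp: a_def b_def dist_real_def abs_if)
  \<comment> \<open>The shadow is the union of \<open>X\<close>, the hairs \<open>h1\<close> and \<open>h2\<close>, and the removed piece.\<close>
  define X where "X = g ` circle_arc x {gap x..2 * pi}"
  define h1 where "h1 = seg x 0 a"
  define h2 where "h2 = seg x b (gap x)"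
  have X: "compact X"
    unfolding X_def using continuous_on_subset[OF cont_g circle_arc_subset[OF xc]]
    by (intro compact_continuous_image compact_circle_arc)
  have notX: "?e u \<notin> X" if u: "0 < u" "u < gap x" for u
  proof
    assume "?e u \<in> X"
    then obtain v where "gap x \<le> v" "v \<le> 2 * pi" "?e v = ?e u" unfolding X_def g_circle_arc by auto
    then show False using inner_inj'[OF x, of v u] u gap_pos[OF x] by auto
  qed
  have pi1: "path_image h1 = ?e ` {0..a}" and pi2: "path_image h2 = ?e ` {b..gap x}"
    using ab by (simp_all add: h1_def h2_def path_image_seg g_circle_arc)
  have not1: "?e u \<notin> path_image h1" if u: "a < u" "u < gap x" for u
  proof
    assume "?e u \<in> path_image h1"
    then obtain v where v: "0 \<le> v" "v \<le> a" "?e v = ?e u" unfolding pi1 by auto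
    then have "v = u" using inner_inj'[OF x, of v u] u ab gap_le[OF x] by simp
    then show False using v u by simp
  qed
  have not2: "?e u \<notin> path_image h2" if u: "0 < u" "u < b" for u
  proof
    assume "?e u \<in> path_image h2"
    then obtain v where v: "b \<le> v" "v \<le> gap x" "?e v = ?e u" unfolding pi2 by auto
    then have "v = u" using inner_inj'[OF x, of v u] u ab gap_le[OF x] by simp
    then show False using v u by simp
  qed
  have arc1: "arc h1" and arc2: "arc h2" unfolding h1_def h2_def using x ab by (auto intro!: arc_seg)
  have gX: "g x \<in> X" "g (nxt x) \<in> X"
    unfolding X_def g_circle_arc nxt_def using gap_le[OF x]
    by (auto intro: image_eqI[of _ _ "2 * pi"])
  have int1: "path_image h1 \<inter> X = {g x}"
  proof -
    have "q = g x" if q: "q \<in> path_image h1" "q \<in> X" for q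
    proof -
      obtain u where u: "0 \<le> u" "u \<le> a" "q = ?e u" using q(1) unfolding pi1 by auto
      then have "u = 0" using q(2) notX[of u] ab by force
      then show ?thesis using u by simp
    qed
    moreover have "g x \<in> path_image h1" unfolding pi1 using ab by (auto intro!: image_eqI[of _ _ 0])
    ultimately show ?thesis using gX(1) by blast
  qed
  have int2: "path_image h2 \<inter> (path_image h1 \<union> X) = {g (nxt x)}"
  proof -
    have "q = g (nxt x)" if q: "q \<in> path_image h2" "q \<in> path_image h1 \<union> X" for q
    proof -
      obtain u where u: "b \<le> u" "u \<le> gap x" "q = ?e u" using q(1) unfolding pi2 by auto
      then have "u = gap x" using q(2) notX[of u] not1[of u] ab by force
      then show ?thesis using u by (simp add: nxt_def)
    qed
    moreover have "g (nxt x) \<in> path_image h2" unfolding pi2 nxt_def using ab by (auto intro!: image_eqI[of _ _ "gap x"])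
    ultimately show ?thesis using gX(2) by blast
  qed
  obtain p where p: "p \<in> F" using face_facts(3)[OF F] by blast
  have pS: "p \<notin> shadow K" using p face_facts(4)[OF F] by blast
  have sub: "X \<subseteq> shadow K" "path_image h1 \<subseteq> shadow K" "path_image h2 \<subseteq> shadow K"
    using xc by (auto simp: X_def pi1 pi2 shadow_def g_circle_arc norm_mult)
  have "connected_component (- X) p (?e t)"
  proof -
    have "connected (F \<union> {?e s})"
    proof (rule connected_intermediate_closure[OF face_facts(2)[OF F]])
      show "F \<union> {?e s} \<subseteq> closure F" using clos closure_subset[of F] by blast
    qed blast
    moreover have "connected (?e ` {0<..<gap x})"
      by (intro connected_continuous_image cont_rot[OF xc]) simp
    ultimately have "connected ((F \<union> {?e s}) \<union> ?e ` {0<..<gap x})"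
    proof (rule connected_Un)
      have "?e s \<in> ?e ` {0<..<gap x}" using s by (intro imageI) simp
      then show "(F \<union> {?e s}) \<inter> ?e ` {0<..<gap x} \<noteq> {}" by blast
    qed
    moreover have "F \<union> {?e s} \<union> ?e ` {0<..<gap x} \<subseteq> - X"
    proof (intro Un_least)
      show "F \<subseteq> - X" using face_facts(4)[OF F] sub by blast
      show "{?e s} \<subseteq> - X" using notX[OF s] by blast
      show "?e ` {0<..<gap x} \<subseteq> - X" using notX by (intro image_subsetI) simp
    qed
    moreover have "p \<in> F \<union> {?e s} \<union> ?e ` {0<..<gap x}" using p by blast
    moreover have "?e t \<in> F \<union> {?e s} \<union> ?e ` {0<..<gap x}" using t by (intro UnI2 imageI) simp
    ultimately show ?thesis
      unfolding connected_component_def by (intro exI conjI)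
  qed
  moreover have "p \<notin> path_image h1" "p \<notin> path_image h2" using pS sub by blast+
  moreover have "?e t \<notin> path_image h1" "?e t \<notin> path_image h2" using not1[of t] not2[of t] ab t by simp_all
  moreover have "closed X" using X by (rule compact_imp_closed)
  moreover have "closed (path_image h1 \<union> X)" using \<open>closed X\<close> arc1 by (intro closed_Un closed_arc_image)
  ultimately have "connected_component (- (path_image h2 \<union> (path_image h1 \<union> X))) p (?e t)"
    by (intro connected_component_avoiding_hair[OF _ arc2 int2] connected_component_avoiding_hair[OF _ arc1 int1])
  then obtain D where D: "connected D" "D \<subseteq> - (path_image h2 \<union> (path_image h1 \<union> X))" "p \<in> D" "?e t \<in> D"
    unfolding connected_component_def by blast
  have "?e t \<notin> F" using far closure_subset by blast
  then have "D \<inter> frontier F \<noteq> {}" using D p by (intro connected_Int_frontier) auto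
  then obtain r where r: "r \<in> D" "r \<in> frontier F" by blast
  then have "r \<in> shadow K" using face_facts(5)[OF F] by blast
  then obtain z where z: "z \<in> circle" "r = g z" by (auto simp: shadow_def)
  obtain u where u: "0 < u" "u \<le> 2 * pi" "z = x * cis u" by (rule on_circle_rot[OF xc z(1)])
  have "a < u \<and> u < b"
  proof (rule ccontr)
    assume "\<not> ?thesis"
    then have "u \<in> {0..a} \<union> {b..gap x} \<union> {gap x..2 * pi}" using u by auto
    then have "r \<in> path_image h2 \<union> (path_image h1 \<union> X)"
      using z u by (auto simp: pi1 pi2 X_def g_circle_arc)
    then show False using D r by blast
  qed
  then show False using away r z u by (auto simp: frontier_def)
qed

end

context knot_diagram
begin

text \<open>
  The union of the edges in \<open>A\<close>; the base point makes it nonempty and connected from the start.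
\<close>

definition partial_shadow :: "complex \<Rightarrow> complex set \<Rightarrow> complex set"
  where "partial_shadow x0 A = insert (g x0) (\<Union>x\<in>A. edge_arc x)"

lemma compact_edge_arc: "x \<in> P \<Longrightarrow> compact (edge_arc x)"
  using continuous_on_subset[OF cont_g circle_arc_subset[OF P_in]]
  by (intro compact_continuous_image compact_circle_arc) auto

lemma path_connected_edge_arc: "x \<in> P \<Longrightarrow> path_connected (edge_arc x)"
proof -
  assume x: "x \<in> P"
  have "path_connected (path_image (seg x 0 (gap x)))"
    by (rule path_connected_path_image[OF path_seg[OF P_in[OF x]]])
  then show ?thesis using path_image_seg[of 0 "gap x" x] gap_pos[OF x] by simp
qed

lemma edge_arc_ends: "x \<in> P \<Longrightarrow> g x \<in> edge_arc x" "x \<in> P \<Longrightarrow> g (nxt x) \<in> edge_arc x"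
  using gap_pos[of x] by (auto simp: g_circle_arc nxt_def intro: image_eqI[of _ _ 0] image_eqI[of _ _ "gap x"])

lemma inner_not_in_edge:
  assumes x: "x \<in> P" and t: "0 < t" "t < gap x" and y: "y \<in> P" "y \<noteq> x"
  shows "g (x * cis t) \<notin> edge_arc y"
proof
  assume "g (x * cis t) \<in> edge_arc y"
  then obtain u where u: "0 \<le> u" "u \<le> gap y" "g (y * cis u) = g (x * cis t)"
    unfolding g_circle_arc by auto
  have "y * cis u \<in> circle" using P_in[OF y(1)] by (simp add: norm_mult)
  then have eq: "y * cis u = x * cis t" using inner_inj[OF x t] u(3) by simp
  show False
  proof (cases "u = gap y")
    case True
    then have "x * cis t \<in> P" using eq nxt_in[OF y(1)] by (simp add: nxt_def)
    then show False using gap_free[OF x t] by simp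
  next
    case False
    then have "y = x" using position_unique[OF y(1) x eq] u t by simp
    then show False using y by simp
  qed
qed

lemma inner_not_crossing:
  assumes x: "x \<in> P" and t: "0 < t" "t < gap x"
  shows "g (x * cis t) \<notin> crossings K"
  using gap_free[OF x t] P_in[OF x] by (simp add: mem_P norm_mult)

lemma inner_not_in_partial:
  assumes x0: "x0 \<in> P" and A: "A \<subseteq> P" and x: "x \<in> P - A" and t: "0 < t" "t < gap x"
  shows "g (x * cis t) \<notin> partial_shadow x0 A"
proof -
  have "g (x * cis t) \<noteq> g x0" using inner_not_crossing[of x t] x t x0 by (auto simp: mem_P)
  moreover have "g (x * cis t) \<notin> edge_arc y" if "y \<in> A" for y
    using inner_not_in_edge[of x t y] x t that A by blast
  ultimately show ?thesis by (auto simp: partial_shadow_def)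
qed

lemma partial_shadow_subset: "x0 \<in> P \<Longrightarrow> A \<subseteq> P \<Longrightarrow> partial_shadow x0 A \<subseteq> shadow K"
  unfolding partial_shadow_def shadow_edges using edge_arc_ends(1) by blast

lemma closed_partial_shadow: "A \<subseteq> P \<Longrightarrow> closed (partial_shadow x0 A)"
  unfolding partial_shadow_def using finite_subset[OF _ finite_P] compact_edge_arc
  by (intro closed_insert closed_UN ballI compact_imp_closed) auto

text \<open>
  A new edge with both ends on a connected part of the diagram closes up to a simple closed curve
  with an arc of this part. By the Jordan curve theorem this curve separates points close to the new edge,
  which the old part did not separate.
\<close>

lemma adding_edge_splits:
  assumes x0: "x0 \<in> P" and A: "A \<subseteq> P" and x: "x \<in> P - A"
    and pc: "path_connected (partial_shadow x0 A)"
    and ends: "g x \<in> partial_shadow x0 A" "g (nxt x) \<in> partial_shadow x0 A"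
  obtains a b where "connected_component (- partial_shadow x0 A) a b"
    "a \<notin> partial_shadow x0 (insert x A)" "b \<notin> partial_shadow x0 (insert x A)"
    "\<not> connected_component (- partial_shadow x0 (insert x A)) a b"
proof -
  let ?S = "partial_shadow x0 A" and ?T = "partial_shadow x0 (insert x A)"
  have xP: "x \<in> P" using x by blast
  have T: "?T = ?S \<union> edge_arc x" by (auto simp: partial_shadow_def)
  have e: "edge_arc x = path_image (seg x 0 (gap x))" using path_image_seg[of 0 "gap x" x] gap_pos[OF xP] by simp
  have cS: "closed ?S" by (rule closed_partial_shadow[OF A])
  let ?q = "g (x * cis (gap x / 2))"
  have qS: "?q \<notin> ?S" using inner_not_in_partial[OF x0 A x] gap_pos[OF xP] by simp
  have qe: "?q \<in> edge_arc x" using gap_pos[OF xP] unfolding g_circle_arc by (intro imageI) simp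
  have meet: "q = g x \<or> q = g (nxt x)" if q: "q \<in> edge_arc x" "q \<in> ?S" for q
  proof -
    obtain u where u: "0 \<le> u" "u \<le> gap x" "q = g (x * cis u)" using q(1) unfolding g_circle_arc by auto
    have "\<not> (0 < u \<and> u < gap x)"
    proof
      assume "0 < u \<and> u < gap x"
      then have "q \<notin> ?S" unfolding u(3) by (intro inner_not_in_partial[OF x0 A x]) simp_all
      then show False using q(2) by simp
    qed
    then have "u = 0 \<or> u = gap x" using u(1,2) by (metis less_eq_real_def)
    then show ?thesis using u by (auto simp: nxt_def)
  qed
  obtain c where c: "simple_path c" "pathfinish c = pathstart c" and qc: "?q \<in> path_image c"
    and cT: "path_image c \<subseteq> ?T" and Tc: "?T \<subseteq> ?S \<union> path_image c"
  proof (cases "g x = g (nxt x)")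
    case True
    show ?thesis
      by (rule that[OF loop_seg[OF xP True]]) (use qe T in \<open>auto simp: e[symmetric]\<close>)
  next
    case False
    obtain d where d: "arc d" "path_image d \<subseteq> ?S" "pathstart d = g (nxt x)" "pathfinish d = g x"
      using pc ends False unfolding path_connected_arcwise by metis
    have a: "arc (seg x 0 (gap x))" using xP gap_pos[OF xP] False by (intro arc_seg) auto
    let ?c = "seg x 0 (gap x) +++ d"
    have pi: "path_image ?c = edge_arc x \<union> path_image d"
      using d by (simp add: path_image_join e nxt_def)
    show ?thesis
    proof (rule that[of ?c])
      show "simple_path ?c"
      proof (rule simple_path_join_loop[OF a d(1)])
        show "path_image (seg x 0 (gap x)) \<inter> path_image d \<subseteq> {pathstart (seg x 0 (gap x)), pathstart d}"
          using meet d unfolding e[symmetric] by auto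
      qed (use d in \<open>simp_all add: nxt_def\<close>)
      show "pathfinish ?c = pathstart ?c" using d by simp
      show "?q \<in> path_image ?c" using qe pi by blast
      show "path_image ?c \<subseteq> ?T" using pi d T by blast
      show "?T \<subseteq> ?S \<union> path_image ?c" using pi T by blast
    qed
  qed
  obtain a b where ab: "a \<notin> ?S \<union> path_image c" "b \<notin> ?S \<union> path_image c"
    "connected_component (- ?S) a b" "\<not> connected_component (- path_image c) a b"
    by (rule simple_closed_curve_separates_locally[OF c cS qc qS])
  have "\<not> connected_component (- ?T) a b"
    using ab(4) cT connected_component_of_subset[of "- ?T" a b "- path_image c"] by blast
  then show ?thesis using that[of a b] ab Tc by blast
qed

text \<open>
  The inequality in Euler's formula for connected plane graphs: add the edges in an order that keeps the graph
  connected. A new edge either brings a new vertex or splits a component of the complement.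
\<close>

lemma face_count_partial:
  assumes x0: "x0 \<in> P" and fin: "finite (faces K)" and k: "k \<le> card P"
  shows "\<exists>A\<subseteq>P. card A = k \<and> path_connected (partial_shadow x0 A) \<and>
    k + 2 \<le> card (components (- partial_shadow x0 A)) + card (insert (g x0) (g ` (A \<union> nxt ` A)))"
  using k
proof (induction k)
  case 0
  have "connected (- {g x0})" by (rule connected_punctured_universe) simp
  moreover have "- {g x0} \<noteq> {}" by (metis Compl_empty_eq finite.emptyI finite_insert infinite_UNIV_char_0 double_complement)
  ultimately have "components (- {g x0}) = {- {g x0}}" by (simp add: components_eq_sing_iff)
  then show ?case by (intro exI[of _ "{}"]) (simp add: partial_shadow_def)
next
  case (Suc k)
  from Suc.IH[OF Suc_leD[OF Suc.prems]] obtain A where A: "A \<subseteq> P" "card A = k"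
    and pc: "path_connected (partial_shadow x0 A)"
    and IH: "k + 2 \<le> card (components (- partial_shadow x0 A)) + card (insert (g x0) (g ` (A \<union> nxt ` A)))"
    by blast
  let ?V = "\<lambda>A. insert (g x0) (g ` (A \<union> nxt ` A))"
  have "A \<noteq> P" using A Suc.prems by auto
  obtain x where x: "x \<in> P - A" and xV: "g x \<in> ?V A"
  proof (cases "A = {}")
    case True
    then show ?thesis using that[of x0] x0 by simp
  next
    case False
    then obtain a where "a \<in> A" "nxt a \<notin> A" using nxt_cycle[OF A(1)] \<open>A \<noteq> P\<close> by blast
    then show ?thesis using that[of "nxt a"] A nxt_in by blast
  qed
  have xP: "x \<in> P" using x by blast
  let ?A = "insert x A"
  let ?S = "partial_shadow x0 A" and ?T = "partial_shadow x0 ?A"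
  have finA: "finite A" using A finite_P finite_subset by blast
  have AP: "?A \<subseteq> P" using A xP by blast
  have VS: "?V A \<subseteq> ?S"
  proof
    fix q assume "q \<in> ?V A"
    then consider "q = g x0" | a where "a \<in> A" "q = g a" | a where "a \<in> A" "q = g (nxt a)" by blast
    then show "q \<in> ?S"
    proof cases
      case 1
      then show ?thesis by (simp add: partial_shadow_def)
    next
      case 2
      then have "q \<in> edge_arc a" using edge_arc_ends(1)[of a] A by blast
      then show ?thesis using 2(1) unfolding partial_shadow_def by blast
    next
      case 3
      then have "q \<in> edge_arc a" using edge_arc_ends(2)[of a] A by blast
      then show ?thesis using 3(1) unfolding partial_shadow_def by blast
    qed
  qed
  have T: "?T = ?S \<union> edge_arc x" by (auto simp: partial_shadow_def)
  have ST: "?S \<subseteq> ?T" using T by blast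
  have pcT: "path_connected ?T"
    unfolding T using pc path_connected_edge_arc[OF xP] edge_arc_ends(1)[OF xP] VS xV
    by (intro path_connected_Un) auto
  have meets: "\<not> G \<subseteq> T'" if T': "T' \<subseteq> shadow K" and B: "B \<subseteq> P" and G: "G \<in> components (- partial_shadow x0 B)" for G T' B
  proof -
    have "open G" using G closed_partial_shadow[OF B, of x0] by (metis open_Compl open_components)
    moreover have "G \<noteq> {}" using G in_components_nonempty by blast
    ultimately show ?thesis using open_not_subset_shadow T' by blast
  qed
  have TK: "?T \<subseteq> shadow K" using partial_shadow_subset[OF x0 AP] .
  have finT: "finite (components (- ?T))"
    using card_components_mono(1)[OF TK _ meets[OF order_refl AP]] fin unfolding faces_def by blast
  note mono = card_components_mono[OF ST finT meets[OF TK A(1)]]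
  have V: "?V ?A = insert (g (nxt x)) (?V A)" using xV by auto
  have finV: "finite (?V A)" using finA by simp
  have "Suc k + 2 \<le> card (components (- ?T)) + card (?V ?A)"
  proof (cases "g (nxt x) \<in> ?V A")
    case False
    then have "card (?V ?A) = Suc (card (?V A))" unfolding V using finV by (rule card_insert_disjoint[rotated])
    then show ?thesis using IH mono(2) by linarith
  next
    case True
    obtain a b where ab: "connected_component (- ?S) a b" "a \<notin> ?T" "b \<notin> ?T" "\<not> connected_component (- ?T) a b"
      by (rule adding_edge_splits[OF x0 A(1) x pc]) (use VS xV True in blast)+
    have "card (components (- ?S)) + 1 \<le> card (components (- ?T))" by (rule mono(3)[OF _ ab])
    moreover have "card (?V ?A) = card (?V A)" unfolding V using True by (simp only: insert_absorb)
    ultimately show ?thesis using IH by linarith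
  qed
  moreover have "card ?A = Suc k" using A finA x by simp
  ultimately show ?case using AP pcT by blast
qed

text \<open>
  Euler's inequality for the whole shadow, which has twice as many edges as vertices.
\<close>

theorem face_count:
  assumes fin: "finite (faces K)" and two: "card P = 2 * card (crossings K)"
  shows "card (crossings K) + 2 \<le> card (faces K)"
proof -
  obtain x0 where x0: "x0 \<in> P" using P_ne by blast
  obtain A where A: "A \<subseteq> P" "card A = card P"
    and le: "card P + 2 \<le> card (components (- partial_shadow x0 A)) + card (insert (g x0) (g ` (A \<union> nxt ` A)))"
    using face_count_partial[OF x0 fin order_refl] by blast
  have "A = P" using A finite_P card_subset_eq by blast
  then have "partial_shadow x0 A = shadow K"
    using x0 edge_arc_ends(1) unfolding partial_shadow_def shadow_edges by blast
  then have le': "card P + 2 \<le> card (faces K) + card (insert (g x0) (g ` (A \<union> nxt ` A)))"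
    using le by (simp add: faces_def)
  have "insert (g x0) (g ` (A \<union> nxt ` A)) \<subseteq> crossings K"
    using x0 A(1) nxt_in by (auto simp: mem_P)
  then have "card (insert (g x0) (g ` (A \<union> nxt ` A))) \<le> card (crossings K)"
    using regular by (intro card_mono) (simp_all add: regular_knot_def)
  then show ?thesis using le' two by linarith
qed

end

section \<open>The alternating map of a reduced alternating diagram\<close>

lemma finite_surj_bij:
  assumes "finite A" "f ` A \<subseteq> A" "inj_on f A"
  shows "bij_betw f A A"
  using assms by (simp add: bij_betw_def endo_inj_surj)

locale alternating_knot = knot_diagram +
  assumes reduced: "reduced_diagram K" and alternating: "alternating_diagram K"
begin

lemma P_eq: "over_params K \<union> under_params K = P"
  unfolding P_def by (rule under_over_params[OF regular])

lemma crossing_pair: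
  assumes p: "p \<in> crossings K"
  shows "\<exists>u v. {z \<in> circle. g z = p} = {u, v} \<and> knot_height K u < knot_height K v"
proof -
  obtain x y where xy: "x \<noteq> y" "{z \<in> circle. g z = p} = {x, y}"
    by (rule two_preimages[OF regular p])
  have c: "x \<in> circle" "y \<in> circle" "g x = p" "g y = p" using xy(2) by blast+
  have "inj_on K circle" using regular by (simp add: regular_knot_def)
  then have "K x \<noteq> K y" using inj_onD[of K circle x y] xy(1) c by blast
  then have "knot_height K x \<noteq> knot_height K y"
    using c by (auto simp: knot_height_def knot_proj_def prod_eq_iff)
  then consider "knot_height K x < knot_height K y" | "knot_height K y < knot_height K x" by linarith
  then show ?thesis
  proof cases
    case 1
    then show ?thesis using xy(2) by blast
  next
    case 2
    then show ?thesis using xy(2) by (metis insert_commute)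
  qed
qed

definition upar :: "complex \<Rightarrow> complex"
  where "upar p = (SOME u. \<exists>v. {z \<in> circle. g z = p} = {u, v} \<and> knot_height K u < knot_height K v)"

definition opar :: "complex \<Rightarrow> complex"
  where "opar p = (SOME v. {z \<in> circle. g z = p} = {upar p, v} \<and> knot_height K (upar p) < knot_height K v)"

lemma upar_opar:
  assumes p: "p \<in> crossings K"
  shows "{z \<in> circle. g z = p} = {upar p, opar p}" "knot_height K (upar p) < knot_height K (opar p)"
proof -
  have "\<exists>v. {z \<in> circle. g z = p} = {upar p, v} \<and> knot_height K (upar p) < knot_height K v"
    unfolding upar_def by (rule someI_ex[OF crossing_pair[OF p]])
  then have "{z \<in> circle. g z = p} = {upar p, opar p} \<and> knot_height K (upar p) < knot_height K (opar p)"
    unfolding opar_def by (rule someI_ex)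
  then show "{z \<in> circle. g z = p} = {upar p, opar p}" "knot_height K (upar p) < knot_height K (opar p)"
    by simp_all
qed

lemma upar_in: "p \<in> crossings K \<Longrightarrow> upar p \<in> circle \<and> g (upar p) = p"
  and opar_in: "p \<in> crossings K \<Longrightarrow> opar p \<in> circle \<and> g (opar p) = p"
  using upar_opar(1)[of p] by blast+

lemma upar_P: "p \<in> crossings K \<Longrightarrow> upar p \<in> P" and opar_P: "p \<in> crossings K \<Longrightarrow> opar p \<in> P"
  using upar_in[of p] opar_in[of p] by (simp_all add: mem_P)

lemma under_iff: "x \<in> under_params K \<longleftrightarrow> x \<in> P \<and> x = upar (g x)"
  and over_iff: "x \<in> over_params K \<longleftrightarrow> x \<in> P \<and> x = opar (g x)"
proof -
  have "(x \<in> under_params K \<longleftrightarrow> x = upar (g x)) \<and> (x \<in> over_params K \<longleftrightarrow> x = opar (g x))" if x: "x \<in> P"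
  proof -
    let ?p = "g x"
    have p: "?p \<in> crossings K" and xc: "x \<in> circle" using x by (simp_all add: mem_P)
    have xs: "x = upar ?p \<or> x = opar ?p" using upar_opar(1)[OF p] xc by blast
    have ne: "upar ?p \<noteq> opar ?p" using upar_opar(2)[OF p] by auto
    have pre: "y = upar ?p \<or> y = opar ?p" if "y \<in> circle" "g y = ?p" for y
      using upar_opar(1)[OF p] that by blast
    have "x \<in> under_params K \<longleftrightarrow> (\<exists>y\<in>circle. g y = ?p \<and> knot_height K x < knot_height K y)"
      "x \<in> over_params K \<longleftrightarrow> (\<exists>y\<in>circle. g y = ?p \<and> knot_height K y < knot_height K x)"
      unfolding under_params_def over_params_def mem_Collect_eq using xc by simp_all
    moreover have "(\<exists>y\<in>circle. g y = ?p \<and> knot_height K x < knot_height K y) \<longleftrightarrow> x = upar ?p"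
    proof
      assume "\<exists>y\<in>circle. g y = ?p \<and> knot_height K x < knot_height K y"
      then obtain y where y: "y \<in> circle" "g y = ?p" "knot_height K x < knot_height K y" by blast
      show "x = upar ?p"
      proof (rule ccontr)
        assume "x \<noteq> upar ?p"
        then have "x = opar ?p" using xs by simp
        then show False using pre[OF y(1,2)] y(3) upar_opar(2)[OF p] by auto
      qed
    next
      assume xu: "x = upar ?p"
      have "opar ?p \<in> circle" "g (opar ?p) = ?p" using opar_in[OF p] by simp_all
      moreover have "knot_height K x < knot_height K (opar ?p)" using upar_opar(2)[OF p] xu by simp
      ultimately show "\<exists>y\<in>circle. g y = ?p \<and> knot_height K x < knot_height K y" by (intro bexI conjI)
    qed
    moreover have "(\<exists>y\<in>circle. g y = ?p \<and> knot_height K y < knot_height K x) \<longleftrightarrow> x = opar ?p"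
    proof
      assume "\<exists>y\<in>circle. g y = ?p \<and> knot_height K y < knot_height K x"
      then obtain y where y: "y \<in> circle" "g y = ?p" "knot_height K y < knot_height K x" by blast
      show "x = opar ?p"
      proof (rule ccontr)
        assume "x \<noteq> opar ?p"
        then have "x = upar ?p" using xs by simp
        then show False using pre[OF y(1,2)] y(3) upar_opar(2)[OF p] by auto
      qed
    next
      assume xo: "x = opar ?p"
      have "upar ?p \<in> circle" "g (upar ?p) = ?p" using upar_in[OF p] by simp_all
      moreover have "knot_height K (upar ?p) < knot_height K x" using upar_opar(2)[OF p] xo by simp
      ultimately show "\<exists>y\<in>circle. g y = ?p \<and> knot_height K y < knot_height K x" by (intro bexI conjI)
    qed
    ultimately show ?thesis by simp
  qed
  moreover have "x \<in> P" if "x \<in> under_params K \<or> x \<in> over_params K" using P_eq that by blast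
  ultimately show "x \<in> under_params K \<longleftrightarrow> x \<in> P \<and> x = upar (g x)"
    "x \<in> over_params K \<longleftrightarrow> x \<in> P \<and> x = opar (g x)" by blast+
qed

lemma upar_ne_opar: "p \<in> crossings K \<Longrightarrow> q \<in> crossings K \<Longrightarrow> upar p \<noteq> opar q"
proof
  assume p: "p \<in> crossings K" "q \<in> crossings K" "upar p = opar q"
  then have "p = q" using upar_in[of p] opar_in[of q] by simp
  then show False using p upar_opar(2)[of p] by simp
qed

lemma P_cases:
  assumes "x \<in> P"
  obtains p where "p \<in> crossings K" "x = upar p" | p where "p \<in> crossings K" "x = opar p"
proof -
  have "g x \<in> crossings K" "x \<in> circle" using assms by (simp_all add: mem_P)
  then have "x = upar (g x) \<or> x = opar (g x)" using upar_opar(1)[of "g x"] by blast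
  then show ?thesis using that \<open>g x \<in> crossings K\<close> by blast
qed

lemma over_iff_nxt_under:
  assumes x: "x \<in> P"
  shows "x \<in> over_params K \<longleftrightarrow> nxt x \<in> under_params K"
proof -
  have "\<forall>x\<in>P. \<forall>t>0. x * cis t \<in> P \<and> (\<forall>s. 0 < s \<and> s < t \<longrightarrow> x * cis s \<notin> P) \<longrightarrow>
    (x \<in> over_params K \<longleftrightarrow> x * cis t \<in> under_params K)"
    using alternating unfolding alternating_diagram_def Let_def P_eq .
  moreover have "x * cis (gap x) \<in> P" using nxt_in[OF x] by (simp add: nxt_def)
  moreover have "\<forall>s. 0 < s \<and> s < gap x \<longrightarrow> x * cis s \<notin> P" using gap_free[OF x] by simp
  ultimately show ?thesis using x gap_pos[OF x] unfolding nxt_def by blast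
qed

lemma nxt_opar: "p \<in> crossings K \<Longrightarrow> \<exists>q\<in>crossings K. nxt (opar p) = upar q"
  and nxt_upar: "p \<in> crossings K \<Longrightarrow> \<exists>q\<in>crossings K. nxt (upar p) = opar q"
proof -
  assume p: "p \<in> crossings K"
  have "opar p \<in> over_params K" using opar_P[OF p] opar_in[OF p] by (simp add: over_iff)
  then have "nxt (opar p) \<in> under_params K" using over_iff_nxt_under[OF opar_P[OF p]] by simp
  then show "\<exists>q\<in>crossings K. nxt (opar p) = upar q"
    unfolding under_iff by (intro bexI[of _ "g (nxt (opar p))"]) (simp_all add: mem_P)
  have "upar p \<notin> over_params K"
    using upar_in[OF p] upar_ne_opar[OF p p] by (simp add: over_iff)
  then have n: "nxt (upar p) \<notin> under_params K" using over_iff_nxt_under[OF upar_P[OF p]] by simp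
  have nP: "nxt (upar p) \<in> P" by (rule nxt_in[OF upar_P[OF p]])
  then show "\<exists>q\<in>crossings K. nxt (upar p) = opar q"
  proof (cases rule: P_cases)
    case (1 q)
    then have "nxt (upar p) \<in> under_params K" unfolding under_iff using nP upar_in[OF 1(1)] by simp
    then show ?thesis using n by simp
  next
    case (2 q)
    then show ?thesis by blast
  qed
qed

abbreviation prv :: "complex \<Rightarrow> complex"
  where "prv \<equiv> inv_into P nxt"

lemma nxt_prv: "x \<in> P \<Longrightarrow> nxt (prv x) = x" and prv_in: "x \<in> P \<Longrightarrow> prv x \<in> P"
  and prv_nxt: "x \<in> P \<Longrightarrow> prv (nxt x) = x"
proof -
  assume x: "x \<in> P"
  show "nxt (prv x) = x" using bij_betw_inv_into_right[OF nxt_bij x] .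
  show "prv x \<in> P" using bij_betw_apply[OF bij_betw_inv_into[OF nxt_bij] x] .
  show "prv (nxt x) = x" using bij_betw_inv_into_left[OF nxt_bij x] .
qed

lemma prv_upar: "p \<in> crossings K \<Longrightarrow> \<exists>q\<in>crossings K. prv (upar p) = opar q"
proof -
  assume p: "p \<in> crossings K"
  have "prv (upar p) \<in> P" by (rule prv_in[OF upar_P[OF p]])
  then show ?thesis
  proof (cases rule: P_cases)
    case (1 q)
    obtain r where "r \<in> crossings K" "nxt (upar q) = opar r" using nxt_upar[OF 1(1)] by blast
    then have "upar p = opar r" using nxt_prv[OF upar_P[OF p]] 1(2) by simp
    then show ?thesis using upar_ne_opar[OF p \<open>r \<in> crossings K\<close>] by simp
  next
    case (2 q)
    then show ?thesis by blast
  qed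
qed

text \<open>
  The crossings before and after the under-passage of \<open>p\<close> along the knot. Since the diagram is alternating, the knot
  passes over there.
\<close>

definition tgt :: "bool \<Rightarrow> complex \<Rightarrow> complex"
  where "tgt a p = (if a then g (nxt (upar p)) else g (prv (upar p)))"

lemma tgt_True: "p \<in> crossings K \<Longrightarrow> tgt True p \<in> crossings K \<and> nxt (upar p) = opar (tgt True p)"
  and tgt_False: "p \<in> crossings K \<Longrightarrow> tgt False p \<in> crossings K \<and> prv (upar p) = opar (tgt False p)"
proof -
  assume p: "p \<in> crossings K"
  obtain q where q: "q \<in> crossings K" "nxt (upar p) = opar q" using nxt_upar[OF p] by blast
  then show "tgt True p \<in> crossings K \<and> nxt (upar p) = opar (tgt True p)"
    using opar_in[OF q(1)] by (simp add: tgt_def)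
  obtain q where q: "q \<in> crossings K" "prv (upar p) = opar q" using prv_upar[OF p] by blast
  then show "tgt False p \<in> crossings K \<and> prv (upar p) = opar (tgt False p)"
    using opar_in[OF q(1)] by (simp add: tgt_def)
qed

lemma finite_crossings: "finite (crossings K)"
  using regular by (simp add: regular_knot_def)

lemma upar_inj: "p \<in> crossings K \<Longrightarrow> q \<in> crossings K \<Longrightarrow> upar p = upar q \<Longrightarrow> p = q"
proof -
  assume p: "p \<in> crossings K" and q: "q \<in> crossings K" and eq: "upar p = upar q"
  have "p = g (upar p)" using upar_in[OF p] by simp
  also have "\<dots> = q" using upar_in[OF q] unfolding eq by simp
  finally show "p = q" .
qed

lemma tgt_bij: "bij_betw (tgt a) (crossings K) (crossings K)"
proof (rule finite_surj_bij[OF finite_crossings])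
  show "tgt a ` crossings K \<subseteq> crossings K" 
  proof (rule image_subsetI)
    fix p assume p: "p \<in> crossings K"
    show "tgt a p \<in> crossings K" using tgt_True[OF p] tgt_False[OF p] by (cases a) simp_all
  qed
  show "inj_on (tgt a) (crossings K)"
  proof (rule inj_onI)
    fix p q assume p: "p \<in> crossings K" and q: "q \<in> crossings K" and eq: "tgt a p = tgt a q"
    have "upar p = upar q"
    proof (cases a)
      case True
      then have "nxt (upar p) = nxt (upar q)" using tgt_True[OF p] tgt_True[OF q] eq by simp
      then have "prv (nxt (upar p)) = prv (nxt (upar q))" by simp
      then show ?thesis by (simp only: prv_nxt[OF upar_P[OF p]] prv_nxt[OF upar_P[OF q]])
    next
      case False
      then have "prv (upar p) = prv (upar q)" using tgt_False[OF p] tgt_False[OF q] eq by simp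
      then have "nxt (prv (upar p)) = nxt (prv (upar q))" by simp
      then show ?thesis by (simp only: nxt_prv[OF upar_P[OF p]] nxt_prv[OF upar_P[OF q]])
    qed
    then show "p = q" by (rule upar_inj[OF p q])
  qed
qed

text \<open>
  The passage that follows the under-passage of \<open>p\<close> is at \<open>tgt True p\<close>. The one that follows the over-passage of
  \<open>p\<close> is at the crossing \<open>q\<close> with \<open>tgt False q = p\<close>, and \<open>q\<close> belongs to \<open>A\<close> since \<open>tgt False\<close> permutes \<open>A\<close>. Hence
  the passages through crossings in \<open>A\<close> are closed under \<open>nxt\<close>, and the knot is a single cycle.
\<close>

lemma crossings_strongly_connected:
  assumes A: "A \<subseteq> crossings K" "A \<noteq> {}" and closed: "\<And>p a. p \<in> A \<Longrightarrow> tgt a p \<in> A"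
  shows "A = crossings K"
proof -
  have finA: "finite A" using A finite_crossings finite_subset by blast
  have "tgt False ` A = A"
  proof (rule endo_inj_surj[OF finA])
    show "tgt False ` A \<subseteq> A" using closed by blast
    show "inj_on (tgt False) A" using tgt_bij[of False] A(1) by (auto simp: bij_betw_def intro: inj_on_subset)
  qed
  note surj = this
  let ?B = "{x \<in> P. g x \<in> A}"
  have "?B = P"
  proof (rule nxt_cycle)
    obtain p where "p \<in> A" using A by blast
    then have "upar p \<in> ?B" using upar_P[of p] upar_in[of p] A by auto
    then show "?B \<noteq> {}" by blast
  next
    fix x assume "x \<in> ?B"
    then have x: "x \<in> P" "g x \<in> A" by auto
    have "g (nxt x) \<in> A" using x(1)
    proof (cases rule: P_cases)
      case (1 p)
      then have "p \<in> A" using x(2) upar_in[OF 1(1)] by simp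
      then have "tgt True p \<in> A" by (rule closed)
      then show ?thesis using 1 by (simp add: tgt_def)
    next
      case (2 p)
      then have "p \<in> A" using x(2) opar_in[OF 2(1)] by simp
      then obtain q where q: "q \<in> A" "tgt False q = p" using surj by (metis imageE)
      then have qc: "q \<in> crossings K" using A by blast
      have "prv (upar q) = x" using tgt_False[OF qc] q(2) 2(2) by simp
      then have "nxt x = upar q" using nxt_prv[OF upar_P[OF qc]] by simp
      then show ?thesis using upar_in[OF qc] q(1) by simp
    qed
    then show "nxt x \<in> ?B" using nxt_in[OF x(1)] by simp
  qed auto
  then show ?thesis
  proof -
    have "p \<in> A" if "p \<in> crossings K" for p
    proof -
      have "upar p \<in> ?B" using upar_P[OF that] \<open>?B = P\<close> by simp
      then show ?thesis using upar_in[OF that] by simp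
    qed
    then show ?thesis using A by blast
  qed
qed

text \<open>
  The midpoint stands for all inner points of the edge, which have the same faces.
\<close>

definition edge_faces :: "complex \<Rightarrow> complex set set"
  where "edge_faces x = {F \<in> faces K. g (x * cis (gap x / 2)) \<in> closure F}"

lemma edge_faces_iff:
  assumes x: "x \<in> P" and F: "F \<in> faces K" and t: "0 < t" "t < gap x"
  shows "F \<in> edge_faces x \<longleftrightarrow> g (x * cis t) \<in> closure F"
proof -
  have half: "0 < gap x / 2" "gap x / 2 < gap x" using gap_pos[OF x] by simp_all
  show ?thesis
    unfolding edge_faces_def using edge_all_or_nothing[OF x F half t] edge_all_or_nothing[OF x F t half] F by blast
qed

text \<open>
  The labelling \<open>c\<close> of the corners is independent of charts: the first argument tells the under half-edge,
  the second one the over half-edge, \<open>True\<close> for the outgoing one.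
\<close>

definition good_corners :: "complex \<Rightarrow> (bool \<Rightarrow> bool \<Rightarrow> complex set) \<Rightarrow> bool"
  where "good_corners p c \<longleftrightarrow>
    (\<forall>a b. c a b \<in> faces K) \<and> (\<forall>a b a' b'. c a b = c a' b' \<longrightarrow> a = a' \<and> b = b') \<and>
    (\<forall>F\<in>faces K. p \<in> closure F \<longleftrightarrow> (\<exists>a b. F = c a b)) \<and>
    edge_faces (upar p) = {c True False, c True True} \<and>
    edge_faces (prv (upar p)) = {c False False, c False True} \<and>
    edge_faces (opar p) = {c False True, c True True} \<and>
    edge_faces (prv (opar p)) = {c False False, c True False}"

lemma edge_faces_out:
  assumes x: "x \<in> P" and d: "0 < d"
    and iff: "\<And>t F. 0 < t \<Longrightarrow> t < d \<Longrightarrow> F \<in> faces K \<Longrightarrow> g (x * cis t) \<in> closure F \<longleftrightarrow> F \<in> A"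
    and A: "A \<subseteq> faces K"
  shows "edge_faces x = A"
proof -
  define t where "t = min d (gap x) / 2"
  have t: "0 < t" "t < d" "t < gap x" using d gap_pos[OF x] by (auto simp: t_def min_def)
  have "F \<in> edge_faces x \<longleftrightarrow> F \<in> A" if F: "F \<in> faces K" for F
    using edge_faces_iff[OF x F t(1,3)] iff[OF t(1,2) F] by simp
  moreover have "edge_faces x \<subseteq> faces K" by (auto simp: edge_faces_def)
  ultimately show ?thesis using A by blast
qed

lemma edge_faces_in:
  assumes x: "x \<in> P" and d: "0 < d"
    and iff: "\<And>t F. 0 < t \<Longrightarrow> t < d \<Longrightarrow> F \<in> faces K \<Longrightarrow> g (x * cis (- t)) \<in> closure F \<longleftrightarrow> F \<in> A"
    and A: "A \<subseteq> faces K"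
  shows "edge_faces (prv x) = A"
proof -
  let ?y = "prv x"
  have y: "?y \<in> P" and yx: "x = ?y * cis (gap ?y)"
    using prv_in[OF x] nxt_prv[OF x] by (simp_all add: nxt_def)
  define t where "t = min d (gap ?y) / 2"
  have t: "0 < t" "t < d" "0 < gap ?y - t" "gap ?y - t < gap ?y"
    using d gap_pos[OF y] by (auto simp: t_def min_def)
  have rot: "x * cis (- t) = ?y * cis (gap ?y - t)"
  proof -
    have "x * cis (- t) = ?y * cis (gap ?y) * cis (- t)" using yx by simp
    then show ?thesis by (simp add: rot_rot)
  qed
  have "F \<in> edge_faces ?y \<longleftrightarrow> F \<in> A" if F: "F \<in> faces K" for F
    using edge_faces_iff[OF y F t(3,4)] iff[OF t(1,2) F] rot by simp
  moreover have "edge_faces ?y \<subseteq> faces K" by (auto simp: edge_faces_def)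
  ultimately show ?thesis using A by blast
qed

lemma obtain_under_chart:
  assumes p: "p \<in> crossings K"
  obtains N h h' X Y where "crossing_chart K p N h h' X Y" "upar p \<in> X" "opar p \<in> Y"
proof -
  obtain N h h' X Y where ch: "crossing_chart K p N h h' X Y" by (rule obtain_chart[OF regular p])
  then interpret crossing_chart K p N h h' X Y .
  obtain x y where xy: "x \<in> X" "y \<in> Y" "{z \<in> circle. g z = p} = {x, y}"
    by (rule preimages) (rule that)
  then have "{upar p, opar p} = {x, y}" using upar_opar(1)[OF p] by simp
  then consider "upar p = x" "opar p = y" | "upar p = y" "opar p = x" by (auto simp: doubleton_eq_iff)
  then show ?thesis
  proof cases
    case 1
    then show ?thesis using that[OF ch] xy by simp
  next
    case 2
    then show ?thesis using that[OF swap] xy by simp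
  qed
qed

lemma good_corners_exist:
  assumes p: "p \<in> crossings K"
  shows "\<exists>c. good_corners p c"
proof -
  obtain N h h' X Y where ch: "crossing_chart K p N h h' X Y" and uX: "upar p \<in> X" and oY: "opar p \<in> Y"
    by (rule obtain_under_chart[OF p])
  interpret crossing_chart K p N h h' X Y by (rule ch)
  have gu: "g (upar p) = p" and go: "g (opar p) = p" using upar_in[OF p] opar_in[OF p] by simp_all
  obtain s r d where d: "0 < d" and iff: "\<And>t F. 0 < t \<Longrightarrow> t < d \<Longrightarrow> F \<in> faces K \<Longrightarrow>
    (g (upar p * cis t) \<in> closure F \<longleftrightarrow> F \<in> {corner_face s False, corner_face s True}) \<and>
    (g (upar p * cis (- t)) \<in> closure F \<longleftrightarrow> F \<in> {corner_face (\<not> s) False, corner_face (\<not> s) True}) \<and>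
    (g (opar p * cis t) \<in> closure F \<longleftrightarrow> F \<in> {corner_face False r, corner_face True r}) \<and>
    (g (opar p * cis (- t)) \<in> closure F \<longleftrightarrow> F \<in> {corner_face False (\<not> r), corner_face True (\<not> r)})"
    by (rule chart_faces[OF uX gu oY go]) (rule that)
  define c where "c a b = corner_face (a = s) (b = r)" for a b
  have cf: "corner_face a b \<in> faces K" for a b by (rule corner_face(1))
  have inj: "a = a' \<and> b = b'" if "c a b = c a' b'" for a b a' b'
    using corner_face_inj[OF reduced p that[unfolded c_def]] by auto
  have center: "p \<in> closure F \<longleftrightarrow> (\<exists>a b. F = c a b)" if F: "F \<in> faces K" for F
  proof -
    have "(\<exists>a b. F = corner_face a b) \<longleftrightarrow> (\<exists>a b. F = c a b)"
      unfolding c_def ex_bool_eq by (cases s; cases r) auto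
    then show ?thesis using closure_face_center[OF F] by simp
  qed
  note iff1 = conjunct1[OF iff] and iff2 = conjunct1[OF conjunct2[OF iff]]
    and iff3 = conjunct1[OF conjunct2[OF conjunct2[OF iff]]]
    and iff4 = conjunct2[OF conjunct2[OF conjunct2[OF iff]]]
  have e1: "edge_faces (upar p) = {corner_face s False, corner_face s True}"
    by (rule edge_faces_out[OF upar_P[OF p] d iff1]) (simp_all add: cf)
  have e2: "edge_faces (prv (upar p)) = {corner_face (\<not> s) False, corner_face (\<not> s) True}"
    by (rule edge_faces_in[OF upar_P[OF p] d iff2]) (simp_all add: cf)
  have e3: "edge_faces (opar p) = {corner_face False r, corner_face True r}"
    by (rule edge_faces_out[OF opar_P[OF p] d iff3]) (simp_all add: cf)
  have e4: "edge_faces (prv (opar p)) = {corner_face False (\<not> r), corner_face True (\<not> r)}"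
    by (rule edge_faces_in[OF opar_P[OF p] d iff4]) (simp_all add: cf)
  have c1: "{corner_face s False, corner_face s True} = {c True False, c True True}"
    unfolding c_def by (cases r) (simp_all add: insert_commute)
  have c2: "{corner_face (\<not> s) False, corner_face (\<not> s) True} = {c False False, c False True}"
    unfolding c_def by (cases s; cases r; simp add: insert_commute)
  have c3: "{corner_face False r, corner_face True r} = {c False True, c True True}"
    unfolding c_def by (cases s) (simp_all add: insert_commute)
  have c4: "{corner_face False (\<not> r), corner_face True (\<not> r)} = {c False False, c True False}"
    unfolding c_def by (cases s; cases r; simp add: insert_commute)
  have cc: "\<forall>a b. c a b \<in> faces K" unfolding c_def using cf by simp
  have ci: "\<forall>a b a' b'. c a b = c a' b' \<longrightarrow> a = a' \<and> b = b'"
    by (intro allI impI) (rule inj)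
  have cn: "\<forall>F\<in>faces K. p \<in> closure F \<longleftrightarrow> (\<exists>a b. F = c a b)"
    by (rule ballI) (rule center)
  have "good_corners p c"
    unfolding good_corners_def
    by (rule conjI[OF cc conjI[OF ci conjI[OF cn conjI[OF e1[unfolded c1]
      conjI[OF e2[unfolded c2] conjI[OF e3[unfolded c3] e4[unfolded c4]]]]]]])
  then show ?thesis by (rule exI[of _ c])
qed

definition cface :: "complex \<Rightarrow> bool \<Rightarrow> bool \<Rightarrow> complex set"
  where "cface p = (SOME c. good_corners p c)"

lemma cface: "p \<in> crossings K \<Longrightarrow> good_corners p (cface p)"
  unfolding cface_def by (rule someI_ex[OF good_corners_exist])

lemma cface_facts:
  assumes p: "p \<in> crossings K"
  shows "cface p a b \<in> faces K" and "cface p a b = cface p a' b' \<Longrightarrow> a = a' \<and> b = b'"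
    and "F \<in> faces K \<Longrightarrow> p \<in> closure F \<longleftrightarrow> (\<exists>a b. F = cface p a b)"
    and "edge_faces (upar p) = {cface p True False, cface p True True}"
    and "edge_faces (prv (upar p)) = {cface p False False, cface p False True}"
    and "edge_faces (opar p) = {cface p False True, cface p True True}"
    and "edge_faces (prv (opar p)) = {cface p False False, cface p True False}"
proof -
  note 1 = cface[OF p, unfolded good_corners_def]
  note 2 = conjunct2[OF 1] and 3 = conjunct2[OF conjunct2[OF 1]]
  note 4 = conjunct2[OF 3]
  note 5 = conjunct2[OF 4]
  note 6 = conjunct2[OF 5]
  show "cface p a b \<in> faces K" using conjunct1[OF 1] by simp
  show "cface p a b = cface p a' b' \<Longrightarrow> a = a' \<and> b = b'" using conjunct1[OF 2] by simp
  show "F \<in> faces K \<Longrightarrow> p \<in> closure F \<longleftrightarrow> (\<exists>a b. F = cface p a b)"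
    using conjunct1[OF 3] by (rule bspec)
  show "edge_faces (upar p) = {cface p True False, cface p True True}" by (rule conjunct1[OF 4])
  show "edge_faces (prv (upar p)) = {cface p False False, cface p False True}" by (rule conjunct1[OF 5])
  show "edge_faces (opar p) = {cface p False True, cface p True True}" by (rule conjunct1[OF 6])
  show "edge_faces (prv (opar p)) = {cface p False False, cface p True False}" by (rule conjunct2[OF 6])
qed

sublocale M: alternating_map "crossings K" tgt cface
proof
  show "finite (crossings K)" by (rule finite_crossings)
  show "crossings K \<noteq> {}" by (rule crossings_ne)
  show "bij_betw (tgt a) (crossings K) (crossings K)" for a by (rule tgt_bij)
  show "a = a' \<and> b = b'" if "c \<in> crossings K" "cface c a b = cface c a' b'" for c a b a' b'
    by (rule cface_facts(2)[OF that])
  show "A = crossings K" if "A \<subseteq> crossings K" "A \<noteq> {}" "\<And>c a. c \<in> A \<Longrightarrow> tgt a c \<in> A" for A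
    by (rule crossings_strongly_connected[OF that])
  fix c a assume c: "c \<in> crossings K"
  show "{cface c a False, cface c a True} = {cface (tgt a c) False (\<not> a), cface (tgt a c) True (\<not> a)}"
  proof (cases a)
    case True
    have t: "tgt True c \<in> crossings K" "nxt (upar c) = opar (tgt True c)" using tgt_True[OF c] by simp_all
    have "prv (opar (tgt True c)) = upar c" using prv_nxt[OF upar_P[OF c]] t(2) by simp
    then show ?thesis using cface_facts(4)[OF c] cface_facts(7)[OF t(1)] True by simp
  next
    case False
    have t: "tgt False c \<in> crossings K" "prv (upar c) = opar (tgt False c)" using tgt_False[OF c] by simp_all
    then show ?thesis using cface_facts(5)[OF c] cface_facts(6)[OF t(1)] False by simp
  qed
qed

text \<open>
  The frontier of a face contains a point of the diagram, hence a whole edge, hence the crossing where this edge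
  starts.
\<close>

lemma face_has_crossing:
  assumes F: "F \<in> faces K"
  shows "\<exists>p\<in>crossings K. p \<in> closure F"
proof -
  have "shadow K \<noteq> {}" by (simp add: shadow_def)
  then have "F \<noteq> UNIV" using face_facts(4)[OF F] by blast
  then have "frontier F \<noteq> {}" using face_facts(3)[OF F] by (simp add: frontier_eq_empty)
  then obtain q where q: "q \<in> frontier F" by blast
  then have qc: "q \<in> closure F" and "q \<in> shadow K" using face_facts(5)[OF F] by (auto simp: frontier_def)
  then obtain z where z: "z \<in> circle" "q = g z" by (auto simp: shadow_def)
  obtain x s where x: "x \<in> P" and s: "0 \<le> s" "s < gap x" "z = x * cis s" by (rule position_exists[OF z(1)])
  have xc: "g x \<in> crossings K" using x by (simp add: mem_P)
  have "g x \<in> closure F"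
  proof (cases "s = 0")
    case True
    then show ?thesis using qc z s by simp
  next
    case False
    then have s0: "0 < s" using s by simp
    have all: "g (x * cis t) \<in> closure F" if "0 < t" "t < gap x" for t
      using edge_all_or_nothing[OF x F s0 s(2) that] qc z(2) s(3) by simp
    have "isCont (\<lambda>t. g (x * cis t)) 0"
      using cont_rot[OF P_in[OF x], of UNIV] by (simp add: continuous_on_eq_continuous_at)
    then have "((\<lambda>t. g (x * cis t)) \<longlongrightarrow> g (x * cis 0)) (at_right 0)"
      unfolding isCont_def by (rule tendsto_mono[OF at_le[OF subset_UNIV]])
    moreover have "\<forall>\<^sub>F t in at_right 0. g (x * cis t) \<in> closure F"
      using gap_pos[OF x] all by (intro eventually_at_rightI[of 0 "gap x"]) auto
    ultimately have "g (x * cis 0) \<in> closure F"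
      by (intro Lim_in_closed_set[of "closure F" _ "at_right 0"]) simp_all
    then show ?thesis by simp
  qed
  then show ?thesis using xc by blast
qed

lemma Fs_eq: "M.Fs = faces K"
proof (rule subset_antisym)
  show "M.Fs \<subseteq> faces K" unfolding M.Fs_def using cface_facts(1) by blast
  show "faces K \<subseteq> M.Fs"
  proof
    fix F assume F: "F \<in> faces K"
    obtain p where p: "p \<in> crossings K" "p \<in> closure F" using face_has_crossing[OF F] by blast
    then obtain a b where "F = cface p a b" using cface_facts(3)[OF p(1) F] by blast
    then show "F \<in> M.Fs" using M.fc_in_Fs[OF p(1)] by simp
  qed
qed

lemma count: "card (crossings K) + 2 \<le> card M.Fs"
  unfolding Fs_eq
proof (rule face_count)
  show "finite (faces K)" using M.finite_Fs by (simp add: Fs_eq)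
  show "card P = 2 * card (crossings K)" unfolding P_def by (rule crossing_parameters(2)[OF regular])
qed

text \<open>
  An infinite set of parameters contains one that is not at a crossing.
\<close>

lemma adjacent_faces_edge:
  assumes adj: "adjacent_faces K F F'"
  obtains c a where "c \<in> crossings K" "M.EF c a = {F, F'}"
proof -
  obtain a J where FF: "F \<in> faces K" "F' \<in> faces K" "F \<noteq> F'" and a: "a \<in> arcs K" and J: "J \<subseteq> a" "infinite J"
    and fr: "g ` J \<subseteq> frontier F \<inter> frontier F'"
    using adj unfolding adjacent_faces_def by blast
  have "a \<subseteq> circle" using a in_components_subset unfolding arcs_def by blast
  obtain z where z: "z \<in> J" "z \<notin> P" using J(2) finite_P by (meson finite_subset subsetI)
  then have zc: "z \<in> circle" using J(1) \<open>a \<subseteq> circle\<close> by blast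
  obtain x s where x: "x \<in> P" and s: "0 \<le> s" "s < gap x" "z = x * cis s" by (rule position_exists[OF zc])
  have "s \<noteq> 0" using z(2) x s(3) by auto
  then have s0: "0 < s" using s by simp
  have clo: "g (x * cis s) \<in> closure F" "g (x * cis s) \<in> closure F'"
    using fr z(1) s(3) by (auto simp: frontier_def)
  then have sub: "{F, F'} \<subseteq> edge_faces x"
    using edge_faces_iff[OF x FF(1) s0 s(2)] edge_faces_iff[OF x FF(2) s0 s(2)] by simp
  obtain c b where c: "c \<in> crossings K" "edge_faces x = M.EF c b"
    using x
  proof (cases rule: P_cases)
    case (1 p)
    then show ?thesis using cface_facts(4)[OF 1(1)] by (intro that[of p True]) (simp_all add: M.EF_def)
  next
    case (2 p)
    obtain q where q: "q \<in> crossings K" "nxt x = upar q" using nxt_opar[OF 2(1)] 2(2) by blast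
    then have "prv (upar q) = x" using prv_nxt[OF x] by simp
    then show ?thesis using cface_facts(5)[OF q(1)] q(1) by (intro that[of q False]) (simp_all add: M.EF_def)
  qed
  have "card (M.EF c b) = 2" using c(1) by (simp add: M.EF_def M.fc_eq_iff)
  then have "{F, F'} = M.EF c b"
    using sub c(2) FF(3) by (intro card_subset_eq) (auto simp: M.EF_def)
  then show ?thesis using that[of c b] c(1) by simp
qed

end

section \<open>Torsion of the Fox coloring module\<close>

lemma free_quotient_coset_eq:
  assumes H: "subgroup H (free_Abelian_group S)"
    and x: "Poly_Mapping.keys x \<subseteq> S" and y: "Poly_Mapping.keys y \<subseteq> S"
  shows "H #>\<^bsub>free_Abelian_group S\<^esub> x = H #>\<^bsub>free_Abelian_group S\<^esub> y \<longleftrightarrow> x - y \<in> H"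
proof -
  let ?G = "free_Abelian_group S"
  interpret G: group ?G by simp
  have c: "x \<in> carrier ?G" "y \<in> carrier ?G" using x y by simp_all
  have "x \<in> H #>\<^bsub>?G\<^esub> y \<longleftrightarrow> x \<otimes>\<^bsub>?G\<^esub> inv\<^bsub>?G\<^esub> y \<in> H"
    by (rule subgroup.rcos_module[OF H _ c(2) c(1)]) simp
  then have m: "x \<in> H #>\<^bsub>?G\<^esub> y \<longleftrightarrow> x - y \<in> H" using y by simp
  show ?thesis
  proof
    assume "H #>\<^bsub>?G\<^esub> x = H #>\<^bsub>?G\<^esub> y"
    then have "x \<in> H #>\<^bsub>?G\<^esub> y" using G.rcos_self[OF c(1) H] by simp
    then show "x - y \<in> H" using m by simp
  next
    assume "x - y \<in> H"
    then have "x \<in> H #>\<^bsub>?G\<^esub> y" using m by simp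
    then show "H #>\<^bsub>?G\<^esub> x = H #>\<^bsub>?G\<^esub> y" using G.repr_independence[OF _ c(2) H] by simp
  qed
qed

lemma torsion_part_free_quotient:
  assumes H: "subgroup H (free_Abelian_group S)"
  shows "torsion_part (free_Abelian_group S Mod H) =
    (\<lambda>x. H #>\<^bsub>free_Abelian_group S\<^esub> x) `
      {x. Poly_Mapping.keys x \<subseteq> S \<and> (\<exists>n::nat. n > 0 \<and> frag_cmul (int n) x \<in> H)}"
proof -
  let ?G = "free_Abelian_group S"
  interpret G: comm_group ?G by (rule abelian_free_Abelian_group)
  interpret N: normal H ?G by (rule G.subgroup_imp_normal[OF H])
  interpret Q: group "?G Mod H" by (rule N.factorgroup_is_group)
  have one: "\<one>\<^bsub>?G Mod H\<^esub> = H" by (simp add: FactGroup_def)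
  have keys: "Poly_Mapping.keys (frag_cmul k x) \<subseteq> S" if "Poly_Mapping.keys x \<subseteq> S" for k x
    using that keys_cmul[of k x] by blast
  have pow: "(H #>\<^bsub>?G\<^esub> x) [^]\<^bsub>?G Mod H\<^esub> n = H #>\<^bsub>?G\<^esub> frag_cmul (int n) x"
    if x: "Poly_Mapping.keys x \<subseteq> S" for x and n :: nat
  proof (induction n)
    case 0
    have "H #>\<^bsub>?G\<^esub> \<one>\<^bsub>?G\<^esub> = H" by (rule G.coset_join2[OF G.one_closed H subgroup.one_closed[OF H]])
    then show ?case by (simp add: one)
  next
    case (Suc n)
    have "frag_cmul (int (Suc n)) x = frag_cmul (int n) x + x"
      by (simp add: frag_cmul_distrib)
    moreover have "(H #>\<^bsub>?G\<^esub> frag_cmul (int n) x) <#>\<^bsub>?G\<^esub> (H #>\<^bsub>?G\<^esub> x) = H #>\<^bsub>?G\<^esub> (frag_cmul (int n) x \<otimes>\<^bsub>?G\<^esub> x)"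
      by (rule N.rcos_sum) (use x keys in simp_all)
    ultimately show ?case using Suc.IH by (simp add: FactGroup_def)
  qed
  have H0: "H = H #>\<^bsub>?G\<^esub> 0"
    using G.coset_join2[OF G.one_closed H subgroup.one_closed[OF H]] by simp
  have one_iff: "H #>\<^bsub>?G\<^esub> x = H \<longleftrightarrow> x \<in> H" if "Poly_Mapping.keys x \<subseteq> S" for x
    using free_quotient_coset_eq[OF H that, of 0] H0 by simp
  have carr: "carrier (?G Mod H) = (\<lambda>x. H #>\<^bsub>?G\<^esub> x) ` {x. Poly_Mapping.keys x \<subseteq> S}"
    by (auto simp: FactGroup_def RCOSETS_def)
  show ?thesis
    unfolding torsion_part_def carr
  proof (intro subset_antisym subsetI)
    fix g assume "g \<in> {g \<in> (\<lambda>x. H #>\<^bsub>?G\<^esub> x) ` {x. Poly_Mapping.keys x \<subseteq> S}.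
      \<exists>n::nat. n > 0 \<and> g [^]\<^bsub>?G Mod H\<^esub> n = \<one>\<^bsub>?G Mod H\<^esub>}"
    then obtain x n where x: "Poly_Mapping.keys x \<subseteq> S" "g = H #>\<^bsub>?G\<^esub> x"
      and n: "(n :: nat) > 0" "g [^]\<^bsub>?G Mod H\<^esub> n = H" unfolding one by blast
    have "frag_cmul (int n) x \<in> H"
      using n(2) unfolding x(2) pow[OF x(1)] one_iff[OF keys[OF x(1)]] .
    then show "g \<in> (\<lambda>x. H #>\<^bsub>?G\<^esub> x) ` {x. Poly_Mapping.keys x \<subseteq> S \<and> (\<exists>n::nat. n > 0 \<and> frag_cmul (int n) x \<in> H)}"
      using x n(1) by blast
  next
    fix g assume "g \<in> (\<lambda>x. H #>\<^bsub>?G\<^esub> x) ` {x. Poly_Mapping.keys x \<subseteq> S \<and> (\<exists>n::nat. n > 0 \<and> frag_cmul (int n) x \<in> H)}"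
    then obtain x n where x: "Poly_Mapping.keys x \<subseteq> S" "g = H #>\<^bsub>?G\<^esub> x"
      and n: "(n :: nat) > 0" "frag_cmul (int n) x \<in> H" by blast
    have "g [^]\<^bsub>?G Mod H\<^esub> n = \<one>\<^bsub>?G Mod H\<^esub>"
      unfolding x(2) pow[OF x(1)] one one_iff[OF keys[OF x(1)]] by (rule n(2))
    then show "g \<in> {g \<in> (\<lambda>x. H #>\<^bsub>?G\<^esub> x) ` {x. Poly_Mapping.keys x \<subseteq> S}.
      \<exists>n::nat. n > 0 \<and> g [^]\<^bsub>?G Mod H\<^esub> n = \<one>\<^bsub>?G Mod H\<^esub>}"
      using x n(1) by blast
  qed
qed

lemma card_image_eq_if:
  assumes "\<And>x y. x \<in> X \<Longrightarrow> y \<in> X \<Longrightarrow> f x = f y \<longleftrightarrow> h x = h y"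
  shows "card (f ` X) = card (h ` X)"
proof (rule bij_betw_same_card)
  define k where "k y = h (SOME x. x \<in> X \<and> f x = y)" for y
  have k: "k (f x) = h x" if x: "x \<in> X" for x
  proof -
    have "(SOME x'. x' \<in> X \<and> f x' = f x) \<in> X \<and> f (SOME x'. x' \<in> X \<and> f x' = f x) = f x"
      by (rule someI[of _ x]) (use x in simp)
    then show ?thesis unfolding k_def using assms x by blast
  qed
  show "bij_betw k (f ` X) (h ` X)"
  proof (rule bij_betw_imageI)
    show "inj_on k (f ` X)"
    proof (rule inj_onI)
      fix y y' assume "y \<in> f ` X" "y' \<in> f ` X" "k y = k y'"
      then obtain x x' where "x \<in> X" "x' \<in> X" "y = f x" "y' = f x'" "k y = k y'" by blast
      then show "y = y'" using k assms by metis
    qed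
    show "k ` f ` X = h ` X" unfolding image_image using k by (intro image_cong) simp_all
  qed
qed

text \<open>
  The relators have coefficient sum \<open>0\<close>, so a torsion element has coefficient sum \<open>0\<close>. Conversely, the
  classes of coefficient sum \<open>0\<close> are finite in number by \<open>fox_index\<close>, so all of them are torsion.
\<close>

lemma (in alternating_map) card_fox_torsion:
  fixes Arc :: "'c \<Rightarrow> 'a"
  assumes count: "card C + 2 \<le> card Fs" and c0: "c0 \<in> C" and Arc: "inj_on Arc C"
  defines "rel c \<equiv> frag_cmul 2 (frag_of (Arc c)) - frag_of (Arc (t False c)) - frag_of (Arc (t True c))"
  shows "card (torsion_part (free_Abelian_group (Arc ` C) Mod generate (free_Abelian_group (Arc ` C)) (rel ` C)))
    = card (face_matchings (Fs - EF c0 a0))"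
proof -
  let ?G = "free_Abelian_group (Arc ` C)"
  define H where "H = generate ?G (rel ` C)"
  interpret G: comm_group ?G by (rule abelian_free_Abelian_group)
  define co where "co x p = Poly_Mapping.lookup x (Arc p)" for x :: "'a \<Rightarrow>\<^sub>0 int" and p
  define comb where "comb \<psi> = (\<Sum>c\<in>C. frag_cmul (\<psi> c) (rel c))" for \<psi>
  have key_frag: "frag_of (Arc c) \<in> carrier ?G" if "c \<in> C" for c using that by simp
  have keys_add: "Poly_Mapping.keys (x + y) \<subseteq> Arc ` C" if "Poly_Mapping.keys x \<subseteq> Arc ` C" "Poly_Mapping.keys y \<subseteq> Arc ` C" for x y :: "'a \<Rightarrow>\<^sub>0 int"
    using G.m_closed[of x y] that by simp
  have keys_diff: "Poly_Mapping.keys (x - y) \<subseteq> Arc ` C" if "Poly_Mapping.keys x \<subseteq> Arc ` C" "Poly_Mapping.keys y \<subseteq> Arc ` C" for x y :: "'a \<Rightarrow>\<^sub>0 int"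
    using that keys_diff[of x y] by blast
  have keys_smul: "Poly_Mapping.keys (frag_cmul k x) \<subseteq> Arc ` C" if "Poly_Mapping.keys x \<subseteq> Arc ` C" for k and x :: "'a \<Rightarrow>\<^sub>0 int"
    using that keys_cmul[of k x] by blast
  have keys_of: "Poly_Mapping.keys (frag_of (Arc c)) \<subseteq> Arc ` C" if "c \<in> C" for c
    using that by simp
  have rel_in: "Poly_Mapping.keys (rel c) \<subseteq> Arc ` C" if "c \<in> C" for c
    unfolding rel_def using that t_in by (intro keys_diff keys_smul keys_of)
  have sub: "subgroup H ?G"
    unfolding H_def by (rule G.generate_is_subgroup) (use rel_in in auto)
  have keys_sum: "Poly_Mapping.keys (\<Sum>c\<in>A. frag_cmul (\<psi> c) (x c)) \<subseteq> Arc ` C"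
    if "finite A" "\<And>c. c \<in> A \<Longrightarrow> Poly_Mapping.keys (x c) \<subseteq> Arc ` C" for A \<psi> and x :: "'c \<Rightarrow> 'a \<Rightarrow>\<^sub>0 int"
    using that
  proof (induction A)
    case (insert c A)
    show ?case
      unfolding sum.insert[OF insert.hyps(1,2)] using insert by (intro keys_add keys_smul) simp_all
  qed simp
  have smul_H: "frag_cmul k x \<in> H" if "x \<in> H" for k x
  proof -
    have "x \<in> carrier ?G" using subgroup.mem_carrier[OF sub that] .
    then have "x [^]\<^bsub>?G\<^esub> k = frag_cmul k x" by simp
    moreover have "x [^]\<^bsub>?G\<^esub> k \<in> H" by (rule G.subgroup_int_pow_closed[OF sub that])
    ultimately show ?thesis by simp
  qed
  have add_H: "x + y \<in> H" if "x \<in> H" "y \<in> H" for x y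
    using subgroup.m_closed[OF sub that] by simp
  have H_eq: "H = range comb"
  proof (rule subset_antisym)
    have "x \<in> range comb" if "x \<in> generate ?G (rel ` C)" for x
      using that
    proof (induction rule: generate.induct)
      case one
      have "comb (\<lambda>_. 0) = 0" by (simp add: comb_def)
      then show ?case by (metis one_free_Abelian_group rangeI)
    next
      case (incl h)
      then obtain c where c: "c \<in> C" "h = rel c" by blast
      have "comb (\<lambda>d. if d = c then 1 else 0) = (\<Sum>d\<in>C. if d = c then rel c else 0)"
        unfolding comb_def by (intro sum.cong) auto
      then have "comb (\<lambda>d. if d = c then 1 else 0) = h" using c finite_C by simp
      then show ?case by (metis rangeI)
    next
      case (inv h)
      then obtain c where c: "c \<in> C" "h = rel c" by blast
      have "comb (\<lambda>d. if d = c then - 1 else 0) = (\<Sum>d\<in>C. if d = c then - rel c else 0)"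
        unfolding comb_def by (intro sum.cong) auto
      then have "comb (\<lambda>d. if d = c then - 1 else 0) = - h" using c finite_C by simp
      moreover have "inv\<^bsub>?G\<^esub> h = - h" using rel_in c by simp
      ultimately show ?case by (metis rangeI)
    next
      case (eng h1 h2)
      then obtain \<psi>1 \<psi>2 where "h1 = comb \<psi>1" "h2 = comb \<psi>2" by blast
      then have "h1 + h2 = comb (\<lambda>c. \<psi>1 c + \<psi>2 c)"
        by (simp add: comb_def frag_cmul_distrib sum.distrib)
      then show ?case by simp
    qed
    then show "H \<subseteq> range comb" unfolding H_def by blast
    have "(\<Sum>c\<in>A. frag_cmul (\<psi> c) (rel c)) \<in> H" if "finite A" "A \<subseteq> C" for A \<psi>
      using that
    proof (induction A)
      case empty
      then show ?case using subgroup.one_closed[OF sub] by simp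
    next
      case (insert c A)
      have "rel c \<in> H" unfolding H_def using insert.prems by (intro generate.incl) blast
      then show ?case using insert by (simp add: add_H smul_H)
    qed
    then show "range comb \<subseteq> H" unfolding comb_def using finite_C by blast
  qed
  have co_of: "co (frag_of (Arc c)) p = (if c = p then 1 else 0)" if "c \<in> C" "p \<in> C" for c p
    using that Arc by (auto simp: co_def dest: inj_onD)
  have co_diff: "co (x - y) p = co x p - co y p" for x y p by (simp add: co_def lookup_minus)
  have co_smul: "co (frag_cmul k x) p = k * co x p" for k x p by (simp add: co_def)
  have co_sum: "co (\<Sum>c\<in>A. frag_cmul (\<psi> c) (x c)) p = (\<Sum>c\<in>A. \<psi> c * co (x c) p)" if "finite A" for A \<psi> p and x :: "'c \<Rightarrow> 'a \<Rightarrow>\<^sub>0 int"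
    using that by (induction A) (simp_all add: co_def lookup_add)
  have co_eq: "x = y" if x: "Poly_Mapping.keys x \<subseteq> Arc ` C" and y: "Poly_Mapping.keys y \<subseteq> Arc ` C"
    and eq: "\<And>p. p \<in> C \<Longrightarrow> co x p = co y p" for x y
  proof (rule poly_mapping_eqI)
    fix k
    show "Poly_Mapping.lookup x k = Poly_Mapping.lookup y k"
    proof (cases "k \<in> Arc ` C")
      case True
      then show ?thesis using eq by (auto simp: co_def)
    next
      case False
      then have "k \<notin> Poly_Mapping.keys x" "k \<notin> Poly_Mapping.keys y" using x y by blast+
      then show ?thesis by (simp add: in_keys_iff)
    qed
  qed
  have sum_pre: "(\<Sum>c\<in>C. \<psi> c * (if t a c = p then 1 else 0)) = \<psi> (pre a p)" if p: "p \<in> C" for \<psi> :: "'c \<Rightarrow> int" and a p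
  proof -
    have "(\<Sum>c\<in>C. \<psi> c * (if t a c = p then 1 else 0)) = (\<Sum>c\<in>C. if c = pre a p then \<psi> (pre a p) else 0)"
      using p by (intro sum.cong refl) auto
    then show ?thesis using pre_in[OF p] finite_C by simp
  qed
  have co_comb: "co (comb \<psi>) p = fox_combination \<psi> p" if p: "p \<in> C" for \<psi> p
  proof -
    have "co (comb \<psi>) p = (\<Sum>c\<in>C. \<psi> c * co (rel c) p)" unfolding comb_def by (rule co_sum[OF finite_C])
    also have "\<dots> = (\<Sum>c\<in>C. 2 * (\<psi> c * (if c = p then 1 else 0)) - \<psi> c * (if t False c = p then 1 else 0)
        - \<psi> c * (if t True c = p then 1 else 0))"
      by (intro sum.cong refl) (simp add: rel_def co_diff co_smul co_of[OF _ p] t_in right_diff_distrib)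
    also have "\<dots> = 2 * (\<Sum>c\<in>C. \<psi> c * (if c = p then 1 else 0)) - \<psi> (pre False p) - \<psi> (pre True p)"
      by (simp only: sum_subtractf sum_pre[OF p] sum_distrib_left)
    also have "(\<Sum>c\<in>C. \<psi> c * (if c = p then 1 else 0)) = (\<Sum>c\<in>C. if c = p then \<psi> p else 0)"
      by (intro sum.cong refl) simp
    also have "\<dots> = \<psi> p" using p finite_C by simp
    finally show ?thesis by (simp add: fox_combination_def)
  qed
  have comb_in: "Poly_Mapping.keys (comb \<psi>) \<subseteq> Arc ` C" for \<psi>
    unfolding comb_def by (rule keys_sum[OF finite_C rel_in])
  have mem_H: "x \<in> H \<longleftrightarrow> (\<exists>\<psi>. \<forall>p\<in>C. co x p = fox_combination \<psi> p)" if x: "Poly_Mapping.keys x \<subseteq> Arc ` C" for x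
  proof
    assume "x \<in> H"
    then obtain \<psi> where "x = comb \<psi>" unfolding H_eq by blast
    then show "\<exists>\<psi>. \<forall>p\<in>C. co x p = fox_combination \<psi> p" using co_comb by blast
  next
    assume "\<exists>\<psi>. \<forall>p\<in>C. co x p = fox_combination \<psi> p"
    then obtain \<psi> where psi: "\<forall>p\<in>C. co x p = fox_combination \<psi> p" by blast
    have "x = comb \<psi>" by (rule co_eq[OF x comb_in]) (simp add: psi co_comb)
    then show "x \<in> H" unfolding H_eq by blast
  qed
  have sum_fox: "(\<Sum>p\<in>C. fox_combination \<psi> p) = 0" for \<psi>
  proof -
    have "(\<Sum>p\<in>C. \<psi> (pre a p)) = (\<Sum>p\<in>C. \<psi> p)" for a
      by (rule sum.reindex_bij_betw[OF bij_betw_inv_into[OF t_bij]])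
    then show ?thesis by (simp add: fox_combination_def sum_subtractf sum_distrib_left[symmetric])
  qed
  obtain red :: "('c \<Rightarrow> int) \<Rightarrow> nat \<Rightarrow> int"
    where red: "\<And>g g'. sum g C = 0 \<Longrightarrow> sum g' C = 0 \<Longrightarrow>
      red g = red g' \<longleftrightarrow> (\<exists>\<psi>. \<forall>c\<in>C. g c - g' c = fox_combination \<psi> c)"
    and fin: "finite (red ` {g. sum g C = 0})"
    and card: "card (red ` {g. sum g C = 0}) = card (face_matchings (Fs - EF c0 a0))"
    by (rule fox_index[OF count c0]) (rule that)
  let ?X = "{x. Poly_Mapping.keys x \<subseteq> Arc ` C \<and> (\<exists>n::nat. n > 0 \<and> frag_cmul (int n) x \<in> H)}"
  have X_iff: "(\<exists>n::nat. n > 0 \<and> frag_cmul (int n) x \<in> H) \<longleftrightarrow> sum (co x) C = 0"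
    if x: "Poly_Mapping.keys x \<subseteq> Arc ` C" for x
  proof
    assume "\<exists>n::nat. n > 0 \<and> frag_cmul (int n) x \<in> H"
    then obtain n :: nat where n: "n > 0" "frag_cmul (int n) x \<in> H" by blast
    then obtain \<psi> where psi: "\<forall>p\<in>C. co (frag_cmul (int n) x) p = fox_combination \<psi> p"
      using mem_H[OF keys_smul[OF x]] by blast
    have "int n * sum (co x) C = (\<Sum>p\<in>C. co (frag_cmul (int n) x) p)"
      by (simp add: co_smul sum_distrib_left)
    also have "\<dots> = (\<Sum>p\<in>C. fox_combination \<psi> p)" using psi by (intro sum.cong refl) simp
    also have "\<dots> = 0" by (rule sum_fox)
    finally show "sum (co x) C = 0" using n(1) by simp
  next
    assume z: "sum (co x) C = 0"
    have zk: "sum (\<lambda>p. int k * co x p) C = 0" for k using z by (simp add: sum_distrib_left[symmetric])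
    let ?f = "\<lambda>k::nat. red (\<lambda>p. int k * co x p)"
    have "range ?f \<subseteq> red ` {g. sum g C = 0}" using zk by blast
    then have "finite (range ?f)" using fin finite_subset by blast
    then have "\<not> inj ?f" using finite_imageD infinite_UNIV_nat by blast
    have "\<exists>k l. ?f k = ?f l \<and> k < l"
    proof (rule ccontr)
      assume no: "\<not> (\<exists>k l. ?f k = ?f l \<and> k < l)"
      have "inj ?f" by (rule linorder_injI) (use no in blast)
      then show False using \<open>\<not> inj ?f\<close> by simp
    qed
    then obtain k l where kl: "?f k = ?f l" "k < l" by blast
    then obtain \<psi> where psi: "\<forall>p\<in>C. int l * co x p - int k * co x p = fox_combination \<psi> p"
      using red[OF zk[of l] zk[of k]] by auto
    have "co (frag_cmul (int (l - k)) x) p = fox_combination \<psi> p" if "p \<in> C" for p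
      using psi that kl(2) by (simp add: co_smul of_nat_diff algebra_simps)
    then have "frag_cmul (int (l - k)) x \<in> H" using mem_H[OF keys_smul[OF x]] by blast
    then show "\<exists>n::nat. n > 0 \<and> frag_cmul (int n) x \<in> H" using kl(2) by (intro exI[of _ "l - k"]) simp
  qed
  have "torsion_part (?G Mod H) = (\<lambda>x. H #>\<^bsub>?G\<^esub> x) ` ?X"
    by (rule torsion_part_free_quotient[OF sub])
  also have "card \<dots> = card ((\<lambda>x. red (co x)) ` ?X)"
  proof (rule card_image_eq_if)
    fix x y assume "x \<in> ?X" "y \<in> ?X"
    then have x: "Poly_Mapping.keys x \<subseteq> Arc ` C" "sum (co x) C = 0"
      and y: "Poly_Mapping.keys y \<subseteq> Arc ` C" "sum (co y) C = 0" using X_iff by blast+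
    have "H #>\<^bsub>?G\<^esub> x = H #>\<^bsub>?G\<^esub> y \<longleftrightarrow> x - y \<in> H" by (rule free_quotient_coset_eq[OF sub x(1) y(1)])
    also have "\<dots> \<longleftrightarrow> (\<exists>\<psi>. \<forall>p\<in>C. co x p - co y p = fox_combination \<psi> p)"
      unfolding mem_H[OF keys_diff[OF x(1) y(1)]] co_diff ..
    also have "\<dots> \<longleftrightarrow> red (co x) = red (co y)" by (rule red[OF x(2) y(2), symmetric])
    finally show "H #>\<^bsub>?G\<^esub> x = H #>\<^bsub>?G\<^esub> y \<longleftrightarrow> red (co x) = red (co y)" .
  qed
  also have "(\<lambda>x. red (co x)) ` ?X = red ` {g. sum g C = 0}"
  proof (intro subset_antisym subsetI)
    fix r assume "r \<in> (\<lambda>x. red (co x)) ` ?X"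
    then obtain x where "Poly_Mapping.keys x \<subseteq> Arc ` C" "\<exists>n::nat. n > 0 \<and> frag_cmul (int n) x \<in> H" "r = red (co x)" by blast
    then show "r \<in> red ` {g. sum g C = 0}" using X_iff by blast
  next
    fix r assume "r \<in> red ` {g. sum g C = 0}"
    then obtain g where g: "sum g C = 0" "r = red g" by blast
    define x where "x = (\<Sum>c\<in>C. frag_cmul (g c) (frag_of (Arc c)))"
    have xk: "Poly_Mapping.keys x \<subseteq> Arc ` C" unfolding x_def by (rule keys_sum[OF finite_C keys_of])
    have cx: "co x p = g p" if p: "p \<in> C" for p
    proof -
      have "co x p = (\<Sum>c\<in>C. g c * co (frag_of (Arc c)) p)" unfolding x_def by (rule co_sum[OF finite_C])
      also have "\<dots> = (\<Sum>c\<in>C. if c = p then g p else 0)" using p by (intro sum.cong refl) (simp add: co_of)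
      finally show ?thesis using p finite_C by simp
    qed
    have s: "sum (co x) C = 0" using g(1) cx by simp
    have "\<forall>c\<in>C. co x c - g c = fox_combination (\<lambda>_. 0) c" using cx by (simp add: fox_combination_def)
    then have "red (co x) = red g" using red[OF s g(1)] by blast
    moreover have "x \<in> ?X" using X_iff[OF xk] xk s by blast
    ultimately show "r \<in> (\<lambda>x. red (co x)) ` ?X" using g(2) by (intro image_eqI[of _ _ x]) simp_all
  qed
  finally show ?thesis unfolding H_def using card by simp
qed

section \<open>Dimer coverings and arcs\<close>

context alternating_knot
begin

lemma crossing_frontier_iff:
  assumes p: "p \<in> crossings K" and F: "F \<in> faces K"
  shows "p \<in> frontier F \<longleftrightarrow> (\<exists>a b. F = cface p a b)"
proof -
  have "p \<in> shadow K" using imageI[of "upar p" circle g] upar_in[OF p] by (simp add: shadow_def)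
  then show ?thesis using frontier_face[OF F] cface_facts(3)[OF p F] by simp
qed

text \<open>
  A dimer covering is the graph of a bijection between its two sides.
\<close>

lemma card_dimer_coverings:
  assumes W: "W \<subseteq> faces K"
  shows "card (dimer_coverings (overlaid_graph K W)) = card (M.face_matchings W)"
proof -
  let ?C = "crossings K"
  define e :: "complex \<Rightarrow> complex set \<Rightarrow> (complex + complex set) set" where "e x y = {Inl x, Inr y}" for x y
  define I where "I x y \<longleftrightarrow> x \<in> ?C \<and> y \<in> W \<and> (\<exists>a b. y = cface x a b)" for x y
  have e_eq: "e x y = e x' y' \<longleftrightarrow> x = x' \<and> y = y'" for x y x' y'
    by (auto simp: e_def doubleton_eq_iff)
  have e_Inl: "Inl x \<in> e x' y \<longleftrightarrow> x = x'" and e_Inr: "Inr y \<in> e x y' \<longleftrightarrow> y = y'" for x x' y y'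
    by (auto simp: e_def)
  have edges: "snd (overlaid_graph K W) = {e x y | x y. I x y}"
  proof -
    have "(x \<in> ?C \<and> y \<in> W \<and> x \<in> frontier y) = I x y" for x y
      unfolding I_def using crossing_frontier_iff[of x y] W by (metis subsetD)
    then show ?thesis unfolding overlaid_graph_def e_def by simp
  qed
  have verts: "fst (overlaid_graph K W) = Inl ` ?C \<union> Inr ` W"
    by (simp add: overlaid_graph_def)
  have dimer_iff: "D \<in> dimer_coverings (overlaid_graph K W) \<longleftrightarrow>
    D \<subseteq> {e x y | x y. I x y} \<and> (\<forall>x\<in>?C. \<exists>!d. d \<in> D \<and> Inl x \<in> d) \<and> (\<forall>y\<in>W. \<exists>!d. d \<in> D \<and> Inr y \<in> d)" for D
    unfolding dimer_coverings_def edges verts by (simp add: ball_Un)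
  define \<Phi> where "\<Phi> m = (\<lambda>x. e x (m x)) ` ?C" for m
  have "bij_betw \<Phi> (M.face_matchings W) (dimer_coverings (overlaid_graph K W))"
  proof (rule bij_betw_imageI)
    show "inj_on \<Phi> (M.face_matchings W)"
    proof (rule inj_onI)
      fix m m' assume m: "m \<in> M.face_matchings W" "m' \<in> M.face_matchings W" and eq: "\<Phi> m = \<Phi> m'"
      have ext: "m \<in> extensional ?C" "m' \<in> extensional ?C" using m by (simp_all add: M.face_matchings_def)
      show "m = m'"
      proof (rule extensionalityI[OF ext])
        fix x assume "x \<in> ?C"
        then have "e x (m x) \<in> \<Phi> m" unfolding \<Phi>_def by (rule image_eqI[OF refl])
        then have "e x (m x) \<in> \<Phi> m'" unfolding eq .
        then obtain x' where "e x (m x) = e x' (m' x')" unfolding \<Phi>_def by blast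
        then show "m x = m' x" unfolding e_eq by auto
      qed
    qed
    show "\<Phi> ` M.face_matchings W = dimer_coverings (overlaid_graph K W)"
    proof (intro subset_antisym subsetI)
      fix D assume "D \<in> \<Phi> ` M.face_matchings W"
      then obtain m where m: "m \<in> M.face_matchings W" and D: "D = \<Phi> m" by blast
      have bij: "bij_betw m ?C W" and inc: "\<And>x. x \<in> ?C \<Longrightarrow> \<exists>a b. m x = cface x a b"
        using m by (simp_all add: M.face_matchings_def)
      have mI: "I x (m x)" if "x \<in> ?C" for x
        using that inc[OF that] bij_betw_apply[OF bij that] by (simp add: I_def)
      show "D \<in> dimer_coverings (overlaid_graph K W)"
        unfolding dimer_iff
      proof (intro conjI ballI)
        show "D \<subseteq> {e x y | x y. I x y}" unfolding D \<Phi>_def using mI by blast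
      next
        fix x assume x: "x \<in> ?C"
        show "\<exists>!d. d \<in> D \<and> Inl x \<in> d"
        proof (rule ex1I[of _ "e x (m x)"])
          show "e x (m x) \<in> D \<and> Inl x \<in> e x (m x)" unfolding D \<Phi>_def e_Inl using x by simp
          fix d assume "d \<in> D \<and> Inl x \<in> d"
          then obtain x' where "d = e x' (m x')" "Inl x \<in> e x' (m x')" unfolding D \<Phi>_def by blast
          then show "d = e x (m x)" unfolding e_Inl by simp
        qed
      next
        fix y assume "y \<in> W"
        then obtain x where x: "x \<in> ?C" "y = m x" using bij unfolding bij_betw_def by blast
        show "\<exists>!d. d \<in> D \<and> Inr y \<in> d"
        proof (rule ex1I[of _ "e x (m x)"])
          show "e x (m x) \<in> D \<and> Inr y \<in> e x (m x)" unfolding D \<Phi>_def e_Inr using x by simp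
          fix d assume "d \<in> D \<and> Inr y \<in> d"
          then obtain x' where x': "x' \<in> ?C" "d = e x' (m x')" "Inr y \<in> e x' (m x')" unfolding D \<Phi>_def by blast
          then have "m x = m x'" using x(2) unfolding e_Inr by simp
          then have "x = x'" by (rule inj_onD[OF bij_betw_imp_inj_on[OF bij] _ x(1) x'(1)])
          then show "d = e x (m x)" using x'(2) by simp
        qed
      qed
    next
      fix D assume "D \<in> dimer_coverings (overlaid_graph K W)"
      then have sub: "D \<subseteq> {e x y | x y. I x y}" and exC: "\<And>x. x \<in> ?C \<Longrightarrow> \<exists>!d. d \<in> D \<and> Inl x \<in> d"
        and exW: "\<And>y. y \<in> W \<Longrightarrow> \<exists>!d. d \<in> D \<and> Inr y \<in> d" unfolding dimer_iff by simp_all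
      have form: "\<exists>x y. d = e x y \<and> I x y" if "d \<in> D" for d using sub that by blast
      have exm: "\<exists>y. e x y \<in> D" if x: "x \<in> ?C" for x
      proof -
        obtain d where d: "d \<in> D" "Inl x \<in> d" using exC[OF x] by (elim ex1E conjE) (rule that)
        obtain x' y where xy: "d = e x' y" using form[OF d(1)] by (elim exE conjE) (rule that)
        then have "x' = x" using d(2) unfolding xy e_Inl by simp
        then show ?thesis using d(1) xy by (intro exI[of _ y]) simp
      qed
      define m where "m = restrict (\<lambda>x. SOME y. e x y \<in> D) ?C"
      have mD: "e x (m x) \<in> D" if "x \<in> ?C" for x
        using someI_ex[OF exm[OF that]] that by (simp add: m_def)
      have mI: "I x (m x)" if "x \<in> ?C" for x
      proof -
        have "\<exists>x' y. e x (m x) = e x' y \<and> I x' y" by (rule form[OF mD[OF that]])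
        then show ?thesis unfolding e_eq by auto
      qed
      have inj: "inj_on m ?C"
      proof (rule inj_onI)
        fix x x' assume x: "x \<in> ?C" "x' \<in> ?C" and eq: "m x = m x'"
        have "m x \<in> W" using mI[OF x(1)] by (simp add: I_def)
        from exW[OF this] have "e x (m x) = e x' (m x')"
          by (rule ex1E) (metis mD[OF x(1)] mD[OF x(2)] eq e_Inr)
        then show "x = x'" unfolding e_eq by simp
      qed
      have onto: "m ` ?C = W"
      proof (rule subset_antisym)
        show "m ` ?C \<subseteq> W" using mI by (intro image_subsetI) (simp add: I_def)
        show "W \<subseteq> m ` ?C"
        proof
          fix y assume y: "y \<in> W"
          obtain d where d: "d \<in> D" "Inr y \<in> d" using exW[OF y] by (elim ex1E conjE) (rule that)
          obtain x y' where xy: "d = e x y'" "I x y'" using form[OF d(1)] by (elim exE conjE) (rule that)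
          have y': "y' = y" using d(2) unfolding xy(1) e_Inr by simp
          have x: "x \<in> ?C" using xy(2) by (simp add: I_def)
          have "Inl x \<in> e x y" "Inl x \<in> e x (m x)" by (simp_all add: e_Inl)
          then have "e x y = e x (m x)" using exC[OF x] mD[OF x] d(1) xy(1) y' by (elim ex1E) metis
          then have "y = m x" unfolding e_eq by simp
          then show "y \<in> m ` ?C" using x by simp
        qed
      qed
      have "m \<in> M.face_matchings W"
        unfolding M.face_matchings_def using inj onto mI by (simp add: bij_betw_def I_def m_def)
      moreover have "D = \<Phi> m"
      proof (rule subset_antisym)
        show "\<Phi> m \<subseteq> D" unfolding \<Phi>_def using mD by (intro image_subsetI)
        show "D \<subseteq> \<Phi> m"
        proof
          fix d assume d: "d \<in> D"
          obtain x y where xy: "d = e x y" "I x y" using form[OF d] by (elim exE conjE) (rule that)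
          have x: "x \<in> ?C" using xy(2) by (simp add: I_def)
          have "Inl x \<in> d" "Inl x \<in> e x (m x)" unfolding xy(1) by (simp_all add: e_Inl)
          then have "d = e x (m x)" using exC[OF x] mD[OF x] d by (elim ex1E) metis
          then show "d \<in> \<Phi> m" unfolding \<Phi>_def using x by simp
        qed
      qed
      ultimately show "D \<in> \<Phi> ` M.face_matchings W" by simp
    qed
  qed
  then show ?thesis by (rule bij_betw_same_card[symmetric])
qed

lemma tgt_preimage:
  assumes q: "q \<in> crossings K"
  obtains p where "p \<in> crossings K" "tgt True p = q"
proof -
  have "q \<in> tgt True ` crossings K" using q bij_betw_imp_surj_on[OF tgt_bij[of True]] by simp
  then show ?thesis by (elim imageE) (rule that, simp_all)
qed

text \<open>
  The arc that starts at the under-passage of \<open>p\<close>. As the diagram is alternating, it consists of two edges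
  with one over-passage between them.
\<close>

definition under_arc :: "complex \<Rightarrow> complex set"
  where "under_arc p = circle_arc (upar p) {0<..<gap (upar p) + gap (nxt (upar p))}"

lemma under_arc_base:
  assumes p: "p \<in> crossings K" and z: "z \<in> under_arc p"
  obtains x s where "x = upar p \<and> 0 < s \<or> x = opar (tgt True p)" "0 \<le> s" "s < gap x" "z = x * cis s"
proof -
  obtain t where t: "0 < t" "t < gap (upar p) + gap (nxt (upar p))" "z = upar p * cis t"
    using z by (auto simp: under_arc_def circle_arc_def)
  show ?thesis
  proof (cases "t < gap (upar p)")
    case True
    then show ?thesis using t by (intro that[of "upar p" t]) auto
  next
    case False
    have "z = nxt (upar p) * cis (t - gap (upar p))" using t(3) by (simp add: nxt_def rot_rot)
    then show ?thesis using t False tgt_True[OF p] by (intro that[of "nxt (upar p)" "t - gap (upar p)"]) auto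
  qed
qed

lemma under_arc_first: "p \<in> crossings K \<Longrightarrow> 0 < t \<Longrightarrow> t < gap (upar p) \<Longrightarrow> upar p * cis t \<in> under_arc p"
  using gap_pos[OF nxt_in[OF upar_P[of p]]] unfolding under_arc_def circle_arc_def by (intro imageI) simp

lemma under_arc_second:
  assumes p: "p \<in> crossings K" and t: "0 \<le> t" "t < gap (opar (tgt True p))"
  shows "opar (tgt True p) * cis t \<in> under_arc p"
proof -
  have n: "nxt (upar p) = opar (tgt True p)" using tgt_True[OF p] by simp
  have "opar (tgt True p) * cis t = upar p * cis (gap (upar p) + t)"
    unfolding n[symmetric] by (simp add: nxt_def rot_rot)
  moreover have "gap (upar p) + t \<in> {0<..<gap (upar p) + gap (nxt (upar p))}"
    using gap_pos[OF upar_P[OF p]] t n by simp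
  ultimately show ?thesis unfolding under_arc_def circle_arc_def by (metis imageI)
qed

text \<open>
  The under-passage where the arc starts is not met again before the arc ends.
\<close>

lemma under_arc_length:
  assumes p: "p \<in> crossings K"
  shows "gap (upar p) + gap (nxt (upar p)) \<le> 2 * pi"
proof (rule ccontr)
  let ?u = "upar p" and ?o = "nxt (upar p)"
  assume "\<not> ?thesis"
  then have lt: "2 * pi - gap ?u < gap ?o" by simp
  have uP: "?u \<in> P" and oP: "?o \<in> P" using upar_P[OF p] nxt_in by blast+
  have u: "?o * cis (2 * pi - gap ?u) = ?u" by (simp add: nxt_def rot_rot)
  have "?o \<noteq> ?u" using tgt_True[OF p] upar_ne_opar[OF p, of "tgt True p"] by auto
  have "0 \<le> 2 * pi - gap ?u" using gap_le[OF uP] by simp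
  moreover have "2 * pi - gap ?u \<noteq> 0"
  proof
    assume "2 * pi - gap ?u = 0"
    then have "?o = ?u" using u by simp
    then show False using \<open>?o \<noteq> ?u\<close> by simp
  qed
  ultimately have "0 < 2 * pi - gap ?u" by simp
  then have "?u \<notin> P" using gap_free[OF oP _ lt] u by simp
  then show False using uP by simp
qed

lemma arcs_eq: "arcs K = under_arc ` crossings K"
  and under_arc_disjoint: "p \<in> crossings K \<Longrightarrow> q \<in> crossings K \<Longrightarrow> z \<in> under_arc p \<Longrightarrow> z \<in> under_arc q \<Longrightarrow> p = q"
proof -
  show disj: "p = q" if p: "p \<in> crossings K" and q: "q \<in> crossings K" and z: "z \<in> under_arc p" "z \<in> under_arc q" for p q z
  proof -
    obtain x s where x: "x = upar p \<and> 0 < s \<or> x = opar (tgt True p)" and s: "0 \<le> s" "s < gap x" "z = x * cis s"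
      by (rule under_arc_base[OF p z(1)])
    obtain y t where y: "y = upar q \<and> 0 < t \<or> y = opar (tgt True q)" and t: "0 \<le> t" "t < gap y" "z = y * cis t"
      by (rule under_arc_base[OF q z(2)])
    have tp: "tgt True p \<in> crossings K" "tgt True q \<in> crossings K" using tgt_True p q by simp_all
    have xP: "x \<in> P" "y \<in> P" using x y upar_P opar_P p q tp by auto
    have "x = y" using position_unique[OF xP _ s(1,2) t(1,2)] s(3) t(3) by simp
    then consider "upar p = upar q" | "opar (tgt True p) = opar (tgt True q)"
      using x y upar_ne_opar[OF p tp(2)] upar_ne_opar[OF q tp(1)] by auto
    then show "p = q"
    proof cases
      case 1
      then show ?thesis by (rule upar_inj[OF p q])
    next
      case 2
      have "g (opar (tgt True p)) = g (opar (tgt True q))" using 2 by simp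
      then have "tgt True p = tgt True q" using opar_in[OF tp(1)] opar_in[OF tp(2)] by simp
      then show ?thesis by (rule inj_onD[OF bij_betw_imp_inj_on[OF tgt_bij[of True]] _ p q])
    qed
  qed
  have not_under: "z \<notin> under_params K" if p: "p \<in> crossings K" and z: "z \<in> under_arc p" for p z
  proof
    assume u: "z \<in> under_params K"
    then have zP: "z \<in> P" using under_iff by simp
    obtain x s where x: "x = upar p \<and> 0 < s \<or> x = opar (tgt True p)" and s: "0 \<le> s" "s < gap x" "z = x * cis s"
      by (rule under_arc_base[OF p z])
    have tp: "tgt True p \<in> crossings K" using tgt_True p by simp
    have xP: "x \<in> P" using x upar_P[OF p] opar_P[OF tp] by auto
    have "\<not> 0 < s" using gap_free[OF xP _ s(2)] zP s(3) by auto
    then have "z = opar (tgt True p)" using x s by auto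
    moreover have "z = upar (g z)" "g z \<in> crossings K" using u zP by (simp_all add: under_iff mem_P)
    ultimately show False using upar_ne_opar[OF _ tp, of "g z"] by simp
  qed
  show "arcs K = under_arc ` crossings K"
    unfolding arcs_def
  proof (rule components_of_partition)
    show cover: "circle - under_params K = (\<Union>p\<in>crossings K. under_arc p)"
    proof (intro subset_antisym subsetI)
      fix z assume z: "z \<in> circle - under_params K"
      then have zc: "z \<in> circle" by simp
      obtain x s where x: "x \<in> P" and s: "0 \<le> s" "s < gap x" "z = x * cis s" by (rule position_exists[OF zc])
      from x show "z \<in> (\<Union>p\<in>crossings K. under_arc p)"
      proof (cases rule: P_cases)
        case (1 p)
        have "s \<noteq> 0"
        proof
          assume "s = 0"
          then have "z = upar p" using s(3) 1(2) by simp
          then have "z \<in> under_params K" using upar_P[OF 1(1)] upar_in[OF 1(1)] by (simp add: under_iff)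
          then show False using z by simp
        qed
        then have "z \<in> under_arc p" using under_arc_first[OF 1(1), of s] s 1(2) by simp
        then show ?thesis by (rule UN_I[OF 1(1)])
      next
        case (2 q)
        obtain p where p: "p \<in> crossings K" "tgt True p = q"
          by (rule tgt_preimage[OF 2(1)])
        then have "z \<in> under_arc p" using under_arc_second[OF p(1), of s] s 2(2) by simp
        then show ?thesis by (rule UN_I[OF p(1)])
      qed
    next
      fix z assume "z \<in> (\<Union>p\<in>crossings K. under_arc p)"
      then obtain p where p: "p \<in> crossings K" "z \<in> under_arc p" by (rule UN_E) (rule that)
      have "under_arc p \<subseteq> circle" unfolding under_arc_def using upar_in[OF p(1)] by (intro circle_arc_subset) simp
      then show "z \<in> circle - under_params K" using p(2) not_under[OF p] by (simp add: subset_iff)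
    qed
    fix p assume p: "p \<in> crossings K"
    have uP: "upar p \<in> P" by (rule upar_P[OF p])
    have pos: "0 < gap (upar p) + gap (nxt (upar p))" using gap_pos[OF uP] gap_pos[OF nxt_in[OF uP]] by simp
    have "openin (top_of_set circle) (under_arc p)"
      unfolding under_arc_def using upar_in[OF p] pos under_arc_length[OF p] by (intro openin_circle_arc) simp_all
    then show "openin (top_of_set (circle - under_params K)) (under_arc p)"
      by (rule openin_subset_trans) (use cover p in blast)+
    show "connected (under_arc p)" unfolding under_arc_def by (rule connected_circle_arc) (simp add: is_interval_convex)
    show "under_arc p \<noteq> {}" unfolding under_arc_def circle_arc_def using pos by simp
    fix q assume q: "q \<in> crossings K" "p \<noteq> q"
    then show "under_arc p \<inter> under_arc q = {}" using disj[OF p q(1)] by blast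
  qed
qed

text \<open>
  The unique arc that passes over \<open>p\<close>.
\<close>

definition over_arc :: "complex \<Rightarrow> complex set"
  where "over_arc p = under_arc (inv_into (crossings K) (tgt True) p)"

lemma over_arc_tgt: "p \<in> crossings K \<Longrightarrow> over_arc (tgt True p) = under_arc p"
  unfolding over_arc_def using bij_betw_inv_into_left[OF tgt_bij, of p True] by simp

lemma over_arc_image: "over_arc ` crossings K = arcs K"
proof -
  have "inv_into (crossings K) (tgt True) ` crossings K = crossings K"
    using bij_betw_inv_into[OF tgt_bij[of True]] by (simp add: bij_betw_def)
  then show ?thesis unfolding arcs_eq over_arc_def by (metis image_image)
qed

lemma arc_unique: "a \<in> arcs K \<Longrightarrow> b \<in> arcs K \<Longrightarrow> z \<in> a \<Longrightarrow> z \<in> b \<Longrightarrow> a = b"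
  unfolding arcs_eq using under_arc_disjoint by blast

lemma under_arc_ne: "p \<in> crossings K \<Longrightarrow> under_arc p \<noteq> {}"
  using arcs_eq in_components_nonempty unfolding arcs_def by blast

lemma over_arc_inj: "inj_on over_arc (crossings K)"
proof (rule inj_onI)
  fix p q assume p: "p \<in> crossings K" and q: "q \<in> crossings K" and eq: "over_arc p = over_arc q"
  obtain p' where p': "p' \<in> crossings K" "tgt True p' = p" by (rule tgt_preimage[OF p])
  obtain q' where q': "q' \<in> crossings K" "tgt True q' = q" by (rule tgt_preimage[OF q])
  have "under_arc p' = under_arc q'" using eq over_arc_tgt[OF p'(1)] over_arc_tgt[OF q'(1)] p'(2) q'(2) by simp
  moreover obtain z where "z \<in> under_arc p'" using under_arc_ne[OF p'(1)] by blast
  ultimately have "p' = q'" using under_arc_disjoint[OF p'(1) q'(1)] by simp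
  then show "p = q" using p' q' by simp
qed

lemma opar_in_over_arc: "p \<in> crossings K \<Longrightarrow> 0 \<le> t \<Longrightarrow> t < gap (opar p) \<Longrightarrow> opar p * cis t \<in> over_arc p"
proof -
  assume p: "p \<in> crossings K" and t: "0 \<le> t" "t < gap (opar p)"
  obtain p' where p': "p' \<in> crossings K" "tgt True p' = p" by (rule tgt_preimage[OF p])
  show ?thesis using under_arc_second[OF p'(1), of t] over_arc_tgt[OF p'(1)] p'(2) t by simp
qed

lemma over_arc_in: "p \<in> crossings K \<Longrightarrow> over_arc p \<in> arcs K"
  using over_arc_image by blast

lemma arc_after_upar:
  assumes p: "p \<in> crossings K"
  shows "arc_after K (upar p) = over_arc (tgt True p)"
  unfolding arc_after_def
proof (rule the_equality)
  let ?c = "over_arc (tgt True p)"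
  have cin: "?c \<in> arcs K" using over_arc_in tgt_True[OF p] by simp
  have ev: "\<forall>\<^sub>F t in at_right 0. upar p * cis t \<in> ?c"
    using gap_pos[OF upar_P[OF p]] under_arc_first[OF p] over_arc_tgt[OF p]
    by (intro eventually_at_rightI[of 0 "gap (upar p)"]) auto
  show "?c \<in> arcs K \<and> (\<forall>\<^sub>F t in at_right 0. upar p * cis t \<in> ?c)" using cin ev by simp
  fix b assume b: "b \<in> arcs K \<and> (\<forall>\<^sub>F t in at_right 0. upar p * cis t \<in> b)"
  then have "\<forall>\<^sub>F t in at_right (0::real). upar p * cis t \<in> b \<and> upar p * cis t \<in> ?c"
    using ev by (intro eventually_conj) simp_all
  then obtain t :: real where "upar p * cis t \<in> b" "upar p * cis t \<in> ?c"
    using eventually_happens'[OF trivial_limit_at_right_real] by blast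
  then show "b = ?c" using arc_unique b cin by blast
qed

lemma arc_before_upar:
  assumes p: "p \<in> crossings K"
  shows "arc_before K (upar p) = over_arc (tgt False p)"
  unfolding arc_before_def
proof (rule the_equality)
  let ?c = "over_arc (tgt False p)"
  let ?y = "prv (upar p)"
  have q: "tgt False p \<in> crossings K" and y: "?y = opar (tgt False p)" using tgt_False[OF p] by simp_all
  have yP: "?y \<in> P" by (rule prv_in[OF upar_P[OF p]])
  have cin: "?c \<in> arcs K" using over_arc_in[OF q] .
  have mem: "upar p * cis t \<in> ?c" if t: "- gap ?y < t" "t < 0" for t
  proof -
    have "upar p = ?y * cis (gap ?y)" using nxt_prv[OF upar_P[OF p]] by (simp add: nxt_def)
    then have "upar p * cis t = ?y * cis (gap ?y) * cis t" by simp
    then have "upar p * cis t = opar (tgt False p) * cis (gap ?y + t)" by (simp add: rot_rot y)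
    then show ?thesis using opar_in_over_arc[OF q, of "gap ?y + t"] t y by simp
  qed
  have ev: "\<forall>\<^sub>F t in at_left 0. upar p * cis t \<in> ?c"
    using gap_pos[OF yP] mem by (intro eventually_at_leftI[of "- gap ?y"]) auto
  show "?c \<in> arcs K \<and> (\<forall>\<^sub>F t in at_left 0. upar p * cis t \<in> ?c)" using cin ev by simp
  fix b assume b: "b \<in> arcs K \<and> (\<forall>\<^sub>F t in at_left 0. upar p * cis t \<in> b)"
  then have "\<forall>\<^sub>F t in at_left (0::real). upar p * cis t \<in> b \<and> upar p * cis t \<in> ?c"
    using ev by (intro eventually_conj) simp_all
  then obtain t :: real where "upar p * cis t \<in> b" "upar p * cis t \<in> ?c"
    using eventually_happens'[OF trivial_limit_at_left_real] by blast
  then show "b = ?c" using arc_unique b cin by blast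
qed

text \<open>
  The arcs that end and start at the under-passage of \<open>c\<close> are those passing over the two neighbouring crossings.
\<close>

lemma fox_relators_eq:
  "fox_relators K = (\<lambda>c. frag_cmul 2 (frag_of (over_arc c)) - frag_of (over_arc (tgt False c)) - frag_of (over_arc (tgt True c))) ` crossings K"
proof (intro subset_antisym subsetI)
  fix r assume "r \<in> fox_relators K"
  then obtain x y a where r: "r = frag_cmul 2 (frag_of a) - frag_of (arc_before K x) - frag_of (arc_after K x)"
    and xy: "x \<in> circle" "y \<in> circle" "g x = g y" "knot_height K x < knot_height K y" and a: "a \<in> arcs K" "y \<in> a"
    unfolding fox_relators_def by blast
  have ux: "x \<in> under_params K"
    unfolding under_params_def by (intro CollectI conjI bexI[of _ y]) (use xy in simp_all)
  have oy: "y \<in> over_params K"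
    unfolding over_params_def by (intro CollectI conjI bexI[of _ x]) (use xy in simp_all)
  define p where "p = g x"
  have x: "x = upar p" and p: "p \<in> crossings K" using ux by (simp_all add: under_iff mem_P p_def)
  have y: "y = opar p" using oy xy(3) by (simp add: over_iff p_def)
  have "opar p \<in> over_arc p" using opar_in_over_arc[OF p, of 0] gap_pos[OF opar_P[OF p]] by simp
  then have "a = over_arc p" using arc_unique[OF a(1) over_arc_in[OF p]] a(2) y by blast
  then show "r \<in> (\<lambda>c. frag_cmul 2 (frag_of (over_arc c)) - frag_of (over_arc (tgt False c)) - frag_of (over_arc (tgt True c))) ` crossings K"
    unfolding r x arc_before_upar[OF p] arc_after_upar[OF p] using p by blast
next
  fix r assume "r \<in> (\<lambda>c. frag_cmul 2 (frag_of (over_arc c)) - frag_of (over_arc (tgt False c)) - frag_of (over_arc (tgt True c))) ` crossings K"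
  then obtain p where p: "p \<in> crossings K"
    and r: "r = frag_cmul 2 (frag_of (over_arc p)) - frag_of (over_arc (tgt False p)) - frag_of (over_arc (tgt True p))" by blast
  have "opar p \<in> over_arc p" using opar_in_over_arc[OF p, of 0] gap_pos[OF opar_P[OF p]] by simp
  moreover have "g (upar p) = g (opar p)" using upar_in[OF p] opar_in[OF p] by simp
  ultimately show "r \<in> fox_relators K"
    unfolding fox_relators_def mem_Collect_eq
    using r arc_before_upar[OF p] arc_after_upar[OF p] upar_in[OF p] opar_in[OF p] upar_opar(2)[OF p] over_arc_in[OF p]
    by (intro exI[of _ "upar p"] exI[of _ "opar p"] exI[of _ "over_arc p"]) simp
qed

theorem knot_det_eq_dimers:
  assumes bot: "bot_graph K \<Gamma>"
  shows "knot_det K = card (dimer_coverings \<Gamma>)"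
proof -
  obtain U F0 where U: "U \<in> faces K" "\<not> bounded U" and F0: "F0 \<in> faces K" "bounded F0"
    and adj: "adjacent_faces K F0 U" and \<Gamma>: "\<Gamma> = overlaid_graph K ({F \<in> faces K. bounded F} - {F0})"
    using bot unfolding bot_graph_def by blast
  obtain c a where c: "c \<in> crossings K" and EF: "M.EF c a = {F0, U}" by (rule adjacent_faces_edge[OF adj])
  have unb: "F = U" if F: "F \<in> faces K" "\<not> bounded F" for F
    using cobounded_unique_unbounded_components[of "- shadow K" U F] that U compact_imp_bounded[OF compact_shadow]
    unfolding faces_def by simp
  have W: "{F \<in> faces K. bounded F} - {F0} = M.Fs - M.EF c a"
    unfolding Fs_eq EF using unb U by blast
  have "knot_det K = card (M.face_matchings (M.Fs - M.EF c a))"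
    unfolding knot_det_def fox_module_def fox_relators_eq over_arc_image[symmetric]
    by (rule M.card_fox_torsion[OF count c over_arc_inj])
  also have "\<dots> = card (dimer_coverings (overlaid_graph K (M.Fs - M.EF c a)))"
    by (rule card_dimer_coverings[symmetric]) (simp add: Fs_eq)
  finally show ?thesis unfolding \<Gamma> W .
qed

end

section \<open>Diagrams without crossings and the main result\<close>

lemma knot_det_no_crossings:
  assumes no: "crossings K = {}"
  shows "knot_det K = 1"
proof -
  have R: "fox_relators K = {}"
  proof (rule ccontr)
    assume "fox_relators K \<noteq> {}"
    then obtain x y where xy: "x \<in> circle" "y \<in> circle" "knot_proj K x = knot_proj K y"
      "knot_height K x < knot_height K y"
      unfolding fox_relators_def by blast
    then have "x \<noteq> y" by auto
    then have "knot_proj K x \<in> crossings K"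
      unfolding crossings_def by (intro CollectI bexI[of _ x] bexI[of _ y]) (use xy in simp_all)
    then show False using no by simp
  qed
  let ?G = "free_Abelian_group (arcs K)"
  interpret G: group ?G by simp
  have H: "generate ?G {} = {0}" using G.generate_empty by simp
  have sub: "subgroup {0} ?G" using G.triv_subgroup by simp
  have "{x. Poly_Mapping.keys x \<subseteq> arcs K \<and> (\<exists>n::nat. n > 0 \<and> frag_cmul (int n) x \<in> {0})} = {0}"
    by (auto simp: frag_cmul_eq_0_iff)
  then have "torsion_part (fox_module K) = {{0} #>\<^bsub>?G\<^esub> 0}"
    unfolding fox_module_def R H torsion_part_free_quotient[OF sub] by simp
  then show ?thesis by (simp add: knot_det_def)
qed

text \<open>
  Without crossings the shadow is a simple closed curve.
\<close>

lemma bounded_face_unique_no_crossings: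
  assumes K: "regular_knot K" and no: "crossings K = {}"
    and F: "F \<in> faces K" "bounded F" and F': "F' \<in> faces K" "bounded F'"
  shows "F = F'"
proof -
  let ?g = "knot_proj K"
  define c where "c t = ?g (cis (2 * pi * t))" for t :: real
  have cont: "continuous_on circle ?g"
    using K unfolding regular_knot_def knot_proj_def by (intro continuous_intros) auto
  have inj: "z = w" if "z \<in> circle" "w \<in> circle" "?g z = ?g w" for z w
    using no that unfolding crossings_def by blast
  have path: "path c"
    unfolding path_def c_def by (rule continuous_on_compose2[OF cont]) (auto intro!: continuous_intros)
  have "simple_path c"
    unfolding simple_path_def loop_free_def
  proof (intro conjI ballI impI path)
    fix s t :: real assume st: "s \<in> {0..1}" "t \<in> {0..1}" "c s = c t"
    have "1 * cis (2 * pi * s) = 1 * cis (2 * pi * t)" using inj[of "cis (2 * pi * s)" "cis (2 * pi * t)"] st(3) by (simp add: c_def)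
    moreover have "\<bar>s - t\<bar> \<le> 1" using st by auto
    ultimately have "s = t" if "\<bar>s - t\<bar> \<noteq> 1"
    proof -
      have "\<bar>2 * pi * s - 2 * pi * t\<bar> = 2 * pi * \<bar>s - t\<bar>"
        by (simp add: right_diff_distrib[symmetric] abs_mult)
      also have "\<dots> < 2 * pi" using that \<open>\<bar>s - t\<bar> \<le> 1\<close> by simp
      finally have "2 * pi * s = 2 * pi * t"
        using \<open>1 * cis (2 * pi * s) = 1 * cis (2 * pi * t)\<close> by (intro rot_eq_imp[of 1]) simp_all
      then show ?thesis by simp
    qed
    then show "s = t \<or> s = 0 \<and> t = 1 \<or> s = 1 \<and> t = 0"
      using st(1,2) unfolding atLeastAtMost_iff by (smt (verit))
  qed
  moreover have "pathfinish c = pathstart c" by (simp add: pathfinish_def pathstart_def c_def)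
  ultimately have J: "connected (inside (path_image c))" "connected (outside (path_image c))"
    "\<not> bounded (outside (path_image c))" "inside (path_image c) \<noteq> {}"
    "inside (path_image c) \<union> outside (path_image c) = - path_image c"
    using Jordan_inside_outside[of c] by blast+
  have S: "shadow K = path_image c"
  proof -
    have "circle = (\<lambda>t. cis (2 * pi * t)) ` {0..1}"
    proof (intro subset_antisym subsetI)
      fix z :: complex assume z: "z \<in> circle"
      have "(1 :: complex) \<in> circle" by simp
      then obtain t where t: "0 < t" "t \<le> 2 * pi" "z = 1 * cis t" using z by (rule on_circle_rot)
      have "z = cis (2 * pi * (t / (2 * pi)))" using t(3) by simp
      moreover have "t / (2 * pi) \<in> {0..1}" using t by (auto simp: field_simps)
      ultimately show "z \<in> (\<lambda>t. cis (2 * pi * t)) ` {0..1}" by (rule image_eqI)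
    qed auto
    then show ?thesis unfolding shadow_def path_image_def c_def by (metis image_image)
  qed
  have in_eq: "G = inside (path_image c)" if G: "G \<in> faces K" "bounded G" for G
  proof -
    have comp: "G \<in> components (- path_image c)" using G(1) unfolding faces_def S .
    have sub: "outside (path_image c) \<subseteq> - path_image c" "inside (path_image c) \<subseteq> - path_image c" using J(5) by blast+
    have "outside (path_image c) \<inter> G = {}"
    proof (rule ccontr)
      assume "outside (path_image c) \<inter> G \<noteq> {}"
      then have "outside (path_image c) \<subseteq> G"
        using components_maximal[OF comp J(2) sub(1)] by blast
      then show False using G(2) J(3) bounded_subset by blast
    qed
    then have GI: "G \<subseteq> inside (path_image c)" using in_components_subset[OF comp] J(5) by blast
    moreover have "inside (path_image c) \<subseteq> G"
      using components_maximal[OF comp J(1) sub(2)] GI in_components_nonempty[OF comp] by blast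
    ultimately show ?thesis by blast
  qed
  show ?thesis using in_eq[OF F] in_eq[OF F'] by simp
qed

text \<open>
  A crossingless diagram is treated apart, because its circle carries no parameters of crossings to start from: its
  coloring module is free and the only bounded face is omitted.
\<close>

theorem corollary5p3:
  fixes K :: "complex \<Rightarrow> complex \<times> real"
    and \<Gamma> :: "(complex + complex set) graph"
  assumes "regular_knot K"
    and "reduced_diagram K"
    and "alternating_diagram K"
    and "bot_graph K \<Gamma>"
  shows "knot_det K = card (dimer_coverings \<Gamma>)"
proof (cases "crossings K = {}")
  case True
  obtain F0 where F0: "F0 \<in> faces K" "bounded F0" and \<Gamma>: "\<Gamma> = overlaid_graph K ({F \<in> faces K. bounded F} - {F0})"
    using assms(4) unfolding bot_graph_def by blast
  have "{F \<in> faces K. bounded F} - {F0} = {}"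
    using bounded_face_unique_no_crossings[OF assms(1) True _ _ F0] by blast
  then have "\<Gamma> = ({}, {})" unfolding \<Gamma> overlaid_graph_def using True by simp
  then have "dimer_coverings \<Gamma> = {{}}" unfolding dimer_coverings_def by auto
  then show ?thesis using knot_det_no_crossings[OF True] by simp
next
  case False
  interpret alternating_knot K
    by unfold_locales (use assms False crossing_parameters(1)[OF assms(1)] in simp_all)
  show ?thesis by (rule knot_det_eq_dimers[OF assms(4)])
qed

end
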